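(* Let $n\ge 1$ and let $\Gamma\subset E(n)=\mathrm{O}(n)\ltimes\mathbb{R}^n$ be a Bieberbach group whose holonomy representation $r(A,a)=A$ takes values in $\mathrm{SO}(n)$, so that $r\colon\Gamma\to\mathrm{SO}(n)$, and let $G=r(\Gamma)\subset\mathrm{SO}(n)$ be its holonomy group. Let $\varphi\colon G\to\mathrm{SO}(n)$ be a representation of $G$ that is equivalent over $\mathbb{R}$ to the identity map $\mathrm{id}\colon G\to G\subset\mathrm{SO}(n)$ (that is, there is $F\in\mathrm{GL}(n,\mathbb{R})$ with $\varphi(g)=FgF^{-1}$ for all $g\in G$). Then the set of spin structures on the flat manifold $\mathbb{R}^n/\Gamma$ is in bijection with the set of group homomorphisms $\varepsilon\colon\Gamma\to\mathrm{Spin}(n)$ such that $\lambda_n\circ\varepsilon=\varphi\circ r$.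
   Context: A Bieberbach group is a torsion-free, discrete and cocompact subgroup $\Gamma$ of the isometry group $E(n)=\mathrm{O}(n)\ltimes\mathbb{R}^n$ of Euclidean space; the quotient $\mathbb{R}^n/\Gamma$ is then a flat manifold (closed connected Riemannian manifold of zero sectional curvature). The holonomy representation sends $(A,a)\in\Gamma$ to its rotational part $A$; its image $G$ is a finite group. The Clifford algebra $C_n$ is the real associative unital algebra generated by $e_1,\dots,e_n$ with relations $e_i^2=-1$ and $e_ie_j=-e_je_i$ for $i\ne j$; $\mathbb{R}^n=\mathrm{span}\{e_1,\dots,e_n\}\subset C_n$. Let $^*$ be the linear map with $(e_{i_1}\cdots e_{i_k})^*=e_{i_k}\cdots e_{i_1}$ for $i_1<\dots<i_k$, let $'$ be the algebra automorphism with $e_i'=-e_i$, and $\overline{a}=(a')^*$. Then $\mathrm{Spin}(n)=\{x\in C_n : x'=x,\ x\overline{x}=1,\ xv\overline{x}\in\mathbb{R}^n \text{ for all } v\in\mathbb{R}^n\}$, and $\lambda_n\colon\mathrm{Spin}(n)\to\mathrm{SO}(n)$, $\lambda_n(x)v=xv\overline{x}$, is a continuous epimorphism with kernel $\{\pm1\}$. A spin structure on an oriented closed Riemannian $n$-manifold $X$ with principal $\mathrm{SO}(n)$-tangent bundle (oriented orthonormal frame bundle) $Q$ is a pair $(P,\Lambda)$, where $P$ is a principal $\mathrm{Spin}(n)$-bundle over $X$ and $\Lambda\colon P\to Q$ is a $2$-fold covering commuting with the projections to $X$ and satisfying $\Lambda(p\cdot x)=\Lambda(p)\cdot\lambda_n(x)$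 for $p\in P$, $x\in\mathrm{Spin}(n)$. Two spin structures $(P,\Lambda)$, $(P_1,\Lambda_1)$ are identified if there is an isomorphism of principal $\mathrm{Spin}(n)$-bundles $f\colon P\to P_1$ with $\Lambda_1\circ f=\Lambda$. On $\mathbb{R}^n/\Gamma$ one uses the flat metric and the orientation induced from $\mathbb{R}^n$. *)

theory Defs
  imports "HOL-Analysis.Analysis" "HOL-Algebra.Group_Action"
begin

section \<open>The real Clifford algebra\<close>

text \<open>
  The index type \<^typ>\<open>'n\<close> is an arbitrary finite linear order; \<open>n = CARD('n)\<close>.  The Clifford algebra
  is built on the vector space with coordinates indexed by the subsets of \<^typ>\<open>'n\<close>: the coordinate
  at \<open>S = {i\<^sub>1 < \<dots> < i\<^sub>k}\<close> belongs to the basis vector \<open>e\<^bsub>i\<^sub>1\<^esub> \<cdots> e\<^bsub>i\<^sub>k\<^esub>\<close>.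
\<close>

typedef 'n clifford = "UNIV :: (real, 'n::finite set) vec set"
  morphisms blade_coeffs Clifford
  by simp

lemmas blade_coeffs_Clifford [simp] = Clifford_inverse [OF UNIV_I]
lemmas Clifford_blade_coeffs [simp] = blade_coeffs_inverse

lemma clifford_eq_iff: "x = y \<longleftrightarrow> blade_coeffs x = blade_coeffs y"
  by (simp add: blade_coeffs_inject)

instantiation clifford :: (finite) real_vector
begin

definition zero_clifford :: "'a clifford" where "0 = Clifford 0"
definition plus_clifford :: "'a clifford \<Rightarrow> 'a clifford \<Rightarrow> 'a clifford"
  where "x + y = Clifford (blade_coeffs x + blade_coeffs y)"
definition minus_clifford :: "'a clifford \<Rightarrow> 'a clifford \<Rightarrow> 'a clifford"
  where "x - y = Clifford (blade_coeffs x - blade_coeffs y)"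
definition uminus_clifford :: "'a clifford \<Rightarrow> 'a clifford" where "- x = Clifford (- blade_coeffs x)"
definition scaleR_clifford :: "real \<Rightarrow> 'a clifford \<Rightarrow> 'a clifford"
  where "c *\<^sub>R x = Clifford (c *\<^sub>R blade_coeffs x)"

instance
  by standard
    (simp_all add: zero_clifford_def plus_clifford_def minus_clifford_def uminus_clifford_def
      scaleR_clifford_def scaleR_right_distrib scaleR_left_distrib add_ac)

end

lemma blade_coeffs_simps [simp]:
  "blade_coeffs 0 = 0" "blade_coeffs (x + y) = blade_coeffs x + blade_coeffs y" "blade_coeffs (x - y) = blade_coeffs x - blade_coeffs y"
  "blade_coeffs (- x) = - blade_coeffs x" "blade_coeffs (c *\<^sub>R x) = c *\<^sub>R blade_coeffs x"
  by (simp_all add: zero_clifford_def plus_clifford_def minus_clifford_def uminus_clifford_def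
      scaleR_clifford_def)

instantiation clifford :: (finite) real_inner
begin

definition inner_clifford :: "'a clifford \<Rightarrow> 'a clifford \<Rightarrow> real"
  where "inner x y = inner (blade_coeffs x) (blade_coeffs y)"
definition norm_clifford :: "'a clifford \<Rightarrow> real" where "norm x = norm (blade_coeffs x)"
definition dist_clifford :: "'a clifford \<Rightarrow> 'a clifford \<Rightarrow> real"
  where "dist x y = dist (blade_coeffs x) (blade_coeffs y)"
definition "sgn (x :: 'a clifford) = inverse (norm x) *\<^sub>R x"
definition uniformity_clifford :: "('a clifford \<times> 'a clifford) filter"
  where "uniformity = (INF e\<in>{0 <..}. principal {(x, y :: 'a clifford). dist x y < e})"
definition
  "open (U :: 'a clifford set) \<longleftrightarrow> (\<forall>x\<in>U. eventually (\<lambda>(x', y). x' = x \<longrightarrow> y \<in> U) uniformity)"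

instance
proof
  fix x y z :: "'a clifford" and a b :: real and U :: "'a clifford set"
  note defs = inner_clifford_def norm_clifford_def dist_clifford_def
  show "dist x y = norm (x - y)"
    by (simp add: defs dist_norm)
  show "sgn x = x /\<^sub>R norm x"
    by (rule sgn_clifford_def)
  show "(uniformity :: ('a clifford \<times> 'a clifford) filter) =
      (INF e\<in>{0 <..}. principal {(x, y). dist x y < e})"
    by (rule uniformity_clifford_def)
  show "open U \<longleftrightarrow> (\<forall>x\<in>U. eventually (\<lambda>(x', y). x' = x \<longrightarrow> y \<in> U) uniformity)"
    by (rule open_clifford_def)
  show "inner x y = inner y x" "inner (x + y) z = inner x z + inner y z"
    "inner (a *\<^sub>R x) y = a * inner x y" "0 \<le> inner x x"
    "norm x = sqrt (inner x x)"
    by (simp_all add: defs inner_left_distrib norm_eq_sqrt_inner) (rule inner_commute)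
  show "inner x x = 0 \<longleftrightarrow> x = 0"
    by (simp add: defs clifford_eq_iff)
qed

end

instantiation clifford :: (finite) euclidean_space
begin

definition Basis_clifford :: "'a clifford set" where "Basis = Clifford ` Basis"

instance
proof
  show "finite (Basis :: 'a clifford set)" "(Basis :: 'a clifford set) \<noteq> {}"
    by (simp_all add: Basis_clifford_def)
  fix x y :: "'a clifford"
  show "(\<forall>u\<in>Basis. inner x u = 0) \<longleftrightarrow> x = 0"
    using euclidean_all_zero_iff [of "blade_coeffs x"]
    by (simp add: Basis_clifford_def inner_clifford_def clifford_eq_iff)
  assume "x \<in> Basis" "y \<in> Basis"
  then show "inner x y = (if x = y then 1 else 0)"
    by (auto simp: Basis_clifford_def inner_clifford_def Clifford_inject inner_Basis)
qed

end

lemma blade_coeffs_sum [simp]: "blade_coeffs (sum f A) = (\<Sum>a\<in>A. blade_coeffs (f a))"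
  by (induction A rule: infinite_finite_induct) auto

definition blade :: "'n::finite set \<Rightarrow> 'n clifford" where
  "blade S = Clifford (axis S 1)"

lemma blade_expansion: "x = (\<Sum>S\<in>UNIV. blade_coeffs x $ S *\<^sub>R blade S)"
  by (simp add: clifford_eq_iff blade_def vec_eq_iff axis_def if_distrib sum.delta
      sum.delta' cong: if_cong)

text \<open>
  Reordering \<open>e\<^sub>S e\<^sub>T\<close> costs one sign for every pair \<open>t < s\<close> that has to be exchanged, and one sign
  \<open>e\<^sub>s e\<^sub>s = -1\<close> for every \<open>s = t\<close>.
\<close>

definition blade_sign :: "'n::{finite,linorder} set \<Rightarrow> 'n set \<Rightarrow> real" where
  "blade_sign S T = (\<Prod>s\<in>S. \<Prod>t\<in>T. if t \<le> s then -1 else 1)"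

lemma prod_sym_diff:
  fixes h :: "'n::finite \<Rightarrow> real"
  assumes "\<And>x. h x * h x = 1"
  shows "prod h (sym_diff S T) = prod h S * prod h T"
proof -
  have S: "prod h S = prod h (S - T) * prod h (S \<inter> T)"
    by (subst prod.union_disjoint [symmetric]) (auto intro!: prod.cong)
  have T: "prod h T = prod h (T - S) * prod h (S \<inter> T)"
    by (subst prod.union_disjoint [symmetric]) (auto intro!: prod.cong)
  have I: "prod h (S \<inter> T) * prod h (S \<inter> T) = 1"
    by (simp add: prod.distrib [symmetric] assms)
  have "prod h (sym_diff S T) = prod h (S - T) * prod h (T - S)"
    by (rule prod.union_disjoint) auto
  also have "\<dots> = prod h (S - T) * prod h (T - S) * (prod h (S \<inter> T) * prod h (S \<inter> T))"
    by (simp add: I)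
  also have "\<dots> = prod h S * prod h T"
    unfolding S T by (simp only: mult_ac)
  finally show ?thesis .
qed

lemma blade_sign_sym_diff:
  "blade_sign (sym_diff S T) U = blade_sign S U * blade_sign T U"
  "blade_sign S (sym_diff T U) = blade_sign S T * blade_sign S U"
proof -
  have sq: "(\<Prod>t\<in>U. if t \<le> s then - 1 else 1::real) * (\<Prod>t\<in>U. if t \<le> s then - 1 else 1) = 1"
    for s :: 'a and U
    by (simp add: prod.distrib [symmetric] if_distrib cong: if_cong)
  show "blade_sign (sym_diff S T) U = blade_sign S U * blade_sign T U"
    unfolding blade_sign_def by (rule prod_sym_diff) (rule sq)
  show "blade_sign S (sym_diff T U) = blade_sign S T * blade_sign S U"
    unfolding blade_sign_def by (subst prod_sym_diff) (auto simp: prod.distrib)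
qed

lemma blade_sign_empty [simp]: "blade_sign {} T = 1" "blade_sign S {} = 1"
  by (simp_all add: blade_sign_def)

instantiation clifford :: ("{finite,linorder}") real_algebra_1
begin

definition one_clifford :: "'a clifford" where "1 = blade {}"

definition times_clifford :: "'a clifford \<Rightarrow> 'a clifford \<Rightarrow> 'a clifford" where
  "x * y = (\<Sum>S\<in>UNIV. \<Sum>T\<in>UNIV.
  (blade_coeffs x $ S * blade_coeffs y $ T * blade_sign S T) *\<^sub>R blade (sym_diff S T))"

instance
proof
  fix x y z :: "'a clifford" and a :: real
  have add1: "(x + y) * z = x * z + y * z" for x y z :: "'a clifford"
    by (simp add: times_clifford_def distrib_right distrib_left scaleR_left_distrib sum.distrib)
  have add2: "z * (x + y) = z * x + z * y" for x y z :: "'a clifford"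
    by (simp add: times_clifford_def distrib_right distrib_left scaleR_left_distrib sum.distrib)
  have sc1: "a *\<^sub>R x * y = a *\<^sub>R (x * y)" for a and x y :: "'a clifford"
    by (simp add: times_clifford_def scaleR_sum_right mult.assoc)
  have sc2: "x * a *\<^sub>R y = a *\<^sub>R (x * y)" for a and x y :: "'a clifford"
    by (simp add: times_clifford_def scaleR_sum_right mult_ac)
  have z1: "0 * x = 0" "x * 0 = 0" for x :: "'a clifford"
    by (simp_all add: times_clifford_def)
  have s1: "(\<Sum>S\<in>UNIV. f S) * y = (\<Sum>S\<in>UNIV. f S * y)" for f :: "'a set \<Rightarrow> 'a clifford" and y
    by (rule Groups_Big.sum_comp_morphism [symmetric, unfolded o_def]) (auto simp: add1 z1)
  have s2: "y * (\<Sum>S\<in>UNIV. f S) = (\<Sum>S\<in>UNIV. y * f S)" for f :: "'a set \<Rightarrow> 'a clifford" and y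
    by (rule Groups_Big.sum_comp_morphism [symmetric, unfolded o_def]) (auto simp: add2 z1)
  have cb: "blade_coeffs (blade S) $ T = (if S = T then 1 else 0)" for S T :: "'a set"
    by (simp add: blade_def axis_def)
  have bl: "blade S * blade T = blade_sign S T *\<^sub>R blade (sym_diff S T)" for S T :: "'a set"
  proof -
    have "blade S * blade T = (\<Sum>S'\<in>UNIV. \<Sum>T'\<in>UNIV. if T' = T then if S' = S then
        blade_sign S T *\<^sub>R blade (sym_diff S T) else 0 else 0)"
      unfolding times_clifford_def by (intro sum.cong refl) (auto simp: cb)
    then show ?thesis by (simp add: sum.delta)
  qed
  have sd: "sym_diff (sym_diff S T) U = sym_diff S (sym_diff T U)" for S T U :: "'a set"
    by blast
  have abl: "blade S * blade T * blade U = blade S * (blade T * blade U)" for S T U :: "'a set"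
    by (simp only: bl sc1 sc2 scaleR_scaleR blade_sign_sym_diff sd mult_ac)
  have "(\<Sum>S\<in>UNIV. blade_coeffs x $ S *\<^sub>R blade S) * (\<Sum>S\<in>UNIV. blade_coeffs y $ S *\<^sub>R blade S) *
      (\<Sum>S\<in>UNIV. blade_coeffs z $ S *\<^sub>R blade S) =
    (\<Sum>S\<in>UNIV. blade_coeffs x $ S *\<^sub>R blade S) * ((\<Sum>S\<in>UNIV. blade_coeffs y $ S *\<^sub>R blade S) *
      (\<Sum>S\<in>UNIV. blade_coeffs z $ S *\<^sub>R blade S))"
    by (simp only: s1 s2 sc1 sc2 abl)
  then show "x * y * z = x * (y * z)"
    by (simp only: blade_expansion [symmetric])
  show "(x + y) * z = x * z + y * z" "z * (x + y) = z * x + z * y"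
    "a *\<^sub>R x * y = a *\<^sub>R (x * y)" "x * a *\<^sub>R y = a *\<^sub>R (x * y)"
    by (rule add1 add2 sc1 sc2)+
  have "1 * (\<Sum>S\<in>UNIV. blade_coeffs x $ S *\<^sub>R blade S) = (\<Sum>S\<in>UNIV. blade_coeffs x $ S *\<^sub>R blade S)"
    by (simp add: s2 sc2 one_clifford_def bl)
  then show "1 * x = x"
    by (simp only: blade_expansion [symmetric])
  have "(\<Sum>S\<in>UNIV. blade_coeffs x $ S *\<^sub>R blade S) * 1 = (\<Sum>S\<in>UNIV. blade_coeffs x $ S *\<^sub>R blade S)"
    by (simp add: s1 sc1 one_clifford_def bl)
  then show "x * 1 = x"
    by (simp only: blade_expansion [symmetric])
  show "(0 :: 'a clifford) \<noteq> 1"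
    by (auto simp: clifford_eq_iff one_clifford_def blade_def axis_eq_0_iff)
qed

end

lemma blade_coeffs_blade [simp]: "blade_coeffs (blade S) $ T = (if S = T then 1 else 0)"
  by (simp add: blade_def axis_def)

lemma blade_mult: "blade S * blade T = blade_sign S T *\<^sub>R blade (sym_diff S T)"
proof -
  have "blade S * blade T = (\<Sum>S'\<in>UNIV. \<Sum>T'\<in>UNIV. if T' = T then if S' = S then
      blade_sign S T *\<^sub>R blade (sym_diff S T) else 0 else 0)"
    unfolding times_clifford_def by (intro sum.cong refl) auto
  then show ?thesis by (simp add: sum.delta)
qed

definition gen :: "'n::finite \<Rightarrow> 'n clifford" where
  "gen i = blade {i}"

lemma gen_sq: "gen i * gen i = - 1"
  by (simp add: gen_def blade_mult blade_sign_def one_clifford_def)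

lemma gen_anticommute: "i \<noteq> j \<Longrightarrow> gen i * gen j = - (gen j * gen i)"
  by (cases "i < j") (auto simp: gen_def blade_mult blade_sign_def Un_commute)

definition ordered_prod :: "('n::{finite,linorder} \<Rightarrow> 'a::monoid_mult) \<Rightarrow> 'n set \<Rightarrow> 'a" where
  "ordered_prod f S = prod_list (map f (sorted_list_of_set S))"

lemma ordered_prod_empty [simp]: "ordered_prod f {} = 1"
  by (simp add: ordered_prod_def)

lemma ordered_prod_insert_max:
  assumes "\<forall>s\<in>S. s < m"
  shows "ordered_prod f (insert m S) = ordered_prod f S * f m"
proof -
  have "sorted (sorted_list_of_set S @ [m])" "distinct (sorted_list_of_set S @ [m])"
    "set (sorted_list_of_set S @ [m]) = insert m S"
    using assms by (auto simp: sorted_append)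
  then have eq: "sorted_list_of_set (insert m S) = sorted_list_of_set S @ [m]"
    by (metis sorted_list_of_set.idem_if_sorted_distinct)
  show ?thesis
    unfolding ordered_prod_def eq by simp
qed

lemma ordered_prod_insert_min:
  assumes "\<forall>s\<in>S. m < s"
  shows "ordered_prod f (insert m S) = f m * ordered_prod f S"
proof -
  have "sorted (m # sorted_list_of_set S)" "distinct (m # sorted_list_of_set S)"
    "set (m # sorted_list_of_set S) = insert m S"
    using assms by (auto simp: sorted_append)
  then have eq: "sorted_list_of_set (insert m S) = m # sorted_list_of_set S"
    by (metis sorted_list_of_set.idem_if_sorted_distinct)
  show ?thesis
    unfolding ordered_prod_def eq by simp
qed

context
  fixes f :: "'n::{finite,linorder} \<Rightarrow> 'a::real_algebra_1"
  assumes sq: "\<And>i. f i * f i = - 1"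
    and anticommute: "\<And>i j. i \<noteq> j \<Longrightarrow> f i * f j = - (f j * f i)"
begin

lemma times_ordered_prod:
  "f m * ordered_prod f T = blade_sign {m} T *\<^sub>R ordered_prod f (sym_diff {m} T)"
proof -
  have "finite T" by simp
  then show ?thesis
  proof (induction T rule: finite_linorder_min_induct)
    case empty
    show ?case by (simp add: ordered_prod_insert_min [of "{}", simplified])
  next
    case (insert b A)
    have bA: "b \<notin> A" using insert.hyps by blast
    consider "m < b" | "m = b" | "b < m" by force
    then show ?case
    proof cases
      case 1
      have eq: "sym_diff {m} (insert b A) = insert m (insert b A)"
        using 1 insert.hyps by (auto dest: less_trans)
      have "blade_sign {m} (insert b A) = 1"
        using 1 insert.hyps by (auto simp: blade_sign_def intro!: prod.neutral)
      moreover have "\<forall>s\<in>insert b A. m < s"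
        using 1 insert.hyps by (auto dest: less_trans)
      ultimately show ?thesis
        unfolding eq by (simp add: ordered_prod_insert_min [of "insert b A"])
    next
      case 2
      have eq: "sym_diff {m} (insert b A) = A"
        using 2 bA by auto
      have "blade_sign {m} A = 1"
        using 2 insert.hyps by (auto simp: blade_sign_def intro!: prod.neutral)
      then have "blade_sign {m} (insert b A) = - 1"
        using 2 bA by (simp add: blade_sign_def)
      moreover have "f m * ordered_prod f (insert b A) = f m * f m * ordered_prod f A"
        using 2 insert.hyps by (simp add: ordered_prod_insert_min mult.assoc)
      ultimately show ?thesis
        by (simp only: eq sq) simp
    next
      case 3
      have eq: "sym_diff {m} (insert b A) = insert b (sym_diff {m} A)"
        using 3 bA by auto
      have "f m * ordered_prod f (insert b A) = f m * f b * ordered_prod f A"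
        using insert.hyps by (simp add: ordered_prod_insert_min mult.assoc)
      also have "\<dots> = - (f b * (f m * ordered_prod f A))"
        using 3 by (subst anticommute) (auto simp: mult.assoc)
      also have "\<dots> = - (blade_sign {m} A *\<^sub>R (f b * ordered_prod f (sym_diff {m} A)))"
        by (simp only: insert.IH mult_scaleR_right)
      also have "f b * ordered_prod f (sym_diff {m} A) = ordered_prod f (insert b (sym_diff {m} A))"
        using 3 insert.hyps by (intro ordered_prod_insert_min [symmetric]) auto
      also have "- (blade_sign {m} A *\<^sub>R ordered_prod f (insert b (sym_diff {m} A))) =
          blade_sign {m} (insert b A) *\<^sub>R ordered_prod f (insert b (sym_diff {m} A))"
        using 3 bA by (simp add: blade_sign_def less_imp_le)
      finally show ?thesis by (simp only: eq)
    qed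
  qed
qed

lemma ordered_prod_mult:
  "ordered_prod f S * ordered_prod f T = blade_sign S T *\<^sub>R ordered_prod f (sym_diff S T)"
proof -
  have "finite S" by simp
  then show ?thesis
  proof (induction S arbitrary: T rule: finite_linorder_max_induct)
    case empty
    show ?case by simp
  next
    case (insert m S)
    have mS: "m \<notin> S" using insert.hyps by blast
    have eq: "sym_diff S (sym_diff {m} T) = sym_diff (insert m S) T"
      using mS by auto
    have "blade_sign S {m} = 1"
      using insert.hyps by (auto simp: blade_sign_def intro!: prod.neutral)
    then have sg: "blade_sign {m} T * blade_sign S (sym_diff {m} T) = blade_sign (insert m S) T"
      using mS by (simp only: blade_sign_sym_diff(2)) (simp add: blade_sign_def)
    have "ordered_prod f (insert m S) * ordered_prod f T =
        ordered_prod f S * (f m * ordered_prod f T)"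
      using insert.hyps by (simp add: ordered_prod_insert_max mult.assoc)
    also have "\<dots> = blade_sign {m} T *\<^sub>R (ordered_prod f S * ordered_prod f (sym_diff {m} T))"
      by (simp only: times_ordered_prod mult_scaleR_right)
    also have "\<dots> = blade_sign (insert m S) T *\<^sub>R ordered_prod f (sym_diff (insert m S) T)"
      by (simp only: insert.IH scaleR_scaleR eq sg)
    finally show ?case .
  qed
qed

end

lemma blade_eq_ordered_prod: "blade S = ordered_prod gen S"
proof -
  have "finite S" by simp
  then show ?thesis
  proof (induction S rule: finite_linorder_max_induct)
    case empty
    show ?case by (simp add: one_clifford_def)
  next
    case (insert m S)
    have mS: "m \<notin> S" using insert.hyps by blast
    have "blade_sign S {m} = 1"
      using insert.hyps by (auto simp: blade_sign_def intro!: prod.neutral)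
    moreover have "sym_diff S {m} = insert m S"
      using mS by auto
    ultimately have "blade S * gen m = blade (insert m S)"
      by (simp add: gen_def blade_mult)
    then show ?case
      using insert by (simp add: ordered_prod_insert_max)
  qed
qed

definition clifford_lift :: "('n::{finite,linorder} \<Rightarrow> 'a::real_algebra_1) \<Rightarrow> 'n clifford \<Rightarrow> 'a" where
  "clifford_lift f x = (\<Sum>S\<in>UNIV. blade_coeffs x $ S *\<^sub>R ordered_prod f S)"

lemma linear_clifford_lift: "linear (clifford_lift f)"
  by (rule linearI) (simp_all add: clifford_lift_def scaleR_left_distrib sum.distrib scaleR_sum_right)

lemma clifford_lift_blade [simp]: "clifford_lift f (blade S) = ordered_prod f S"
  by (simp add: clifford_lift_def if_distrib [of "\<lambda>c. c *\<^sub>R _"] sum.delta cong: if_cong)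

lemma clifford_lift_gen [simp]: "clifford_lift f (gen i) = f i"
  by (simp add: gen_def ordered_prod_def)

lemma clifford_lift_one [simp]: "clifford_lift f 1 = 1"
  by (simp add: one_clifford_def)

lemma clifford_lift_mult:
  assumes "\<And>i. f i * f i = - 1" "\<And>i j. i \<noteq> j \<Longrightarrow> f i * f j = - (f j * f i)"
  shows "clifford_lift f (x * y) = clifford_lift f x * clifford_lift f y"
proof -
  interpret linear "clifford_lift f" by (rule linear_clifford_lift)
  have "clifford_lift f ((\<Sum>S\<in>UNIV. blade_coeffs x $ S *\<^sub>R blade S) *
      (\<Sum>S\<in>UNIV. blade_coeffs y $ S *\<^sub>R blade S)) =
    clifford_lift f (\<Sum>S\<in>UNIV. blade_coeffs x $ S *\<^sub>R blade S) *
      clifford_lift f (\<Sum>S\<in>UNIV. blade_coeffs y $ S *\<^sub>R blade S)"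
    by (simp add: sum_distrib_left sum_distrib_right sum scale blade_mult
        ordered_prod_mult [OF assms] mult.commute)
  then show ?thesis
    by (simp only: blade_expansion [symmetric])
qed

text \<open>
  The universal property: \<^typ>\<open>'n clifford\<close> is the unital real algebra generated by the \<^term>\<open>gen i\<close>
  subject to exactly the Clifford relations.
\<close>

theorem clifford_universal:
  fixes f :: "'n::{finite,linorder} \<Rightarrow> 'a::real_algebra_1"
  assumes "\<And>i. f i * f i = - 1" "\<And>i j. i \<noteq> j \<Longrightarrow> f i * f j = - (f j * f i)"
  shows "\<exists>!h. linear h \<and> h 1 = 1 \<and> (\<forall>x y. h (x * y) = h x * h y) \<and> (\<forall>i. h (gen i) = f i)"
proof (rule ex1I [of _ "clifford_lift f"])
  show "linear (clifford_lift f) \<and> clifford_lift f 1 = 1 \<and>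
    (\<forall>x y. clifford_lift f (x * y) = clifford_lift f x * clifford_lift f y) \<and>
    (\<forall>i. clifford_lift f (gen i) = f i)"
    by (simp add: linear_clifford_lift clifford_lift_mult [OF assms])
next
  fix h :: "'n clifford \<Rightarrow> 'a"
  assume h: "linear h \<and> h 1 = 1 \<and> (\<forall>x y. h (x * y) = h x * h y) \<and> (\<forall>i. h (gen i) = f i)"
  have "h (prod_list (map gen xs)) = prod_list (map f xs)" for xs
    using h by (induction xs) auto
  then have blade: "h (blade S) = ordered_prod f S" for S
    by (simp add: blade_eq_ordered_prod ordered_prod_def)
  show "h = clifford_lift f"
  proof
    fix x
    interpret linear h using h by simp
    have "h (\<Sum>S\<in>UNIV. blade_coeffs x $ S *\<^sub>R blade S) = clifford_lift f x"
      by (simp add: sum scale blade clifford_lift_def)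
    then show "h x = clifford_lift f x"
      by (simp only: blade_expansion [symmetric])
  qed
qed

section \<open>The spin group\<close>

definition grade_involution :: "'n::{finite,linorder} clifford \<Rightarrow> 'n clifford" where
  "grade_involution = clifford_lift (\<lambda>i. - gen i)"

lemma grade_involution_simps:
  "linear grade_involution" "grade_involution 1 = 1"
  "grade_involution (x * y) = grade_involution x * grade_involution y"
  "grade_involution (gen i) = - gen i"
proof -
  show "grade_involution (x * y) = grade_involution x * grade_involution y"
    unfolding grade_involution_def
    by (rule clifford_lift_mult) (auto simp: gen_sq intro: gen_anticommute)
qed (simp_all add: grade_involution_def linear_clifford_lift)

definition reversal :: "'n::{finite,linorder} clifford \<Rightarrow> 'n clifford" where
  "reversal x =
    (\<Sum>S\<in>UNIV. blade_coeffs x $ S *\<^sub>R prod_list (map gen (rev (sorted_list_of_set S))))"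

lemma linear_reversal: "linear reversal"
  by (rule linearI) (simp_all add: reversal_def scaleR_left_distrib sum.distrib scaleR_sum_right)

lemma reversal_sorted_prod:
  assumes "sorted xs" "distinct xs"
  shows "reversal (prod_list (map gen xs)) = prod_list (map gen (rev xs))"
proof -
  have xs: "sorted_list_of_set (set xs) = xs"
    using assms by (simp add: sorted_list_of_set.idem_if_sorted_distinct)
  have "prod_list (map gen xs) = blade (set xs)"
    by (simp add: blade_eq_ordered_prod ordered_prod_def xs)
  then show ?thesis
    by (simp add: reversal_def if_distrib [of "\<lambda>c. c *\<^sub>R _"] sum.delta xs cong: if_cong)
qed

definition clifford_conj :: "'n::{finite,linorder} clifford \<Rightarrow> 'n clifford" where
  "clifford_conj x = reversal (grade_involution x)"

definition cvec :: "real ^ 'n \<Rightarrow> 'n::finite clifford" where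
  "cvec v = (\<Sum>i\<in>UNIV. v $ i *\<^sub>R gen i)"

lemma inj_cvec: "inj cvec"
proof
  fix v w :: "real ^ 'n"
  assume "cvec v = cvec w"
  moreover have "blade_coeffs (cvec u) $ {i} = u $ i" for u :: "real ^ 'n" and i
    by (simp add: cvec_def gen_def if_distrib sum.delta sum.delta' cong: if_cong)
  ultimately show "v = w"
    by (metis vec_eq_iff)
qed

definition Spin :: "'n::{finite,linorder} clifford set" where
  "Spin = {x. grade_involution x = x \<and> x * clifford_conj x = 1 \<and>
              (\<forall>v. x * cvec v * clifford_conj x \<in> range cvec)}"

definition spin_group :: "'n::{finite,linorder} clifford monoid" where
  "spin_group = \<lparr>carrier = Spin, monoid.mult = (*), one = 1\<rparr>"

definition SO_group :: "(real ^ 'n ^ 'n::finite) monoid" where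
  "SO_group = \<lparr>carrier = {A. rotation_matrix A}, monoid.mult = (**), one = mat 1\<rparr>"

definition spin_cover :: "'n::{finite,linorder} clifford \<Rightarrow> real ^ 'n::_ ^ 'n::_" where
  "spin_cover x = matrix (\<lambda>v. the_inv cvec (x * cvec v * clifford_conj x))"

lemma group_SO_group: "group (SO_group :: (real ^ 'n ^ 'n::finite) monoid)"
proof (rule groupI)
  fix A :: "real ^ 'n ^ 'n"
  assume "A \<in> carrier SO_group"
  then have "transpose A \<in> carrier SO_group" "transpose A ** A = mat 1"
    by (simp_all add: SO_group_def rotation_matrix_def orthogonal_matrix_transpose
        det_transpose orthogonal_matrix_def)
  then show "\<exists>B\<in>carrier SO_group. B \<otimes>\<^bsub>SO_group\<^esub> A = \<one>\<^bsub>SO_group\<^esub>"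
    by (auto simp: SO_group_def)
qed (auto simp: SO_group_def rotation_matrix_def orthogonal_matrix_mul orthogonal_matrix_id
    det_mul matrix_mul_assoc)

section \<open>Bieberbach groups and flat manifolds\<close>

type_synonym 'n motion = "(real ^ 'n ^ 'n) \<times> (real ^ 'n)"

definition euclidean_group :: "'n::finite motion monoid" where
  "euclidean_group =
    \<lparr>carrier = {(A, a). orthogonal_matrix A},
     monoid.mult = (\<lambda>(A, a) (B, b). (A ** B, A *v b + a)),
     one = (mat 1, 0)\<rparr>"

definition motion_apply :: "'n::finite motion \<Rightarrow> real ^ 'n \<Rightarrow> real ^ 'n" where
  "motion_apply = (\<lambda>(A, a) x. A *v x + a)"

lemma group_euclidean_group: "group (euclidean_group :: 'n::finite motion monoid)"
proof (rule groupI)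
  fix g :: "'n motion"
  assume "g \<in> carrier euclidean_group"
  then obtain A a where g: "g = (A, a)" "orthogonal_matrix A"
    by (auto simp: euclidean_group_def)
  then have "(transpose A, - (transpose A *v a)) \<in> carrier euclidean_group"
    "(transpose A, - (transpose A *v a)) \<otimes>\<^bsub>euclidean_group\<^esub> g = \<one>\<^bsub>euclidean_group\<^esub>"
    by (simp_all add: euclidean_group_def orthogonal_matrix_transpose)
      (simp_all add: orthogonal_matrix_def)
  then show "\<exists>h\<in>carrier euclidean_group. h \<otimes>\<^bsub>euclidean_group\<^esub> g = \<one>\<^bsub>euclidean_group\<^esub>"
    by blast
qed (auto simp: euclidean_group_def orthogonal_matrix_mul orthogonal_matrix_id matrix_mul_assoc
    matrix_vector_mul_assoc matrix_vector_right_distrib algebra_simps)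

definition orbit_space :: "('g, 'm) monoid_scheme \<Rightarrow> ('g \<Rightarrow> 'x \<Rightarrow> 'x) \<Rightarrow> 'x topology \<Rightarrow> 'x set topology" where
  "orbit_space G \<phi> T = topology (\<lambda>\<U>. \<U> \<subseteq> orbits G (topspace T) \<phi> \<and>
    openin T {x \<in> topspace T. orbit G \<phi> x \<in> \<U>})"

lemma openin_orbit_space:
  "openin (orbit_space G \<phi> T) \<U> \<longleftrightarrow>
    \<U> \<subseteq> orbits G (topspace T) \<phi> \<and> openin T {x \<in> topspace T. orbit G \<phi> x \<in> \<U>}"
proof -
  have "istopology (\<lambda>\<U>. \<U> \<subseteq> orbits G (topspace T) \<phi> \<and>
      openin T {x \<in> topspace T. orbit G \<phi> x \<in> \<U>})" (is "istopology ?P")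
    unfolding istopology_def
  proof (intro conjI allI impI)
    fix U V
    assume UV: "?P U" "?P V"
    have "{x \<in> topspace T. orbit G \<phi> x \<in> U \<inter> V} =
        {x \<in> topspace T. orbit G \<phi> x \<in> U} \<inter> {x \<in> topspace T. orbit G \<phi> x \<in> V}"
      by blast
    with UV show "U \<inter> V \<subseteq> orbits G (topspace T) \<phi>"
      "openin T {x \<in> topspace T. orbit G \<phi> x \<in> U \<inter> V}"
      by auto
  next
    fix \<K>
    assume K: "\<forall>U\<in>\<K>. ?P U"
    have "{x \<in> topspace T. orbit G \<phi> x \<in> \<Union>\<K>} =
        (\<Union>U\<in>\<K>. {x \<in> topspace T. orbit G \<phi> x \<in> U})"
      by blast
    with K show "\<Union>\<K> \<subseteq> orbits G (topspace T) \<phi>"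
      "openin T {x \<in> topspace T. orbit G \<phi> x \<in> \<Union>\<K>}"
      by auto
  qed
  then show ?thesis
    by (simp add: orbit_space_def)
qed

lemma topspace_orbit_space: "topspace (orbit_space G \<phi> T) = orbits G (topspace T) \<phi>"
proof (rule topspace_def [THEN trans], rule equalityI)
  show "\<Union>{U. openin (orbit_space G \<phi> T) U} \<subseteq> orbits G (topspace T) \<phi>"
    by (auto simp: openin_orbit_space)
  have "{x \<in> topspace T. orbit G \<phi> x \<in> orbits G (topspace T) \<phi>} = topspace T"
    by (auto simp: orbits_def)
  then have "openin (orbit_space G \<phi> T) (orbits G (topspace T) \<phi>)"
    by (simp add: openin_orbit_space)
  then show "orbits G (topspace T) \<phi> \<subseteq> \<Union>{U. openin (orbit_space G \<phi> T) U}"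
    by blast
qed

lemma quotient_map_orbit: "quotient_map T (orbit_space G \<phi> T) (orbit G \<phi>)"
proof -
  have "orbit G \<phi> ` topspace T = orbits G (topspace T) \<phi>"
    by (auto simp: orbits_def)
  then show ?thesis
    by (simp add: quotient_map_def topspace_orbit_space openin_orbit_space)
qed

definition torsion_free :: "('g, 'm) monoid_scheme \<Rightarrow> bool" where
  "torsion_free G \<longleftrightarrow>
    (\<forall>g\<in>carrier G. \<forall>k::nat. k > 0 \<longrightarrow> g [^]\<^bsub>G\<^esub> k = \<one>\<^bsub>G\<^esub> \<longrightarrow> g = \<one>\<^bsub>G\<^esub>)"

definition bieberbach :: "'n::finite motion set \<Rightarrow> bool" where
  "bieberbach \<Gamma> \<longleftrightarrow>
    subgroup \<Gamma> euclidean_group \<and>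
    torsion_free (euclidean_group\<lparr>carrier := \<Gamma>\<rparr>) \<and>
    discrete \<Gamma> \<and>
    compact_space (orbit_space (euclidean_group\<lparr>carrier := \<Gamma>\<rparr>) (monoid.mult euclidean_group)
      (top_of_set (carrier euclidean_group)))"

definition holonomy :: "'n::finite motion set \<Rightarrow> (real ^ 'n ^ 'n) set" where
  "holonomy \<Gamma> = fst ` \<Gamma>"

definition flat_manifold :: "'n::finite motion set \<Rightarrow> (real ^ 'n) set topology" where
  "flat_manifold \<Gamma> = orbit_space (euclidean_group\<lparr>carrier := \<Gamma>\<rparr>) motion_apply euclidean"

section \<open>Principal bundles and spin structures\<close>

record ('p, 'x, 'g) bundle_data =
  total_space :: "'p topology"
  projection :: "'p \<Rightarrow> 'x"
  right_action :: "'p \<Rightarrow> 'g \<Rightarrow> 'p"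

definition principal_bundle ::
    "'g::topological_space monoid \<Rightarrow> 'x topology \<Rightarrow> ('p, 'x, 'g) bundle_data \<Rightarrow> bool" where
  "principal_bundle G X P \<longleftrightarrow>
    continuous_map (total_space P) X (projection P) \<and>
    continuous_map (prod_topology (total_space P) (top_of_set (carrier G))) (total_space P)
      (\<lambda>(p, g). right_action P p g) \<and>
    (\<forall>p\<in>topspace (total_space P).
      right_action P p \<one>\<^bsub>G\<^esub> = p \<and>
      (\<forall>g\<in>carrier G. projection P (right_action P p g) = projection P p \<and>
        (\<forall>h\<in>carrier G.
          right_action P (right_action P p g) h = right_action P p (g \<otimes>\<^bsub>G\<^esub> h)))) \<and>
    (\<forall>x\<in>topspace X. \<exists>U \<tau>. openin X U \<and> x \<in> U \<and>
      homeomorphic_map (prod_topology (subtopology X U) (top_of_set (carrier G)))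
        (subtopology (total_space P) {p \<in> topspace (total_space P). projection P p \<in> U}) \<tau> \<and>
      (\<forall>y\<in>U. \<forall>g\<in>carrier G. projection P (\<tau> (y, g)) = y \<and>
        (\<forall>h\<in>carrier G. \<tau> (y, g \<otimes>\<^bsub>G\<^esub> h) = right_action P (\<tau> (y, g)) h)))"

text \<open>
  A frame of Euclidean space is a pair of a base point and a matrix whose columns are the frame
  vectors.  The differential of a motion \<open>(A, a)\<close> sends \<open>(x, B)\<close> to \<open>(A x + a, A B)\<close>.  As the
  projection to the flat manifold is a local isometry preserving the orientation, a positively
  oriented orthonormal frame of the flat manifold is an orbit of such frames of Euclidean space;
  a rotation \<open>C\<close> acts on \<open>B\<close> from the right.
\<close>

type_synonym 'n frame = "(real ^ 'n) \<times> (real ^ 'n ^ 'n)"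

definition motion_frame :: "'n::finite motion \<Rightarrow> 'n frame \<Rightarrow> 'n frame" where
  "motion_frame = (\<lambda>(A, a) (x, B). (A *v x + a, A ** B))"

definition frame_bundle ::
    "'n::finite motion set \<Rightarrow> ('n frame set, (real ^ 'n) set, real ^ 'n ^ 'n) bundle_data" where
  "frame_bundle \<Gamma> =
    \<lparr>total_space = orbit_space (euclidean_group\<lparr>carrier := \<Gamma>\<rparr>) motion_frame
       (prod_topology euclidean (top_of_set (carrier SO_group))),
     projection = (\<lambda>q. fst ` q),
     right_action = (\<lambda>q C. (\<lambda>(x, B). (x, B ** C)) ` q)\<rparr>"

definition two_fold_covering :: "'p topology \<Rightarrow> 'q topology \<Rightarrow> ('p \<Rightarrow> 'q) \<Rightarrow> bool" where
  "two_fold_covering P Q \<Lambda> \<longleftrightarrow>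
    continuous_map P Q \<Lambda> \<and>
    (\<forall>q\<in>topspace Q. card {p \<in> topspace P. \<Lambda> p = q} = 2 \<and>
      (\<exists>T. openin Q T \<and> q \<in> T \<and>
        (\<exists>\<V>. \<Union>\<V> = {p \<in> topspace P. \<Lambda> p \<in> T} \<and> pairwise disjnt \<V> \<and>
          (\<forall>V\<in>\<V>. openin P V \<and> homeomorphic_map (subtopology P V) (subtopology Q T) \<Lambda>))))"

text \<open>
  Bundles are topological.  For a smooth \<open>Q\<close> this is no loss: a covering space of \<open>Q\<close> carries a unique
  smooth structure for which \<open>\<Lambda>\<close> is a local diffeomorphism, and the action and all isomorphisms are
  smooth for it, because they cover smooth maps.
\<close>

definition spin_structure ::
    "'x topology \<Rightarrow> ('q, 'x, real ^ 'n::_ ^ 'n::_) bundle_data \<Rightarrow>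
     ('p, 'x, 'n::{finite,linorder} clifford) bundle_data \<times> ('p \<Rightarrow> 'q) \<Rightarrow> bool" where
  "spin_structure X Q = (\<lambda>(P, \<Lambda>).
    principal_bundle spin_group X P \<and>
    two_fold_covering (total_space P) (total_space Q) \<Lambda> \<and>
    (\<forall>p\<in>topspace (total_space P). projection Q (\<Lambda> p) = projection P p \<and>
      (\<forall>x\<in>Spin. \<Lambda> (right_action P p x) = right_action Q (\<Lambda> p) (spin_cover x))))"

definition spin_isomorphic ::
    "('p, 'x, 'n::{finite,linorder} clifford) bundle_data \<times> ('p \<Rightarrow> 'q) \<Rightarrow>
     ('r, 'x, 'n clifford) bundle_data \<times> ('r \<Rightarrow> 'q) \<Rightarrow> bool" where
  "spin_isomorphic = (\<lambda>(P, \<Lambda>) (P\<^sub>1, \<Lambda>\<^sub>1).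
    \<exists>f. homeomorphic_map (total_space P) (total_space P\<^sub>1) f \<and>
      (\<forall>p\<in>topspace (total_space P).
        projection P\<^sub>1 (f p) = projection P p \<and> \<Lambda>\<^sub>1 (f p) = \<Lambda> p \<and>
        (\<forall>x\<in>Spin. f (right_action P p x) = right_action P\<^sub>1 (f p) x)))"

text \<open>
  The total space of a spin structure may have points of any type.  In order to form the set of
  all isomorphism classes, the points are taken from \<open>'q \<times> bool\<close>, where \<open>'q\<close> is the type of the
  points of \<open>Q\<close>.  No isomorphism class is lost, see \<open>spin_structure_universe\<close> below.
\<close>

definition spin_structure_classes ::
    "'x topology \<Rightarrow> ('q, 'x, real ^ 'n::_ ^ 'n::_) bundle_data \<Rightarrow>
     (('q \<times> bool, 'x, 'n::{finite,linorder} clifford) bundle_data \<times> ('q \<times> bool \<Rightarrow> 'q)) set set" where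
  "spin_structure_classes X Q =
    {S. spin_structure X Q S} //
    {(S, S\<^sub>1). spin_structure X Q S \<and> spin_structure X Q S\<^sub>1 \<and> spin_isomorphic S S\<^sub>1}"

lemma equiv_spin_isomorphic:
  fixes X :: "'x topology" and Q :: "('q, 'x, real ^ 'n::{finite,linorder} ^ 'n::_) bundle_data"
  shows "equiv {S :: ('p, 'x, 'n::_ clifford) bundle_data \<times> ('p \<Rightarrow> 'q). spin_structure X Q S}
    {(S, S\<^sub>1). spin_structure X Q S \<and> spin_structure X Q S\<^sub>1 \<and> spin_isomorphic S S\<^sub>1}"
    (is "equiv _ ?R")
proof -
  have iso_refl: "spin_isomorphic S S" for S :: "('p, 'x, 'n::_ clifford) bundle_data \<times> ('p \<Rightarrow> 'q)"
    by (cases S) (auto simp: spin_isomorphic_def intro!: exI [of _ "\<lambda>p. p"] homeomorphic_map_id [unfolded id_def, THEN iffD2])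
  have iso_trans: "spin_isomorphic S U" if ST: "spin_isomorphic S T" and TU: "spin_isomorphic T U"
    for S T U :: "('p, 'x, 'n::_ clifford) bundle_data \<times> ('p \<Rightarrow> 'q)"
  proof -
    obtain P \<Lambda> P' \<Lambda>' P'' \<Lambda>'' where eq: "S = (P, \<Lambda>)" "T = (P', \<Lambda>')" "U = (P'', \<Lambda>'')"
      by (metis surj_pair)
    obtain f where f: "homeomorphic_map (total_space P) (total_space P') f"
      "\<And>p. p \<in> topspace (total_space P) \<Longrightarrow>
        projection P' (f p) = projection P p \<and> \<Lambda>' (f p) = \<Lambda> p \<and>
        (\<forall>x\<in>Spin. f (right_action P p x) = right_action P' (f p) x)"
      using ST unfolding eq spin_isomorphic_def prod.case by blast
    obtain g where g: "homeomorphic_map (total_space P') (total_space P'') g"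
      "\<And>p. p \<in> topspace (total_space P') \<Longrightarrow>
        projection P'' (g p) = projection P' p \<and> \<Lambda>'' (g p) = \<Lambda>' p \<and>
        (\<forall>x\<in>Spin. g (right_action P' p x) = right_action P'' (g p) x)"
      using TU unfolding eq spin_isomorphic_def prod.case by blast
    have m: "f p \<in> topspace (total_space P')" if "p \<in> topspace (total_space P)" for p
      using homeomorphic_imp_surjective_map [OF f(1)] that by blast
    have "homeomorphic_map (total_space P) (total_space P'') (g \<circ> f)"
      using f(1) g(1) by (rule homeomorphic_map_compose)
    with f(2) g(2) m show ?thesis
      unfolding eq spin_isomorphic_def prod.case by (intro exI [of _ "g \<circ> f"]) auto
  qed
  have iso_sym: "spin_isomorphic T S" if ST: "spin_isomorphic S T" and S: "spin_structure X Q S"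
    for S T :: "('p, 'x, 'n::_ clifford) bundle_data \<times> ('p \<Rightarrow> 'q)"
  proof -
    obtain P \<Lambda> P' \<Lambda>' where eq: "S = (P, \<Lambda>)" "T = (P', \<Lambda>')"
      by (metis surj_pair)
    obtain f where f: "homeomorphic_map (total_space P) (total_space P') f"
      "\<And>p. p \<in> topspace (total_space P) \<Longrightarrow>
        projection P' (f p) = projection P p \<and> \<Lambda>' (f p) = \<Lambda> p \<and>
        (\<forall>x\<in>Spin. f (right_action P p x) = right_action P' (f p) x)"
      using ST unfolding eq spin_isomorphic_def prod.case by blast
    obtain g where fg: "homeomorphic_maps (total_space P) (total_space P') f g"
      using f(1) homeomorphic_map_maps by blast
    have g: "homeomorphic_map (total_space P') (total_space P) g"
      using fg by (meson homeomorphic_maps_imp_map homeomorphic_maps_sym)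
    have gp: "g p \<in> topspace (total_space P)" "f (g p) = p" if "p \<in> topspace (total_space P')" for p
      using fg that homeomorphic_imp_surjective_map [OF g] by (auto simp: homeomorphic_maps_def)
    have gf: "g (f p) = p" if "p \<in> topspace (total_space P)" for p
      using fg that by (auto simp: homeomorphic_maps_def)
    have "continuous_map (prod_topology (total_space P) (top_of_set Spin)) (total_space P)
        (\<lambda>(p, x). right_action P p x)"
      using S by (simp add: eq spin_structure_def principal_bundle_def spin_group_def)
    then have act: "right_action P p x \<in> topspace (total_space P)"
      if "p \<in> topspace (total_space P)" "x \<in> Spin" for p x
      using that by (auto simp: continuous_map_def Pi_iff)
    show ?thesis
      unfolding eq spin_isomorphic_def prod.case
      by (intro exI [of _ g] conjI g) (metis gp gf f(2) act)
  qed
  show ?thesis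
  proof (rule equivI)
    show "sym ?R"
      by (rule symI) (auto intro: iso_sym)
    show "trans ?R"
      by (rule transI) (auto intro: iso_trans)
  qed (use iso_refl in \<open>auto simp: refl_on_def\<close>)
qed

lemma spin_structure_transport:
  fixes P :: "('p, 'x, 'n::{finite,linorder} clifford) bundle_data"
    and \<Lambda> :: "'p \<Rightarrow> 'q" and h :: "'p \<Rightarrow> 'r"
  assumes S: "spin_structure X Q (P, \<Lambda>)" and h: "inj_on h (topspace (total_space P))"
  shows "\<exists>S\<^sub>1 :: ('r, 'x, 'n clifford) bundle_data \<times> ('r \<Rightarrow> 'q).
    spin_structure X Q S\<^sub>1 \<and> spin_isomorphic (P, \<Lambda>) S\<^sub>1"
proof -
  define T where "T = total_space P"
  define M where "M = topspace T"
  define g where "g = inv_into M h"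
  define T' where "T' = pullback_topology (h ` M) g T"
  define P' where "P' = \<lparr>total_space = T', projection = (\<lambda>p. projection P (g p)),
    right_action = (\<lambda>p x. h (right_action P (g p) x))\<rparr>"
  have gh [simp]: "g (h p) = p" if "p \<in> M" for p
    using h that by (simp add: g_def M_def T_def)
  have gM: "g p \<in> M" if "p \<in> h ` M" for p
    using that by auto
  have hg [simp]: "h (g p) = p" if "p \<in> h ` M" for p
    using that by auto
  have topT': "topspace T' = h ` M"
    using gM by (auto simp: T'_def topspace_pullback_topology M_def)
  have "continuous_map T' T g"
    using continuous_map_pullback [OF continuous_map_id, of "h ` M" g T] by (simp add: T'_def)
  moreover have "continuous_map T T' h"
    unfolding T'_def
  proof (rule continuous_map_pullback')
    show "continuous_map T T (g \<circ> h)"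
      by (rule continuous_map_eq [OF continuous_map_id]) (simp add: M_def)
    show "topspace T \<subseteq> h -` (h ` M)"
      by (auto simp: M_def)
  qed
  ultimately have hom: "homeomorphic_maps T T' h g"
    by (simp add: homeomorphic_maps_def topT' M_def [symmetric])
  then have hm: "homeomorphic_map T T' h"
    using homeomorphic_maps_imp_map by blast
  have cg: "continuous_map T' T g" and ch: "continuous_map T T' h"
    using hom by (auto simp: homeomorphic_maps_def)
  have pb: "principal_bundle spin_group X P"
    and cov: "two_fold_covering T (total_space Q) \<Lambda>"
    and eqv: "\<And>p. p \<in> M \<Longrightarrow> projection Q (\<Lambda> p) = projection P p \<and>
      (\<forall>x\<in>Spin. \<Lambda> (right_action P p x) = right_action Q (\<Lambda> p) (spin_cover x))"
    using S by (auto simp: spin_structure_def T_def M_def)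
  have Sp: "carrier spin_group = Spin"
    by (simp add: spin_group_def)
  have cproj: "continuous_map T X (projection P)"
    and cact: "continuous_map (prod_topology T (top_of_set Spin)) T (\<lambda>(p, x). right_action P p x)"
    and alg: "\<And>p. p \<in> M \<Longrightarrow> right_action P p \<one>\<^bsub>spin_group\<^esub> = p \<and>
      (\<forall>x\<in>Spin. projection P (right_action P p x) = projection P p \<and>
        (\<forall>y\<in>Spin. right_action P (right_action P p x) y = right_action P p (x \<otimes>\<^bsub>spin_group\<^esub> y)))"
    and triv: "\<And>x. x \<in> topspace X \<Longrightarrow> \<exists>U \<tau>. openin X U \<and> x \<in> U \<and>
      homeomorphic_map (prod_topology (subtopology X U) (top_of_set Spin))
        (subtopology T {p \<in> M. projection P p \<in> U}) \<tau> \<and>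
      (\<forall>y\<in>U. \<forall>g\<in>Spin. projection P (\<tau> (y, g)) = y \<and>
        (\<forall>h\<in>Spin. \<tau> (y, g \<otimes>\<^bsub>spin_group\<^esub> h) = right_action P (\<tau> (y, g)) h))"
    using pb unfolding principal_bundle_def Sp T_def M_def by blast+
  have act: "right_action P p x \<in> M" if "p \<in> M" "x \<in> Spin" for p x
    using cact that by (auto simp: continuous_map_def Pi_iff M_def)
  have 1: "continuous_map T' X (\<lambda>p. projection P (g p))"
    using continuous_map_compose [OF cg cproj] by (simp add: o_def)
  have 2: "continuous_map (prod_topology T' (top_of_set Spin)) T' (\<lambda>(p, x). h (right_action P (g p) x))"
  proof -
    have "continuous_map (prod_topology T' (top_of_set Spin)) (prod_topology T (top_of_set Spin))
        (\<lambda>(p, x). (g p, x))"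
      using cg by (auto simp: continuous_map_prod_top)
    from continuous_map_compose [OF continuous_map_compose [OF this cact] ch]
    show ?thesis by (simp add: o_def case_prod_unfold)
  qed
  have 3: "\<exists>U \<tau>. openin X U \<and> x \<in> U \<and>
      homeomorphic_map (prod_topology (subtopology X U) (top_of_set Spin))
        (subtopology T' {p \<in> h ` M. projection P (g p) \<in> U}) \<tau> \<and>
      (\<forall>y\<in>U. \<forall>a\<in>Spin. projection P (g (\<tau> (y, a))) = y \<and>
        (\<forall>b\<in>Spin. \<tau> (y, a \<otimes>\<^bsub>spin_group\<^esub> b) = h (right_action P (g (\<tau> (y, a))) b)))"
    if x: "x \<in> topspace X" for x
  proof -
    obtain U \<tau> where U: "openin X U" "x \<in> U"
      and \<tau>: "homeomorphic_map (prod_topology (subtopology X U) (top_of_set Spin))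
        (subtopology T {p \<in> M. projection P p \<in> U}) \<tau>"
      and e: "\<And>y a. y \<in> U \<Longrightarrow> a \<in> Spin \<Longrightarrow> projection P (\<tau> (y, a)) = y \<and>
        (\<forall>b\<in>Spin. \<tau> (y, a \<otimes>\<^bsub>spin_group\<^esub> b) = right_action P (\<tau> (y, a)) b)"
      using triv [OF x] by blast
    have "U \<subseteq> topspace X"
      using U(1) by (rule openin_subset)
    then have m: "\<tau> (y, a) \<in> M" if "y \<in> U" "a \<in> Spin" for y a
      using homeomorphic_imp_surjective_map [OF \<tau>] that by (fastforce simp: M_def)
    have "homeomorphic_map (subtopology T {p \<in> M. projection P p \<in> U})
        (subtopology T' {p \<in> h ` M. projection P (g p) \<in> U}) h"
      by (rule homeomorphic_map_subtopologies [OF hm]) (auto simp: topT' M_def [symmetric])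
    then have "homeomorphic_map (prod_topology (subtopology X U) (top_of_set Spin))
        (subtopology T' {p \<in> h ` M. projection P (g p) \<in> U}) (h \<circ> \<tau>)"
      using \<tau> homeomorphic_map_compose by blast
    with U show ?thesis
      by (intro exI [of _ U] exI [of _ "h \<circ> \<tau>"]) (simp add: e m)
  qed
  have pb': "principal_bundle spin_group X P'"
    unfolding principal_bundle_def Sp P'_def bundle_data.simps topT'
  proof (intro conjI 1 2 ballI)
    fix p and x y :: "'n clifford"
    assume "p \<in> h ` M"
    then obtain m where m: "m \<in> M" "p = h m" by blast
    then show "h (right_action P (g p) \<one>\<^bsub>spin_group\<^esub>) = p"
      by (simp add: alg)
    assume x: "x \<in> Spin"
    with m show "projection P (g (h (right_action P (g p) x))) = projection P (g p)"
      by (simp add: alg act)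
    assume "y \<in> Spin"
    with x m show "h (right_action P (g (h (right_action P (g p) x))) y) =
        h (right_action P (g p) (x \<otimes>\<^bsub>spin_group\<^esub> y))"
      by (simp add: alg act)
  qed (use 3 in blast)
  have cov': "two_fold_covering T' (total_space Q) (\<lambda>p. \<Lambda> (g p))"
    unfolding two_fold_covering_def
  proof (intro conjI ballI)
    show "continuous_map T' (total_space Q) (\<lambda>p. \<Lambda> (g p))"
      using continuous_map_compose [OF cg, of "total_space Q" \<Lambda>] cov
      by (simp add: o_def two_fold_covering_def)
    fix q
    assume q: "q \<in> topspace (total_space Q)"
    have "{p \<in> topspace T'. \<Lambda> (g p) = q} = h ` {p \<in> M. \<Lambda> p = q}"
      by (auto simp: topT')
    moreover have "inj_on h {p \<in> M. \<Lambda> p = q}"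
      using h by (rule inj_on_subset) (auto simp: M_def T_def)
    ultimately show "card {p \<in> topspace T'. \<Lambda> (g p) = q} = 2"
      using cov q by (simp add: card_image two_fold_covering_def M_def)
    obtain O' \<V> where O: "openin (total_space Q) O'" "q \<in> O'"
      and V: "\<Union>\<V> = {p \<in> M. \<Lambda> p \<in> O'}" "pairwise disjnt \<V>"
      and VV: "\<And>V. V \<in> \<V> \<Longrightarrow> openin T V \<and>
        homeomorphic_map (subtopology T V) (subtopology (total_space Q) O') \<Lambda>"
      using cov q unfolding two_fold_covering_def M_def by meson
    have VM: "V \<subseteq> M" if "V \<in> \<V>" for V
      using VV [OF that] openin_subset M_def by blast
    show "\<exists>O'. openin (total_space Q) O' \<and> q \<in> O' \<and>
        (\<exists>\<V>. \<Union>\<V> = {p \<in> topspace T'. \<Lambda> (g p) \<in> O'} \<and> pairwise disjnt \<V> \<and>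
          (\<forall>V\<in>\<V>. openin T' V \<and>
            homeomorphic_map (subtopology T' V) (subtopology (total_space Q) O') (\<lambda>p. \<Lambda> (g p))))"
    proof (intro exI [of _ O'] conjI O exI [of _ "(`) h ` \<V>"] ballI)
      have "\<Union> ((`) h ` \<V>) = h ` \<Union>\<V>"
        by blast
      also have "\<dots> = {p \<in> topspace T'. \<Lambda> (g p) \<in> O'}"
        unfolding V topT' by auto
      finally show "\<Union> ((`) h ` \<V>) = {p \<in> topspace T'. \<Lambda> (g p) \<in> O'}" .
      have "disjnt (h ` V) (h ` W)" if "V \<in> \<V>" "W \<in> \<V>" "h ` V \<noteq> h ` W" for V W
      proof -
        have "disjnt V W"
          using V(2) that unfolding pairwise_def by metis
        then show ?thesis
          using h VM [OF that(1)] VM [OF that(2)]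
          by (simp add: disjnt_def M_def T_def inj_on_image_Int [symmetric])
      qed
      then show "pairwise disjnt ((`) h ` \<V>)"
        by (auto simp: pairwise_def)
    next
      fix V'
      assume "V' \<in> (`) h ` \<V>"
      then obtain V where V: "V \<in> \<V>" "V' = h ` V" by blast
      show "openin T' V'"
        using VV [OF V(1)] hm V(2) homeomorphic_imp_open_map open_map_def by metis
      have "homeomorphic_map T' T g"
        using hom by (meson homeomorphic_maps_imp_map homeomorphic_maps_sym)
      moreover have "g ` (topspace T' \<inter> V') = topspace T \<inter> V"
        using VM [OF V(1)] by (force simp: V(2) topT' M_def [symmetric])
      ultimately have "homeomorphic_map (subtopology T' V') (subtopology T V) g"
        by (rule homeomorphic_map_subtopologies)
      then have "homeomorphic_map (subtopology T' V') (subtopology (total_space Q) O') (\<Lambda> \<circ> g)"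
        using VV [OF V(1)] homeomorphic_map_compose by blast
      then show "homeomorphic_map (subtopology T' V') (subtopology (total_space Q) O') (\<lambda>p. \<Lambda> (g p))"
        by (simp add: o_def)
    qed
  qed
  have "spin_structure X Q (P', \<lambda>p. \<Lambda> (g p))"
    unfolding spin_structure_def prod.case
    using pb' cov' eqv by (auto simp: P'_def topT' act)
  moreover have "spin_isomorphic (P, \<Lambda>) (P', \<lambda>p. \<Lambda> (g p))"
    unfolding spin_isomorphic_def prod.case
    using hm by (intro exI [of _ h]) (auto simp: P'_def T_def [symmetric] M_def [symmetric])
  ultimately show ?thesis by blast
qed

theorem spin_structure_universe:
  fixes P :: "('p, 'x, 'n::{finite,linorder} clifford) bundle_data"
    and Q :: "('q, 'x, real ^ 'n::_ ^ 'n::_) bundle_data"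
  assumes S: "spin_structure X Q (P, \<Lambda>)"
  shows "\<exists>S\<^sub>1 :: ('q \<times> bool, 'x, 'n clifford) bundle_data \<times> ('q \<times> bool \<Rightarrow> 'q).
    spin_structure X Q S\<^sub>1 \<and> spin_isomorphic (P, \<Lambda>) S\<^sub>1"
proof -
  define M where "M = topspace (total_space P)"
  define F where "F = (\<lambda>q. {p \<in> M. \<Lambda> p = q})"
  define c where "c = (\<lambda>q. SOME p. p \<in> F q)"
  define h where "h = (\<lambda>p. (\<Lambda> p, p = c (\<Lambda> p)))"
  have cov: "two_fold_covering (total_space P) (total_space Q) \<Lambda>"
    using S by (simp add: spin_structure_def)
  have "inj_on h M"
  proof (rule inj_onI)
    fix p p'
    assume p: "p \<in> M" "p' \<in> M" "h p = h p'"
    define q where "q = \<Lambda> p"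
    have pF: "p \<in> F q" "p' \<in> F q"
      using p by (auto simp: F_def q_def h_def)
    then have c: "c q \<in> F q"
      unfolding c_def by (metis someI)
    have "q \<in> topspace (total_space Q)"
      using cov p(1) by (auto simp: two_fold_covering_def continuous_map_def q_def M_def)
    then have "card (F q) = 2"
      using cov by (simp add: two_fold_covering_def F_def M_def)
    then obtain u v where "F q = {u, v}"
      by (auto simp: card_2_iff)
    with pF c p(3) show "p = p'"
      by (auto simp: h_def q_def)
  qed
  then show ?thesis
    using spin_structure_transport [OF S, of h] by (simp add: M_def)
qed

end

theory Submission
  imports Defs
begin

text \<open>
  The frame bundle of the flat manifold \<open>X = \<real>\<^sup>n / \<Gamma>\<close> becomes trivial over its universal cover: every
  point \<open>x\<close> of Euclidean space carries the standard frame \<open>[(x, 1)]\<close>.  Given a spin structure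
  \<open>(P, \<Lambda>)\<close>, this family of frames lifts through the two-fold covering \<open>\<Lambda>\<close> to a map
  \<open>s : \<real>\<^sup>n \<rightarrow> P\<close>, because Euclidean space is simply connected (\<open>two_fold_covering_lift\<close>).  For
  \<open>\<gamma> = (A, a)\<close> in \<open>\<Gamma>\<close> the points \<open>s (\<gamma> x)\<close> and \<open>s x\<close> lie in the same fibre of \<open>P\<close>, so they differ by
  an element of the spin group.  That element cannot jump between the two preimages of a rotation, so
  there is a single \<open>\<epsilon> \<gamma>\<close> with \<open>s (\<gamma> x) \<cdot> \<epsilon> \<gamma> = s x\<close> for all \<open>x\<close>.  Applying \<open>\<Lambda>\<close> shows that \<open>\<epsilon> \<gamma>\<close> covers
  \<open>A\<close>, and iterating shows that \<open>\<epsilon>\<close> is a homomorphism (\<open>framing_exists\<close>).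

  The assignment of \<open>\<epsilon>\<close> to \<open>(P, \<Lambda>)\<close> is a bijection from isomorphism classes of spin structures to
  lifts of the holonomy representation.  It is well defined, since the only other lift of the family of
  frames is \<open>s \<cdot> (-1)\<close> and \<open>-1\<close> is central (\<open>framing_unique\<close>, \<open>framing_isomorphic\<close>).  It is injective,
  since \<open>(x, u) \<mapsto> s x \<cdot> u\<close> exhibits \<open>P\<close> as the quotient of \<open>\<real>\<^sup>n \<times> Spin\<close> by the action
  \<open>\<gamma> (x, u) = (\<gamma> x, \<epsilon> \<gamma> u)\<close> (\<open>isomorphic_framed\<close>).  It is surjective, since for every lift \<open>\<epsilon>\<close> this
  quotient is a spin structure (\<open>spin_structure_associated\<close>).  These arguments rest on two facts: the
  map from the spin group to the rotation group is a two-fold covering (\<open>spin_cover_eq_iff\<close>,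
  \<open>spin_cover_surj\<close>, \<open>openin_spin_cover_image\<close>), and a discrete torsion-free group of motions acts
  freely and properly discontinuously (\<open>free\<close>, \<open>properly_discontinuous\<close>).

  This settles the case that \<open>\<phi>\<close> is the identity.  In general \<open>\<phi> g = F g F\<^sup>-\<^sup>1\<close>, where \<open>F\<close> may be
  replaced by the orthogonal factor \<open>U\<close> of its polar decomposition, because the positive factor
  commutes with the holonomy group (\<open>orthogonal_conjugator\<close>).  Any orthogonal \<open>U\<close>, of determinant \<open>1\<close>
  or \<open>-1\<close>, induces an automorphism of the Clifford algebra that preserves the spin group and covers
  conjugation by \<open>U\<close>.  Composing with it turns lifts of the identity representation into lifts of \<open>\<phi>\<close>
  (\<open>lifts_conjugate_bij\<close>).
\<close>

section \<open>Lifting maps through two-fold coverings\<close>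

lemma two_fold_covering_point:
  assumes "two_fold_covering P Q \<Lambda>" "q \<in> topspace Q"
  obtains p where "p \<in> topspace P" "\<Lambda> p = q"
proof -
  have "card {p \<in> topspace P. \<Lambda> p = q} = 2"
    using assms by (auto simp: two_fold_covering_def)
  then have "{p \<in> topspace P. \<Lambda> p = q} \<noteq> {}"
    by (metis card.empty zero_neq_numeral)
  then show ?thesis
    using that by blast
qed

lemma two_fold_covering_in_base:
  assumes "two_fold_covering P Q \<Lambda>" "p \<in> topspace P"
  shows "\<Lambda> p \<in> topspace Q"
  using assms by (auto simp: two_fold_covering_def continuous_map_def)

lemma two_fold_covering_local_inverse:
  assumes cov: "two_fold_covering P Q \<Lambda>" and q: "q \<in> topspace Q"
  obtains T where "openin Q T" "q \<in> T"
    "\<And>p. p \<in> topspace P \<Longrightarrow> \<Lambda> p \<in> T \<Longrightarrow>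
      \<exists>V g. openin P V \<and> p \<in> V \<and> homeomorphic_maps (subtopology P V) (subtopology Q T) \<Lambda> g"
proof -
  obtain T \<V> where T: "openin Q T" "q \<in> T"
    and V: "\<Union>\<V> = {p \<in> topspace P. \<Lambda> p \<in> T}"
    and VV: "\<And>V. V \<in> \<V> \<Longrightarrow> openin P V \<and> homeomorphic_map (subtopology P V) (subtopology Q T) \<Lambda>"
    using cov q unfolding two_fold_covering_def by meson
  have "\<exists>V g. openin P V \<and> p \<in> V \<and> homeomorphic_maps (subtopology P V) (subtopology Q T) \<Lambda> g"
    if "p \<in> topspace P" "\<Lambda> p \<in> T" for p
  proof -
    have "p \<in> \<Union>\<V>"
      using V that by simp
    then obtain V where "V \<in> \<V>" "p \<in> V"
      by blast
    then show ?thesis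
      using VV [of V] unfolding homeomorphic_map_maps by blast
  qed
  then show ?thesis
    using T that by blast
qed

lemma two_fold_covering_sheets:
  assumes cov: "two_fold_covering P Q \<Lambda>"
    and p: "p \<in> topspace P" "p' \<in> topspace P" "\<Lambda> p = \<Lambda> p'"
  obtains V V' where "openin P V" "openin P V'" "p \<in> V" "p' \<in> V'" "inj_on \<Lambda> V"
    "p \<noteq> p' \<Longrightarrow> V \<inter> V' = {}"
proof -
  have "\<Lambda> p \<in> topspace Q"
    using cov p(1) by (rule two_fold_covering_in_base)
  then obtain T \<V> where T: "\<Lambda> p \<in> T"
    and V: "\<Union>\<V> = {p \<in> topspace P. \<Lambda> p \<in> T}" "pairwise disjnt \<V>"
    and VV: "\<And>V. V \<in> \<V> \<Longrightarrow> openin P V \<and> homeomorphic_map (subtopology P V) (subtopology Q T) \<Lambda>"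
    using cov unfolding two_fold_covering_def by meson
  have "p \<in> \<Union>\<V>" "p' \<in> \<Union>\<V>"
    unfolding V(1) using p T by auto
  then obtain V V' where VV': "V \<in> \<V>" "p \<in> V" "V' \<in> \<V>" "p' \<in> V'"
    by blast
  have inj: "inj_on \<Lambda> W" if "W \<in> \<V>" for W
    using VV [OF that] by (metis homeomorphic_imp_injective_map openin_subset topspace_subtopology_subset)
  have "p = p'" if "V = V'"
    using inj_onD [OF inj [OF VV'(1)] p(3)] VV' that by blast
  moreover have "V \<inter> V' = {}" if "V \<noteq> V'"
    using V(2) VV' that by (auto simp: pairwise_def disjnt_def)
  ultimately show ?thesis
    using that [of V V'] VV [OF VV'(1)] VV [OF VV'(3)] VV' inj by blast
qed

text \<open>
  Two points over the same point lie in the same sheet exactly if they are equal, and distinct sheets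
  are disjoint.  So the set where two lifts agree is both open and closed.
\<close>

lemma lifts_agree:
  fixes s t :: "'a::topological_space \<Rightarrow> 'p"
  assumes cov: "two_fold_covering P Q \<Lambda>" and S: "connected S" "c \<in> S"
    and s: "continuous_map (top_of_set S) P s" and t: "continuous_map (top_of_set S) P t"
    and eq: "\<And>x. x \<in> S \<Longrightarrow> \<Lambda> (s x) = \<Lambda> (t x)" and c: "s c = t c" and x: "x \<in> S"
  shows "s x = t x"
proof -
  define A where "A = {x \<in> S. s x = t x}"
  have nbhd: "\<exists>U. openin (top_of_set S) U \<and> x \<in> U \<and>
      (if s x = t x then U \<subseteq> A else U \<subseteq> S - A)" if xS: "x \<in> S" for x
  proof -
    have st: "s x \<in> topspace P" "t x \<in> topspace P"
      using s t xS by (auto simp: continuous_map_def)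
    obtain V V' where V: "openin P V" "openin P V'" "s x \<in> V" "t x \<in> V'" "inj_on \<Lambda> V"
      "s x \<noteq> t x \<Longrightarrow> V \<inter> V' = {}"
      using two_fold_covering_sheets [OF cov st eq [OF xS]] by blast
    define W where "W = (if s x = t x then V else V')"
    define U where "U = {x \<in> S. s x \<in> V} \<inter> {x \<in> S. t x \<in> W}"
    have "openin P W"
      using V by (simp add: W_def)
    then have "openin (top_of_set S) U"
      unfolding U_def using V s t by (intro openin_Int) (auto dest: openin_continuous_map_preimage)
    moreover have "x \<in> U"
      using xS V by (auto simp: U_def W_def)
    moreover have "if s x = t x then U \<subseteq> A else U \<subseteq> S - A"
      using V(5,6) eq by (auto simp: U_def W_def A_def dest: inj_onD)
    ultimately show ?thesis by blast
  qed
  have "openin (top_of_set S) A"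
    by (subst openin_subopen) (use nbhd in \<open>fastforce simp: A_def\<close>)
  moreover have "openin (top_of_set S) (S - A)"
    by (subst openin_subopen) (use nbhd in \<open>fastforce simp: A_def\<close>)
  then have "closedin (top_of_set S) A"
    by (simp add: closedin_def A_def)
  moreover have "c \<in> A"
    using S c by (simp add: A_def)
  ultimately have "A = S"
    using S(1) unfolding connected_clopen by blast
  then show ?thesis
    using x by (auto simp: A_def)
qed

text \<open>
  The starting point of the lift is prescribed arbitrarily.  This makes the property pass to subsets, and
  it lets lifts over two overlapping pieces be chosen so that they agree at one common point.
\<close>

definition lifts_over :: "'p topology \<Rightarrow> ('p \<Rightarrow> 'q) \<Rightarrow> ('a::topological_space \<Rightarrow> 'q) \<Rightarrow> 'a set \<Rightarrow> bool" where
  "lifts_over P \<Lambda> f S \<longleftrightarrow> (\<forall>c\<in>S. \<forall>p\<in>topspace P. \<Lambda> p = f c \<longrightarrow>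
    (\<exists>s. continuous_map (top_of_set S) P s \<and> s c = p \<and> (\<forall>x\<in>S. \<Lambda> (s x) = f x)))"

lemma lifts_over_subset:
  assumes "lifts_over P \<Lambda> f S" "T \<subseteq> S"
  shows "lifts_over P \<Lambda> f T"
  unfolding lifts_over_def
proof (intro ballI impI)
  fix c p
  assume "c \<in> T" "p \<in> topspace P" "\<Lambda> p = f c"
  then obtain s where "continuous_map (top_of_set S) P s" "s c = p" "\<forall>x\<in>S. \<Lambda> (s x) = f x"
    using assms unfolding lifts_over_def by blast
  then show "\<exists>s. continuous_map (top_of_set T) P s \<and> s c = p \<and> (\<forall>x\<in>T. \<Lambda> (s x) = f x)"
    using assms(2) by (intro exI [of _ s]) (auto intro: continuous_map_from_subtopology_mono)
qed

text \<open>
  Cutting a convex set along a hyperplane leaves a convex, hence connected, intersection of the two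
  halves.  Lifts over the halves that agree at one point of the intersection agree on all of it and can
  be pasted.
\<close>

lemma lifts_over_halves:
  fixes f :: "'a::euclidean_space \<Rightarrow> 'q"
  assumes cov: "two_fold_covering P Q \<Lambda>" and f: "continuous_map euclidean Q f"
    and d: "d \<in> S" "d \<bullet> k = r" and S: "convex S"
    and le: "lifts_over P \<Lambda> f (S \<inter> {x. x \<bullet> k \<le> r})" and ge: "lifts_over P \<Lambda> f (S \<inter> {x. r \<le> x \<bullet> k})"
  shows "lifts_over P \<Lambda> f S"
proof -
  let ?L = "S \<inter> {x. x \<bullet> k \<le> r}" and ?G = "S \<inter> {x. r \<le> x \<bullet> k}"
  have glue: "\<exists>s. continuous_map (top_of_set S) P s \<and> s d = p \<and> (\<forall>x\<in>S. \<Lambda> (s x) = f x)"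
    if p: "p \<in> topspace P" "\<Lambda> p = f d" for p
  proof -
    obtain s where s: "continuous_map (top_of_set ?L) P s" "s d = p" "\<forall>x\<in>?L. \<Lambda> (s x) = f x"
      using le d p unfolding lifts_over_def by blast
    obtain t where t: "continuous_map (top_of_set ?G) P t" "t d = p" "\<forall>x\<in>?G. \<Lambda> (t x) = f x"
      using ge d p unfolding lifts_over_def by blast
    have agree: "s x = t x" if "x \<in> S" "x \<bullet> k = r" for x
    proof (rule lifts_agree [OF cov, of "S \<inter> {x. x \<bullet> k = r}" d])
      show "connected (S \<inter> {x. x \<bullet> k = r})"
        using S convex_hyperplane [of k r] by (intro convex_connected convex_Int) (simp_all add: inner_commute)
      show "continuous_map (top_of_set (S \<inter> {x. x \<bullet> k = r})) P s"
        using s(1) by (rule continuous_map_from_subtopology_mono) auto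
      show "continuous_map (top_of_set (S \<inter> {x. x \<bullet> k = r})) P t"
        using t(1) by (rule continuous_map_from_subtopology_mono) auto
    qed (use d s t that in auto)
    have "continuous_map (top_of_set S) P (\<lambda>x. if x \<bullet> k \<le> r then s x else t x)"
    proof (rule continuous_map_cases_le)
      have "continuous_on S (\<lambda>x. x \<bullet> k)"
        by (intro continuous_intros)
      then show "continuous_map (top_of_set S) euclideanreal (\<lambda>x. x \<bullet> k)"
        by simp
      have "S \<inter> {x \<in> S. x \<bullet> k \<le> r} = ?L" "S \<inter> {x \<in> S. r \<le> x \<bullet> k} = ?G"
        by auto
      then show "continuous_map (subtopology (top_of_set S) {x \<in> topspace (top_of_set S). x \<bullet> k \<le> r}) P s"
        "continuous_map (subtopology (top_of_set S) {x \<in> topspace (top_of_set S). r \<le> x \<bullet> k}) P t"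
        using s(1) t(1) by (simp_all add: subtopology_subtopology)
    qed (use agree in auto)
    then show ?thesis
      using s t d by (intro exI [of _ "\<lambda>x. if x \<bullet> k \<le> r then s x else t x"]) auto
  qed
  show ?thesis
    unfolding lifts_over_def
  proof (intro ballI impI)
    fix c p
    assume c: "c \<in> S" and p: "p \<in> topspace P" "\<Lambda> p = f c"
    define H where "H = (if c \<bullet> k \<le> r then ?L else ?G)"
    have H: "c \<in> H" "d \<in> H" "H \<subseteq> S" "lifts_over P \<Lambda> f H" "convex H"
      using c d le ge S convex_halfspace_le [of k r] convex_halfspace_ge [of r k]
      by (auto simp: H_def inner_commute intro!: convex_Int)
    then obtain u where u: "continuous_map (top_of_set H) P u" "u c = p" "\<forall>x\<in>H. \<Lambda> (u x) = f x"
      using p unfolding lifts_over_def by blast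
    then have "u d \<in> topspace P" "\<Lambda> (u d) = f d"
      using H by (auto simp: continuous_map_def)
    then obtain s where s: "continuous_map (top_of_set S) P s" "s d = u d" "\<forall>x\<in>S. \<Lambda> (s x) = f x"
      using glue by blast
    have "s c = u c"
    proof (rule lifts_agree [OF cov, of H d])
      show "continuous_map (top_of_set H) P s"
        using s(1) H(3) by (rule continuous_map_from_subtopology_mono)
    qed (use H u s in \<open>auto intro: convex_connected\<close>)
    with s u show "\<exists>s. continuous_map (top_of_set S) P s \<and> s c = p \<and> (\<forall>x\<in>S. \<Lambda> (s x) = f x)"
      by auto
  qed
qed

lemma lifts_over_local:
  fixes f :: "'a::topological_space \<Rightarrow> 'q"
  assumes cov: "two_fold_covering P Q \<Lambda>" and f: "continuous_map euclidean Q f"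
  shows "\<exists>U. open U \<and> x \<in> U \<and> lifts_over P \<Lambda> f U"
proof -
  have "f x \<in> topspace Q"
    using f by (auto simp: continuous_map_def)
  then obtain T where T: "openin Q T" "f x \<in> T"
    and loc: "\<And>p. p \<in> topspace P \<Longrightarrow> \<Lambda> p \<in> T \<Longrightarrow>
      \<exists>V g. openin P V \<and> p \<in> V \<and> homeomorphic_maps (subtopology P V) (subtopology Q T) \<Lambda> g"
    using two_fold_covering_local_inverse [OF cov] by metis
  define U where "U = {x. f x \<in> T}"
  have "open U"
    using openin_continuous_map_preimage [OF f T(1)] by (simp add: U_def)
  moreover have "lifts_over P \<Lambda> f U"
    unfolding lifts_over_def
  proof (intro ballI impI)
    fix c p
    assume c: "c \<in> U" and p: "p \<in> topspace P" "\<Lambda> p = f c"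
    then obtain V g where V: "openin P V" "p \<in> V"
      and g: "homeomorphic_maps (subtopology P V) (subtopology Q T) \<Lambda> g"
      using loc [of p] by (auto simp: U_def)
    have "continuous_map (top_of_set U) (subtopology Q T) f"
      using f by (auto simp: continuous_map_in_subtopology continuous_map_from_subtopology U_def)
    then have "continuous_map (top_of_set U) (subtopology P V) (g \<circ> f)"
      using g continuous_map_compose unfolding homeomorphic_maps_def by blast
    then have "continuous_map (top_of_set U) P (g \<circ> f)"
      by (simp add: continuous_map_in_subtopology)
    moreover have "g (f c) = p"
      using g p V unfolding homeomorphic_maps_def by (metis IntI topspace_subtopology)
    moreover have "\<forall>x\<in>U. \<Lambda> (g (f x)) = f x"
      using g f unfolding homeomorphic_maps_def U_def by (auto simp: continuous_map_def)
    ultimately show "\<exists>s. continuous_map (top_of_set U) P s \<and> s c = p \<and> (\<forall>x\<in>U. \<Lambda> (s x) = f x)"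
      by (intro exI [of _ "g \<circ> f"]) auto
  qed
  ultimately show ?thesis
    using T by (auto simp: U_def)
qed

text \<open>
  Liftability is local and compatible with cutting a box in two, so it behaves like an additive function
  of boxes with values in the monoid of truth values under conjunction.  A box has a tagged division
  each of whose pieces lies in a set where lifts exist, and additivity transfers the property from the
  pieces to the box.
\<close>

lemma lifts_over_cbox:
  fixes f :: "'a::euclidean_space \<Rightarrow> 'q"
  assumes cov: "two_fold_covering P Q \<Lambda>" and f: "continuous_map euclidean Q f"
    and ne: "box a b \<noteq> {}"
  shows "lifts_over P \<Lambda> f (cbox a b)"
proof -
  \<comment> \<open>Additive functions of boxes take the neutral value on boxes without interior.\<close>
  define g where "g = (\<lambda>S. interior S = {} \<or> lifts_over P \<Lambda> f S)"
  interpret operative conj True g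
  proof
    fix a b c and k :: 'a
    assume k: "k \<in> Basis"
    let ?L = "cbox a b \<inter> {x. x \<bullet> k \<le> c}" and ?G = "cbox a b \<inter> {x. c \<le> x \<bullet> k}"
    have "g ?L" "g ?G" if "g (cbox a b)"
      using that interior_mono [of ?L "cbox a b"] interior_mono [of ?G "cbox a b"]
        lifts_over_subset [of P \<Lambda> f "cbox a b"] unfolding g_def by blast+
    moreover have "g (cbox a b)" if LG: "g ?L" "g ?G"
    proof (cases "box a b = {}")
      case True
      then show ?thesis by (simp add: g_def)
    next
      case False
      then have ab: "a \<bullet> i < b \<bullet> i" if "i \<in> Basis" for i
        using that by (simp add: box_ne_empty)
      consider "c \<le> a \<bullet> k" | "b \<bullet> k \<le> c" | "a \<bullet> k < c" "c < b \<bullet> k"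
        by linarith
      then show ?thesis
      proof cases
        case 1
        then have "?G = cbox a b"
          using k by (force simp: mem_box)
        then show ?thesis using LG by simp
      next
        case 2
        then have "?L = cbox a b"
          using k by (force simp: mem_box)
        then show ?thesis using LG by simp
      next
        case 3
        \<comment> \<open>The midpoint of the box, moved to height \<open>t\<close> in the direction \<open>k\<close>.\<close>
        define z where "z = (\<lambda>t. (a + b) /\<^sub>R 2 + (t - ((a + b) /\<^sub>R 2) \<bullet> k) *\<^sub>R k)"
        have zk: "z t \<bullet> k = t" for t
          using k by (simp add: z_def inner_simps)
        have z: "z t \<in> box a b" if "a \<bullet> k < t" "t < b \<bullet> k" for t
        proof -
          have "a \<bullet> i < z t \<bullet> i \<and> z t \<bullet> i < b \<bullet> i" if "i \<in> Basis" for i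
          proof (cases "i = k")
            case False
            then have "z t \<bullet> i = (a \<bullet> i + b \<bullet> i) / 2"
              using k that by (simp add: z_def inner_simps inner_not_same_Basis)
            then show ?thesis using ab [OF that] by simp
          qed (use zk \<open>a \<bullet> k < t\<close> \<open>t < b \<bullet> k\<close> in auto)
          then show ?thesis by (simp add: mem_box)
        qed
        have "interior ?L \<noteq> {}"
        proof -
          have "open (box a b \<inter> {x. x \<bullet> k < c})"
            by (intro open_Int open_box open_halfspace_component_lt)
          moreover have "z ((a \<bullet> k + c) / 2) \<in> box a b \<inter> {x. x \<bullet> k < c}"
            using z 3 zk by simp
          moreover have "box a b \<inter> {x. x \<bullet> k < c} \<subseteq> ?L"
            using box_subset_cbox by fastforce
          ultimately show ?thesis
            using interior_maximal by blast
        qed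
        moreover have "interior ?G \<noteq> {}"
        proof -
          have "open (box a b \<inter> {x. c < x \<bullet> k})"
            by (intro open_Int open_box open_halfspace_component_gt)
          moreover have "z ((b \<bullet> k + c) / 2) \<in> box a b \<inter> {x. c < x \<bullet> k}"
            using z 3 zk by simp
          moreover have "box a b \<inter> {x. c < x \<bullet> k} \<subseteq> ?G"
            using box_subset_cbox by fastforce
          ultimately show ?thesis
            using interior_maximal by blast
        qed
        ultimately have "lifts_over P \<Lambda> f ?L" "lifts_over P \<Lambda> f ?G"
          using LG by (auto simp: g_def)
        moreover have "z c \<in> cbox a b"
          using z 3 box_subset_cbox by blast
        ultimately have "lifts_over P \<Lambda> f (cbox a b)"
          using lifts_over_halves [OF cov f _ zk [of c]] convex_box(1) by blast
        then show ?thesis by (simp add: g_def)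
      qed
    qed
    ultimately show "g (cbox a b) = (g ?L \<and> g ?G)"
      by blast
  qed (simp add: g_def)
  obtain \<gamma> where \<gamma>: "\<And>x. open (\<gamma> x)" "\<And>x. x \<in> \<gamma> x" "\<And>x. lifts_over P \<Lambda> f (\<gamma> x)"
    using lifts_over_local [OF cov f] by metis
  then have "gauge \<gamma>"
    by (simp add: gauge_def)
  then obtain p where p: "p tagged_division_of (cbox a b)" "\<gamma> fine p"
    using fine_division_exists by blast
  have "g K" if "K \<in> snd ` p" for K
  proof -
    from that obtain x where "(x, K) \<in> p" by auto
    then have "K \<subseteq> \<gamma> x" using p(2) by (auto simp: fine_def)
    then show ?thesis
      using lifts_over_subset [OF \<gamma>(3)] by (auto simp: g_def)
  qed
  then have "F g (snd ` p) = True"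
    by (intro neutral) blast
  then have "g (cbox a b)"
    using division [OF division_of_tagged_division [OF p(1)]] by simp
  then show ?thesis
    using ne by (simp add: g_def)
qed

text \<open>
  Lifts over the cubes of an exhaustion that take the same value at the origin agree on smaller cubes, so
  they fit together to a lift over the whole space.
\<close>

theorem two_fold_covering_lift:
  fixes f :: "'a::euclidean_space \<Rightarrow> 'q"
  assumes cov: "two_fold_covering P Q \<Lambda>" and f: "continuous_map euclidean Q f"
    and p: "p \<in> topspace P" "\<Lambda> p = f 0"
  obtains s where "continuous_map euclidean P s" "s 0 = p" "\<And>x. \<Lambda> (s x) = f x"
proof -
  define B where "B = (\<lambda>m::nat. cbox (- (Suc m *\<^sub>R One)) (Suc m *\<^sub>R One :: 'a))"
  have memB: "x \<in> B m \<longleftrightarrow> (\<forall>i\<in>Basis. - real (Suc m) \<le> x \<bullet> i \<and> x \<bullet> i \<le> Suc m)" for x m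
    by (simp add: B_def mem_box del: of_nat_Suc)
  have B0: "0 \<in> B m" for m
    by (simp add: memB)
  have "lifts_over P \<Lambda> f (B m)" for m
    unfolding B_def by (rule lifts_over_cbox [OF cov f]) (simp add: box_ne_empty)
  then have "\<exists>s. continuous_map (top_of_set (B m)) P s \<and> s 0 = p \<and> (\<forall>x\<in>B m. \<Lambda> (s x) = f x)" for m
    using B0 p unfolding lifts_over_def by blast
  then obtain s where s: "\<And>m. continuous_map (top_of_set (B m)) P (s m)" "\<And>m. s m 0 = p"
      "\<And>m x. x \<in> B m \<Longrightarrow> \<Lambda> (s m x) = f x"
    by metis
  have mono: "B m \<subseteq> B m'" if "m \<le> m'" for m m'
    using that by (force simp: memB)
  have agree: "s m x = s m' x" if "m \<le> m'" "x \<in> B m" for m m' x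
  proof (rule lifts_agree [OF cov, of "B m" 0])
    show "connected (B m)"
      by (simp add: B_def convex_connected)
    show "continuous_map (top_of_set (B m)) P (s m')"
      using s(1) mono [OF that(1)] by (rule continuous_map_from_subtopology_mono)
    qed (use s mono [OF that(1)] that(2) B0 in \<open>auto dest: subsetD\<close>)
  define k where "k = (\<lambda>x::'a. nat \<lceil>norm x\<rceil>)"
  define u where "u = (\<lambda>x. s (k x) x)"
  have inB: "x \<in> B m" if "norm x \<le> Suc m" for x :: 'a and m
  proof -
    have "\<bar>x \<bullet> i\<bar> \<le> Suc m" if "i \<in> Basis" for i
      using Basis_le_norm [OF that, of x] \<open>norm x \<le> Suc m\<close> by linarith
    then show ?thesis
      unfolding memB abs_le_iff by (metis minus_le_iff)
  qed
  have kB: "x \<in> B (k x)" for x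
  proof (rule inB)
    show "norm x \<le> Suc (k x)"
      unfolding k_def of_nat_Suc using real_nat_ceiling_ge [of "norm x"] by linarith
  qed
  have u: "u x = s m x" if "x \<in> B m" for x m
    unfolding u_def using agree [of "k x" m x] agree [of m "k x" x] kB [of x] that by (metis nat_le_linear)
  have uP: "u x \<in> topspace P" for x
    using continuous_map_funspace [OF s(1)] kB [of x] unfolding u_def by fastforce
  have "continuous_map euclidean P u"
    unfolding continuous_map_def
  proof (intro conjI allI impI)
    show "u \<in> topspace euclidean \<rightarrow> topspace P"
      using uP by simp
    fix V assume V: "openin P V"
    have "\<exists>T. open T \<and> x \<in> T \<and> T \<subseteq> u -` V" if "u x \<in> V" for x
    proof -
      obtain m where m: "norm x < Suc m"
        by (meson reals_Archimedean2 less_trans of_nat_less_iff lessI)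
      define T where "T = ball (0::'a) (Suc m) \<inter> u -` V"
      have BT: "ball (0::'a) (Suc m) \<subseteq> B m"
        using inB by auto
      have "continuous_map (top_of_set (ball 0 (Suc m))) P (s m)"
        using s(1) BT by (rule continuous_map_from_subtopology_mono)
      then have "openin (top_of_set (ball 0 (Suc m))) {x \<in> ball 0 (Suc m). s m x \<in> V}"
        using openin_continuous_map_preimage [OF _ V] by fastforce
      moreover have "{x \<in> ball 0 (Suc m). s m x \<in> V} = T"
        using u BT by (auto simp: T_def)
      ultimately have "open T"
        by (metis open_ball openin_open_eq)
      then show ?thesis
        using m that by (intro exI [of _ T]) (auto simp: T_def)
    qed
    then have "open (u -` V)"
      by (subst open_subopen) auto
    then show "openin euclidean {x \<in> topspace euclidean. u x \<in> V}"
      by (simp add: vimage_def)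
  qed
  moreover have "u 0 = p" "\<Lambda> (u x) = f x" for x
    using s kB by (auto simp: u_def)
  ultimately show ?thesis
    using that by blast
qed

section \<open>Clifford algebra\<close>

subsection \<open>Conjugation\<close>

text \<open>
  Identities between linear maps of the Clifford algebra are checked on products of generators.
\<close>

lemma blade_linear_induct:
  assumes "linear f" "linear g" "\<And>S. f (blade S) = g (blade S)"
  shows "f x = g x"
proof -
  have "f (\<Sum>S\<in>UNIV. blade_coeffs x $ S *\<^sub>R blade S) = g (\<Sum>S\<in>UNIV. blade_coeffs x $ S *\<^sub>R blade S)"
    by (simp add: linear_sum [OF assms(1)] linear_sum [OF assms(2)] linear_scale [OF assms(1)]
        linear_scale [OF assms(2)] assms(3))
  then show ?thesis
    by (simp only: blade_expansion [symmetric])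
qed

lemma linear_mult_left: "linear (\<lambda>x. a * (x :: 'a::real_algebra))"
  by (rule linearI) (simp_all add: distrib_left)

lemma linear_mult_right: "linear (\<lambda>x. (x :: 'a::real_algebra) * a)"
  by (rule linearI) (simp_all add: distrib_right)

lemma prod_list_gen_inverse:
  "prod_list (map gen xs) * prod_list (map (\<lambda>i. - gen i) (rev xs)) = (1 :: 'n::{finite,linorder} clifford)"
  "prod_list (map (\<lambda>i. - gen i) (rev xs)) * prod_list (map gen xs) = (1 :: 'n clifford)"
proof -
  show "prod_list (map gen xs) * prod_list (map (\<lambda>i. - gen i) (rev xs)) = (1 :: 'n clifford)"
  proof (induction xs)
    case (Cons i xs)
    have "prod_list (map gen (i # xs)) * prod_list (map (\<lambda>i. - gen i) (rev (i # xs))) =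
        gen i * (prod_list (map gen xs) * prod_list (map (\<lambda>i. - gen i) (rev xs))) * - gen i"
      by (simp add: mult.assoc)
    also have "\<dots> = 1"
      by (simp only: Cons.IH) (simp add: gen_sq)
    finally show ?case .
  qed simp
  show "prod_list (map (\<lambda>i. - gen i) (rev xs)) * prod_list (map gen xs) = (1 :: 'n clifford)"
  proof (induction xs)
    case (Cons i xs)
    have "prod_list (map (\<lambda>i. - gen i) (rev (i # xs))) * prod_list (map gen (i # xs)) =
        prod_list (map (\<lambda>i. - gen i) (rev xs)) * (- gen i * gen i) * prod_list (map gen xs)"
      by (simp add: mult.assoc)
    also have "\<dots> = 1"
      using Cons.IH by (simp add: gen_sq)
    finally show ?case .
  qed simp
qed

lemma prod_list_uminus:
  "prod_list (map (\<lambda>i. - f i) xs) = (- 1) ^ length xs * prod_list (map (f :: _ \<Rightarrow> 'a::ring_1) xs)"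
proof (induction xs)
  case (Cons x xs)
  have "(- 1) ^ length xs * f x = f x * (- 1) ^ length xs"
    by (cases "even (length xs)") simp_all
  then show ?case
    using Cons by (simp add: mult.assoc [symmetric])
qed simp

lemma grade_involution_blade: "grade_involution (blade S) = (- 1) ^ card S * blade S"
  unfolding grade_involution_def clifford_lift_blade
  by (simp add: ordered_prod_def prod_list_uminus blade_eq_ordered_prod)

lemma linear_grade_involution: "linear grade_involution"
  by (rule grade_involution_simps)

lemma linear_clifford_conj: "linear clifford_conj"
proof -
  have "clifford_conj = reversal \<circ> grade_involution"
    by (simp add: clifford_conj_def fun_eq_iff)
  then show ?thesis
    by (metis linear_compose linear_grade_involution linear_reversal)
qed

lemma clifford_conj_blade:
  "clifford_conj (blade S) = prod_list (map (\<lambda>i. - gen i) (rev (sorted_list_of_set S)))"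
proof -
  have r: "reversal (blade S) = prod_list (map gen (rev (sorted_list_of_set S)))"
    using reversal_sorted_prod [of "sorted_list_of_set S"]
    by (simp add: blade_eq_ordered_prod ordered_prod_def)
  have e: "(- 1) ^ k * x = (- 1 :: real) ^ k *\<^sub>R x" for k and x :: "'a clifford"
    by (cases "even k") simp_all
  show ?thesis
    unfolding clifford_conj_def grade_involution_blade prod_list_uminus e linear_scale [OF linear_reversal] r
    by simp
qed

lemma blade_conj: "blade S * clifford_conj (blade S) = 1" "clifford_conj (blade S) * blade S = 1"
  unfolding clifford_conj_blade by (simp_all only: blade_eq_ordered_prod ordered_prod_def prod_list_gen_inverse)

lemma blade_sign_sq: "blade_sign S T * blade_sign S T = 1"
  unfolding blade_sign_def prod.distrib [symmetric] by (intro prod.neutral ballI) (simp add: prod.distrib [symmetric])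

text \<open>
  The conjugate of a blade is its inverse, and so is the conjugate of a blade up to sign.  As the product
  of two blades is again a blade up to sign, the rule is the one for the inverse of a product.
\<close>

lemma clifford_conj_blade_mult:
  "clifford_conj (blade S * blade T) = clifford_conj (blade T) * clifford_conj (blade S)"
proof -
  define u where "u = blade S * blade T"
  define v where "v = clifford_conj (blade T) * clifford_conj (blade S)"
  define \<sigma> where "\<sigma> = blade_sign S T"
  have u: "u = \<sigma> *\<^sub>R blade (sym_diff S T)" and \<sigma>: "\<sigma> * \<sigma> = 1"
    by (simp_all add: u_def \<sigma>_def blade_mult blade_sign_sq)
  have cu: "clifford_conj u * u = 1"
    by (simp add: u linear_scale [OF linear_clifford_conj] blade_conj \<sigma>)
  have "u * v = blade S * (blade T * clifford_conj (blade T)) * clifford_conj (blade S)"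
    by (simp only: u_def v_def mult.assoc)
  then have uv: "u * v = 1"
    by (simp add: blade_conj)
  have "clifford_conj u = clifford_conj u * (u * v)"
    by (simp add: uv)
  also have "\<dots> = v"
    by (simp only: mult.assoc [symmetric] cu) simp
  finally show ?thesis
    by (simp add: u_def v_def)
qed

lemma clifford_conj_mult: "clifford_conj (x * y) = clifford_conj y * clifford_conj x"
proof -
  have lin: "linear (\<lambda>y. clifford_conj (a * y))" "linear (\<lambda>x. clifford_conj (x * a))"
    "linear (\<lambda>y. clifford_conj y * a)" "linear (\<lambda>x. a * clifford_conj x)" for a :: "'a clifford"
    using linear_compose [OF linear_mult_left linear_clifford_conj, of a]
      linear_compose [OF linear_mult_right linear_clifford_conj, of a]
      linear_compose [OF linear_clifford_conj linear_mult_right, of a]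
      linear_compose [OF linear_clifford_conj linear_mult_left, of a]
    by (simp_all add: o_def)
  have "clifford_conj (blade S * y) = clifford_conj y * clifford_conj (blade S)" for S
    using lin(1,3) clifford_conj_blade_mult by (rule blade_linear_induct)
  with lin(2,4) show ?thesis
    by (rule blade_linear_induct)
qed

lemma clifford_conj_one [simp]: "clifford_conj 1 = 1"
  by (simp add: one_clifford_def clifford_conj_blade)

lemma clifford_conj_gen [simp]: "clifford_conj (gen i) = - gen i"
  by (simp add: gen_def clifford_conj_blade)

lemma clifford_conj_minus [simp]: "clifford_conj (- x) = - clifford_conj x"
  by (rule linear_neg [OF linear_clifford_conj])

lemma grade_involution_minus [simp]: "grade_involution (- x) = - grade_involution x"
  by (rule linear_neg [OF linear_grade_involution])

lemma grade_involution_one [simp]: "grade_involution 1 = 1"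
  by (rule grade_involution_simps)

lemma clifford_conj_grade_involution:
  "clifford_conj (grade_involution x) = grade_involution (clifford_conj x)"
proof (rule blade_linear_induct [of "\<lambda>x. clifford_conj (grade_involution x)" "\<lambda>x. grade_involution (clifford_conj x)"])
  show "linear (\<lambda>x. clifford_conj (grade_involution x))" "linear (\<lambda>x. grade_involution (clifford_conj x))"
    using linear_compose [OF linear_clifford_conj linear_grade_involution]
      linear_compose [OF linear_grade_involution linear_clifford_conj] by (simp_all add: o_def)
  fix S :: "'a set"
  have h: "grade_involution (prod_list xs) = prod_list (map grade_involution xs)" for xs :: "'a clifford list"
    by (induction xs) (simp_all add: grade_involution_simps(3))
  have c: "clifford_conj (prod_list (map gen ys)) = prod_list (map (\<lambda>i. - gen i) (rev ys))" for ys :: "'a list"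
    by (induction ys) (simp_all add: clifford_conj_mult)
  have "grade_involution (clifford_conj (blade S)) = prod_list (map gen (rev (sorted_list_of_set S)))"
    by (simp add: clifford_conj_blade h o_def grade_involution_simps(4))
  moreover have "clifford_conj (grade_involution (blade S)) = (- 1) ^ card S * clifford_conj (blade S)"
    unfolding grade_involution_blade by (cases "even (card S)") simp_all
  ultimately show "clifford_conj (grade_involution (blade S)) = grade_involution (clifford_conj (blade S))"
    by (cases "even (card S)") (simp_all add: clifford_conj_blade prod_list_uminus)
qed

text \<open>
  In finite dimension, left multiplication by \<open>x\<close> is injective as soon as it is surjective.
\<close>

lemma clifford_inverse_commutes:
  fixes x y :: "'n::{finite,linorder} clifford"
  assumes "x * y = 1"
  shows "y * x = 1"
proof -
  have "surj (\<lambda>z. x * z)"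
  proof (rule surjI)
    show "x * (y * z) = z" for z
      using assms by (simp add: mult.assoc [symmetric])
  qed
  then have "inj (\<lambda>z. x * z)"
    by (rule linear_surjective_imp_injective [OF linear_mult_left]) simp
  moreover have "x * (y * x) = x * 1"
    using assms by (simp add: mult.assoc [symmetric])
  ultimately show ?thesis
    by (rule injD)
qed

subsection \<open>Vectors and reflections\<close>

lemma linear_cvec: "linear cvec"
  by (rule linearI) (simp_all add: cvec_def scaleR_left_distrib sum.distrib scaleR_sum_right)

lemma cvec_axis: "cvec (axis i 1) = gen i"
  by (simp add: cvec_def axis_def if_distrib [of "\<lambda>c. c *\<^sub>R _"] sum.delta cong: if_cong)

lemma clifford_conj_cvec: "clifford_conj (cvec v) = - cvec v"
  by (simp add: cvec_def linear_sum [OF linear_clifford_conj] linear_scale [OF linear_clifford_conj] sum_negf)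

lemma grade_involution_cvec: "grade_involution (cvec v) = - cvec v"
  by (simp add: cvec_def linear_sum [OF linear_grade_involution] linear_scale [OF linear_grade_involution]
      grade_involution_simps(4) sum_negf)

lemma gen_anticommutator: "gen i * gen j + gen j * gen i = (if i = j then - 2 else 0)"
  using gen_anticommute [of i j] gen_sq [of i] by auto

lemma cvec_anticommutator:
  fixes v w :: "real ^ 'n::{finite,linorder}"
  shows "cvec v * cvec w + cvec w * cvec v = (- 2 * (v \<bullet> w)) *\<^sub>R 1"
proof -
  have "cvec v * cvec w + cvec w * cvec v =
      (\<Sum>i\<in>UNIV. \<Sum>j\<in>UNIV. (v $ i * w $ j) *\<^sub>R (gen i * gen j)) + (\<Sum>j\<in>UNIV. \<Sum>i\<in>UNIV. (v $ i * w $ j) *\<^sub>R (gen j * gen i))"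
        by (simp only: cvec_def sum_product mult_scaleR_left mult_scaleR_right scaleR_scaleR)
      (simp only: mult.commute)
  also have "(\<Sum>j\<in>UNIV. \<Sum>i\<in>UNIV. (v $ i * w $ j) *\<^sub>R (gen j * gen i)) =
      (\<Sum>i\<in>UNIV. \<Sum>j\<in>UNIV. (v $ i * w $ j) *\<^sub>R (gen j * gen i))"
    by (rule sum.swap)
  also have "(\<Sum>i\<in>UNIV. \<Sum>j\<in>UNIV. (v $ i * w $ j) *\<^sub>R (gen i * gen j)) + \<dots> =
      (\<Sum>i\<in>UNIV. \<Sum>j\<in>UNIV. (v $ i * w $ j) *\<^sub>R (gen i * gen j + gen j * gen i))"
    by (simp add: sum.distrib [symmetric] scaleR_right_distrib)
  also have "\<dots> = (\<Sum>i\<in>UNIV. (v $ i * w $ i) *\<^sub>R (- 2))"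
    by (simp add: gen_anticommutator if_distrib [of "\<lambda>c. _ *\<^sub>R c"] sum.delta cong: if_cong)
  also have "\<dots> = (v \<bullet> w) *\<^sub>R (- 2)"
    by (simp add: inner_vec_def scaleR_sum_left sum_negf)
  also have "- 2 = (- 2 :: real) *\<^sub>R (1 :: 'n clifford)"
    by (simp add: scaleR_conv_of_real)
  finally show ?thesis
    by (simp only: scaleR_scaleR mult.commute)
qed

lemma cvec_sq: "cvec v * cvec v = (- (v \<bullet> v)) *\<^sub>R 1"
proof -
  have "2 *\<^sub>R (cvec v * cvec v) = 2 *\<^sub>R ((- (v \<bullet> v)) *\<^sub>R 1)"
    unfolding scaleR_2 [of "cvec v * cvec v"] cvec_anticommutator by simp
  then show ?thesis
    by (simp only: scaleR_cancel_left) simp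
qed

definition reflect :: "'a::real_inner \<Rightarrow> 'a \<Rightarrow> 'a" where
  "reflect u v = v - (2 * (u \<bullet> v)) *\<^sub>R u"

text \<open>
  A unit vector satisfies \<open>u\<^sup>2 = -1\<close>, and moving it past \<open>v\<close> produces the reflection term; this is how
  the Clifford algebra encodes reflections.
\<close>

lemma cvec_sandwich:
  assumes "norm u = 1"
  shows "cvec u * cvec v * cvec u = cvec (reflect u v)"
proof -
  have "cvec u * cvec v = (- 2 * (u \<bullet> v)) *\<^sub>R 1 - cvec v * cvec u"
    using cvec_anticommutator [of u v] by (simp add: algebra_simps)
  then have "cvec u * cvec v * cvec u = (- 2 * (u \<bullet> v)) *\<^sub>R cvec u - cvec v * (cvec u * cvec u)"
    by (simp add: left_diff_distrib mult.assoc)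
  also have "cvec u * cvec u = - 1"
    using assms by (simp add: cvec_sq norm_eq_1)
  finally show ?thesis
    by (simp add: reflect_def linear_diff [OF linear_cvec] linear_scale [OF linear_cvec])
qed

subsection \<open>The twisted centre\<close>

text \<open>
  A generator anticommutes with each of the other generators.  Moving \<open>e\<^sub>i\<close> past \<open>e\<^sub>S\<close> therefore costs the
  sign \<open>(-1)\<^bsup>|S|\<^esup>\<close>, corrected by one sign if \<open>i \<in> S\<close>.  The grade involution absorbs the first factor.
\<close>

lemma gen_mult_blade: "grade_involution (blade S) * gen i = (if i \<in> S then - 1 else 1) *\<^sub>R (gen i * blade S)"
proof -
  have 1: "blade_sign {i} S * blade_sign S {i} = (\<Prod>t\<in>S. (if t = i then 1 else - 1))"
    unfolding blade_sign_def by (simp add: prod.distrib [symmetric]) (intro prod.cong, auto)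
  also have "\<dots> = (- 1) ^ card S * (if i \<in> S then - 1 else 1)"
  proof (cases "i \<in> S")
    case True
    define m where "m = card (S - {i})"
    have "card S = Suc m"
      unfolding m_def using True by (simp only: card.remove finite)
    moreover have "(\<Prod>t\<in>S - {i}. (if t = i then 1 else - 1 :: real)) = (\<Prod>t\<in>S - {i}. - 1)"
      by (intro prod.cong) auto
    ultimately show ?thesis
      using True by (simp only: prod.remove [OF finite True]) (simp flip: m_def)
  next
    case False
    then have "(\<Prod>t\<in>S. (if t = i then 1 else - 1 :: real)) = (\<Prod>t\<in>S. - 1)"
      by (intro prod.cong) auto
    then show ?thesis using False by simp
  qed
  finally have "blade_sign {i} S * (blade_sign {i} S * blade_sign S {i}) = blade_sign {i} S * ((- 1) ^ card S * (if i \<in> S then - 1 else 1))"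
    by simp
  then have 2: "blade_sign S {i} = blade_sign {i} S * ((- 1) ^ card S * (if i \<in> S then - 1 else 1))"
    by (simp only: mult.assoc [symmetric] blade_sign_sq)
  have "sym_diff S {i} = sym_diff {i} S"
    by blast
  then have "blade S * gen i = ((- 1) ^ card S * (if i \<in> S then - 1 else 1)) *\<^sub>R (gen i * blade S)"
    by (simp only: gen_def blade_mult 2 scaleR_scaleR mult_ac)
  then show ?thesis
    unfolding grade_involution_blade by (cases "even (card S)") simp_all
qed

lemma blade_coeffs_combination: "blade_coeffs (\<Sum>T\<in>UNIV. c T *\<^sub>R blade T) $ S = c S"
proof -
  have "blade_coeffs (\<Sum>T\<in>UNIV. c T *\<^sub>R blade T) $ S = (\<Sum>T\<in>UNIV. if T = S then c T else 0)"
    by (simp add: if_distrib cong: if_cong)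
  then show ?thesis by simp
qed

text \<open>
  Multiplying by \<open>e\<^sub>i\<close> and comparing coefficients, an element of the twisted centre has coefficient zero at
  every blade that contains \<open>e\<^sub>i\<close>.  As this holds for all \<open>i\<close>, only the scalar part remains.
\<close>

lemma twisted_central_imp_scalar:
  fixes z :: "'n::{finite,linorder} clifford"
  assumes "\<And>i. grade_involution z * gen i = gen i * z"
  shows "\<exists>c. z = c *\<^sub>R 1"
proof -
  have zero: "blade_coeffs z $ S = 0" if i: "i \<in> S" for i S
  proof -
    have lin: "linear (\<lambda>z. gen i * (grade_involution z * gen i))"
      using linear_compose [OF linear_grade_involution linear_compose [OF linear_mult_right linear_mult_left]]
      by (simp add: o_def)
    have bl: "gen i * (grade_involution (blade T) * gen i) = (if i \<in> T then 1 else - 1) *\<^sub>R blade T" for T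
      by (simp add: gen_mult_blade mult.assoc [symmetric] gen_sq)
    have "- z = gen i * (grade_involution z * gen i)"
      by (simp add: assms mult.assoc [symmetric] gen_sq)
    also have "\<dots> = gen i * (grade_involution (\<Sum>T\<in>UNIV. blade_coeffs z $ T *\<^sub>R blade T) * gen i)"
      by (simp only: blade_expansion [symmetric])
    also have "\<dots> = (\<Sum>T\<in>UNIV. (blade_coeffs z $ T * (if i \<in> T then 1 else - 1)) *\<^sub>R blade T)"
      by (simp only: linear_sum [OF lin] linear_scale [OF lin] bl scaleR_scaleR)
    finally have "blade_coeffs (- z) $ S = blade_coeffs z $ S * (if i \<in> S then 1 else - 1)"
      by (simp only: blade_coeffs_combination)
    then show ?thesis
      using i by simp
  qed
  have "blade_coeffs z $ S *\<^sub>R blade S = (if S = {} then blade_coeffs z $ {} *\<^sub>R 1 else 0)" for S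
    using zero by (cases "S = {}") (auto simp: one_clifford_def)
  then have "(\<Sum>S\<in>UNIV. blade_coeffs z $ S *\<^sub>R blade S) =
      (\<Sum>S\<in>(UNIV :: 'n set set). if S = {} then blade_coeffs z $ {} *\<^sub>R 1 else 0)"
    by (rule sum.cong [OF refl])
  then have "z = (\<Sum>S\<in>(UNIV :: 'n set set). if S = {} then blade_coeffs z $ {} *\<^sub>R 1 else 0)"
    by (simp only: blade_expansion [symmetric])
  then have "z = blade_coeffs z $ {} *\<^sub>R 1"
    by simp
  then show ?thesis ..
qed

section \<open>The spin group as a double cover of the rotation group\<close>

subsection \<open>Orthogonal maps as products of reflections\<close>

lemma linear_reflect: "linear (reflect u)"
  by (rule linearI) (simp_all add: reflect_def inner_right_distrib algebra_simps scaleR_left_distrib)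

lemma norm_reflect:
  assumes "norm u = 1"
  shows "norm (reflect u v) = norm v"
proof -
  have "u \<bullet> u = 1"
    using assms by (simp add: norm_eq_1)
  then have "reflect u v \<bullet> reflect u v = v \<bullet> v"
    by (simp add: reflect_def inner_diff_left inner_diff_right inner_commute algebra_simps)
  then show ?thesis
    by (simp add: norm_eq_sqrt_inner)
qed

lemma orthogonal_transformation_reflect: "norm u = 1 \<Longrightarrow> orthogonal_transformation (reflect u)"
  by (simp add: orthogonal_transformation linear_reflect norm_reflect)

lemma reflect_reflect:
  assumes "norm u = 1"
  shows "reflect u (reflect u v) = v"
proof -
  have "u \<bullet> u = 1"
    using assms by (simp add: norm_eq_1)
  then have "u \<bullet> reflect u v = - (u \<bullet> v)"
    by (simp add: reflect_def inner_diff_right)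
  then show ?thesis
    by (simp add: reflect_def [of u "reflect u v"]) (simp add: reflect_def)
qed

text \<open>
  For vectors of equal length, the hyperplane orthogonal to \<open>a - b\<close> bisects them.
\<close>

lemma reflect_exchange:
  assumes "norm a = norm b" "a \<noteq> b"
  shows "reflect ((a - b) /\<^sub>R norm (a - b)) a = b"
proof -
  define d where "d = a - b"
  have d: "norm d \<noteq> 0"
    using assms by (simp add: d_def)
  have "a \<bullet> a = b \<bullet> b"
    using assms(1) by (simp add: norm_eq_sqrt_inner)
  then have "2 * (d \<bullet> a) = d \<bullet> d"
    by (simp add: d_def inner_diff_left inner_diff_right inner_commute)
  then have "2 * (d \<bullet> a) = norm d * norm d"
    by (simp add: power2_norm_eq_inner [symmetric] power2_eq_square)
  then have "reflect (d /\<^sub>R norm d) a = a - d"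
    using d by (simp add: reflect_def field_simps)
  then show ?thesis
    by (simp add: d_def)
qed

lemma orthogonal_transformation_foldr_reflect:
  assumes "\<forall>u\<in>set us. norm u = 1"
  shows "orthogonal_transformation (foldr reflect us)"
  using assms
proof (induction us)
  case (Cons u us)
  then have "orthogonal_transformation (reflect u \<circ> foldr reflect us)"
    by (intro orthogonal_transformation_compose orthogonal_transformation_reflect) simp_all
  then show ?case by (simp add: o_def)
qed (simp add: id_def orthogonal_transformation_id)

text \<open>
  The theorem of Cartan and Dieudonne, by induction on a set of indices outside of which the map fixes
  the standard basis: one reflection exchanges \<open>f e\<^sub>i\<close> and \<open>e\<^sub>i\<close>, and it leaves alone the basis vectors that
  were fixed before, because they are orthogonal to \<open>f e\<^sub>i - e\<^sub>i\<close>.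
\<close>

theorem orthogonal_transformation_product_of_reflections:
  fixes f :: "real ^ 'n \<Rightarrow> real ^ 'n"
  assumes "orthogonal_transformation f"
  obtains us where "\<forall>u\<in>set us. norm u = 1" "f = foldr reflect us"
proof -
  have "\<exists>us. (\<forall>u\<in>set us. norm u = 1) \<and> f = foldr reflect us"
    if "orthogonal_transformation f" "\<forall>j\<in>- B. f (axis j 1) = axis j 1" for B :: "'n set" and f :: "real ^ 'n \<Rightarrow> real ^ 'n"
    using finite [of B] that
  proof (induction B arbitrary: f rule: finite_induct)
    case empty
    have lin: "linear f" "linear (\<lambda>v::real^'n. v)"
      using empty by (simp_all add: orthogonal_transformation_def linear_id [unfolded id_def])
    have "f = (\<lambda>v. v)"
      by (rule linear_eq_stdbasis [OF lin]) (use empty in \<open>auto simp: Basis_vec_def\<close>)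
    then have "f = foldr reflect []"
      by (simp add: fun_eq_iff)
    then show ?case
      by (intro exI [of _ "[]"]) simp
  next
    case (insert i B)
    note f = insert.prems
    show ?case
    proof (cases "f (axis i 1) = axis i 1")
      case True
      then have "\<forall>j\<in>- B. f (axis j 1) = axis j 1"
        using f(2) by auto
      then show ?thesis
        using insert.IH f(1) by blast
    next
      case False
      define d where "d = f (axis i 1) - axis i 1"
      define u where "u = d /\<^sub>R norm d"
      have "norm (f (axis i 1)) = norm (axis i 1 :: real ^ 'n)"
        using f(1) by (simp add: orthogonal_transformation_norm)
      then have ui: "reflect u (f (axis i 1)) = axis i 1"
        unfolding u_def d_def using False by (rule reflect_exchange)
      have u: "norm u = 1"
        using False by (simp add: u_def d_def)
      have uj: "reflect u (f (axis j 1)) = axis j 1" if "j \<in> - insert i B" for j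
      proof -
        have fj: "f (axis j 1) = axis j 1" and ij: "i \<noteq> j"
          using f(2) that by auto
        have "f (axis i 1) \<bullet> f (axis j 1) = axis i 1 \<bullet> (axis j 1 :: real ^ 'n)"
          using f(1) by (simp add: orthogonal_transformation_def)
        then have "d \<bullet> axis j 1 = 0"
          by (simp add: d_def inner_diff_left fj)
        then show ?thesis
          by (simp add: fj reflect_def u_def)
      qed
      have "orthogonal_transformation (reflect u \<circ> f)"
        using u f(1) by (intro orthogonal_transformation_compose orthogonal_transformation_reflect)
      moreover have "(reflect u \<circ> f) (axis j 1) = axis j 1" if "j \<in> - B" for j
        by (cases "j = i") (use ui uj [of j] that in auto)
      ultimately obtain us where us: "\<forall>u\<in>set us. norm u = 1" "reflect u \<circ> f = foldr reflect us"
        using insert.IH by blast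
      have "f = foldr reflect (u # us)"
        using us(2) reflect_reflect [OF u] by (simp add: fun_eq_iff) metis
      then show ?thesis
        using us(1) u by (intro exI [of _ "u # us"]) auto
    qed
  qed
  from this [of f UNIV] show ?thesis
    using assms that by auto
qed

text \<open>
  All reflections are conjugate under orthogonal matrices, and the reflection in a coordinate hyperplane is
  diagonal.
\<close>

lemma det_reflect:
  fixes u :: "real ^ 'n"
  assumes "norm u = 1"
  shows "det (matrix (reflect u)) = - 1"
proof -
  fix k :: 'n
  obtain A :: "real ^ 'n ^ 'n" where A: "orthogonal_matrix A" "A *v axis k 1 = u"
    using orthogonal_matrix_exists_basis [OF assms] by metis
  have iso: "(A *v v) \<bullet> (A *v w) = v \<bullet> w" for v w
    using A(1) orthogonal_transformation_matrix [of "(*v) A"] by (simp add: orthogonal_transformation_def)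
  have "reflect u \<circ> (*v) A = (*v) A \<circ> reflect (axis k 1)"
    unfolding A(2) [symmetric] reflect_def o_def iso
    by (simp add: matrix_vector_mult_diff_distrib matrix_vector_mult_scaleR)
  then have "matrix (reflect u \<circ> (*v) A) = matrix ((*v) A \<circ> reflect (axis k 1))"
    by simp
  then have "matrix (reflect u) ** A = A ** matrix (reflect (axis k 1))"
    by (simp add: matrix_compose linear_reflect)
  then have "det (matrix (reflect u)) * det A = det A * det (matrix (reflect (axis k 1 :: real ^ 'n)))"
    by (metis det_mul)
  moreover have "det A \<noteq> 0"
    using det_orthogonal_matrix [OF A(1)] by auto
  moreover have "det (matrix (reflect (axis k 1 :: real ^ 'n))) = - 1"
  proof -
    have entry: "matrix (reflect (axis k 1 :: real ^ 'n)) $ i $ j = (if i = j then if i = k then - 1 else 1 else 0)" for i j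
      by (auto simp: matrix_def reflect_def inner_axis_axis) (auto simp: axis_def)
    have "det (matrix (reflect (axis k 1 :: real ^ 'n))) = (\<Prod>i\<in>UNIV. if i = k then - 1 else 1)"
      by (subst det_diagonal) (auto simp: entry)
    then show ?thesis by simp
  qed
  ultimately show ?thesis
    by (metis mult.commute mult_cancel_left)
qed

lemma det_foldr_reflect:
  fixes us :: "(real ^ 'n) list"
  assumes "\<forall>u\<in>set us. norm u = 1"
  shows "det (matrix (foldr reflect us)) = (- 1) ^ length us"
  using assms
proof (induction us)
  case (Cons u us)
  have "foldr reflect (u # us) = reflect u \<circ> foldr reflect us"
    by (simp add: o_def)
  moreover have "linear (foldr reflect us)"
    using Cons.prems orthogonal_transformation_foldr_reflect [of us] by (simp add: orthogonal_transformation_def)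
  ultimately have "matrix (foldr reflect (u # us)) = matrix (reflect u) ** matrix (foldr reflect us)"
    by (simp only: matrix_compose linear_reflect)
  then have "det (matrix (foldr reflect (u # us))) = det (matrix (reflect u)) * det (matrix (foldr reflect us))"
    by (simp only: det_mul)
  then show ?case
    using Cons by (simp only: det_reflect) (simp add: det_reflect)
qed (simp add: matrix_id [unfolded id_def] id_def)

subsection \<open>Products of unit vectors\<close>

lemma cvec_prod_unit:
  assumes "\<forall>u\<in>set us. norm u = 1"
  shows "prod_list (map cvec us) * clifford_conj (prod_list (map cvec us)) = 1"
  using assms
proof (induction us)
  case (Cons u us)
  let ?y = "prod_list (map cvec us)"
  have "cvec u * ?y * clifford_conj (cvec u * ?y) = cvec u * (?y * clifford_conj ?y) * (- cvec u)"
    by (simp add: clifford_conj_mult clifford_conj_cvec mult.assoc)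
  also have "\<dots> = 1"
    using Cons by (simp add: cvec_sq norm_eq_1)
  finally show ?case by simp
qed simp

lemma cvec_prod_sandwich:
  assumes "\<forall>u\<in>set us. norm u = 1"
  shows "prod_list (map cvec us) * cvec v * clifford_conj (prod_list (map cvec us)) =
    (- 1) ^ length us *\<^sub>R cvec (foldr reflect us v)"
  using assms
proof (induction us)
  case (Cons u us)
  let ?y = "prod_list (map cvec us)"
  have "cvec u * ?y * cvec v * clifford_conj (cvec u * ?y) = cvec u * (?y * cvec v * clifford_conj ?y) * (- cvec u)"
    by (simp add: clifford_conj_mult clifford_conj_cvec mult.assoc)
  also have "\<dots> = - ((- 1) ^ length us *\<^sub>R (cvec u * cvec (foldr reflect us v) * cvec u))"
    using Cons by simp
  also have "\<dots> = (- 1) ^ length (u # us) *\<^sub>R cvec (reflect u (foldr reflect us v))"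
    using Cons.prems by (simp add: cvec_sandwich)
  finally show ?case by simp
qed simp

lemma grade_involution_cvec_prod:
  "grade_involution (prod_list (map cvec us)) = (- 1) ^ length us *\<^sub>R prod_list (map cvec us)"
  by (induction us) (simp_all add: grade_involution_simps(3) grade_involution_cvec)

text \<open>
  For a unit \<open>z\<close> that commutes with vectors up to the sign \<open>e\<close> of its own parity, twisted centrality forces
  \<open>z\<close> to be a scalar, so its parity is even.  The lemma is applied to quotients of two elements that
  induce the same rotation.
\<close>

lemma twisted_central_unit:
  fixes z :: "'n::{finite,linorder} clifford"
  assumes z: "z * clifford_conj z = 1" and e: "e * e = 1" and g: "grade_involution z = e *\<^sub>R z"
    and c: "\<And>v. z * cvec v = e *\<^sub>R (cvec v * z)"
  shows "e = 1" "z = 1 \<or> z = - 1"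
proof -
  have "grade_involution z * gen i = gen i * z" for i
    using c [of "axis i 1"] e by (simp add: g cvec_axis)
  then obtain a where a: "z = a *\<^sub>R 1"
    using twisted_central_imp_scalar by blast
  then have "(a * a) *\<^sub>R (1 :: 'n clifford) = 1 *\<^sub>R 1"
    using z by (simp add: linear_scale [OF linear_clifford_conj])
  then have aa: "a * a = 1"
    by (simp only: scaleR_cancel_right) simp
  have "e *\<^sub>R z = 1 *\<^sub>R z"
    using g by (simp add: a linear_scale [OF linear_grade_involution])
  moreover have "z \<noteq> 0"
    using z by auto
  ultimately show "e = 1"
    by (simp only: scaleR_cancel_right) simp
  have "a = 1 \<or> a = - 1"
    using aa by (metis square_eq_1_iff)
  then show "z = 1 \<or> z = - 1"
    by (auto simp: a)
qed

subsection \<open>The double cover\<close>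

lemma SpinD:
  assumes "x \<in> Spin"
  shows "grade_involution x = x" "x * clifford_conj x = 1" "clifford_conj x * x = 1"
    "x * cvec v * clifford_conj x \<in> range cvec"
  using assms clifford_inverse_commutes by (auto simp: Spin_def)

lemma Spin_one [simp]: "1 \<in> Spin"
  by (simp add: Spin_def)

lemma Spin_minus [simp]: "- x \<in> Spin \<longleftrightarrow> x \<in> Spin"
  by (auto simp: Spin_def)

lemma Spin_mult:
  assumes x: "x \<in> Spin" and y: "y \<in> Spin"
  shows "x * y \<in> Spin"
proof -
  have "x * y * clifford_conj (x * y) = x * (y * clifford_conj y) * clifford_conj x"
    by (simp only: clifford_conj_mult mult.assoc)
  moreover have "x * y * cvec v * clifford_conj (x * y) \<in> range cvec" for v
  proof -
    obtain w where "y * cvec v * clifford_conj y = cvec w"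
      using SpinD(4) [OF y] by blast
    then have "x * y * cvec v * clifford_conj (x * y) = x * cvec w * clifford_conj x"
      by (simp only: clifford_conj_mult mult.assoc) (simp only: mult.assoc [symmetric])
    then show ?thesis
      using SpinD(4) [OF x] by simp
  qed
  ultimately show ?thesis
    using x y by (simp add: Spin_def grade_involution_simps(3))
qed

text \<open>
  This equation characterises the rotation covered by \<open>x\<close>, because vectors embed injectively.
\<close>

lemma cvec_spin_cover:
  assumes "x \<in> Spin"
  shows "cvec (spin_cover x *v v) = x * cvec v * clifford_conj x"
proof -
  define f where "f = (\<lambda>v. the_inv cvec (x * cvec v * clifford_conj x))"
  have f: "cvec (f v) = x * cvec v * clifford_conj x" for v
    unfolding f_def by (rule f_the_inv_into_f [OF inj_cvec SpinD(4) [OF assms]])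
  have "linear f"
    by (rule linearI; rule injD [OF inj_cvec])
      (simp_all add: f linear_add [OF linear_cvec] linear_scale [OF linear_cvec] distrib_left distrib_right)
  then have "matrix f *v v = f v"
    using matrix_vector_mul(2) by metis
  then show ?thesis
    using f by (simp add: spin_cover_def f_def)
qed

lemma orthogonal_spin_cover:
  assumes "x \<in> Spin"
  shows "orthogonal_matrix (spin_cover x)"
proof -
  let ?f = "(*v) (spin_cover x)"
  have "norm (?f v) = norm v" for v
  proof -
    have "cvec (?f v) * cvec (?f v) = x * cvec v * (clifford_conj x * x) * cvec v * clifford_conj x"
      by (simp only: cvec_spin_cover [OF assms] mult.assoc)
    also have "\<dots> = x * (cvec v * cvec v) * clifford_conj x"
      by (simp add: SpinD [OF assms] mult.assoc)
    also have "\<dots> = (- (v \<bullet> v)) *\<^sub>R 1"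
      by (simp add: cvec_sq SpinD [OF assms])
    finally have "(- (?f v \<bullet> ?f v)) *\<^sub>R (1 :: 'a clifford) = (- (v \<bullet> v)) *\<^sub>R 1"
      by (simp only: cvec_sq)
    then have "?f v \<bullet> ?f v = v \<bullet> v"
      by (simp only: scaleR_cancel_right) simp
    then show ?thesis
      by (simp add: norm_eq_sqrt_inner)
  qed
  then have "orthogonal_transformation ?f"
    by (simp add: orthogonal_transformation)
  then show ?thesis
    by (simp add: orthogonal_transformation_matrix)
qed

lemma spin_cover_eqI:
  assumes "\<And>v. x * cvec v * clifford_conj x = cvec (A *v v)"
  shows "spin_cover x = A"
proof -
  have "(\<lambda>v. the_inv cvec (x * cvec v * clifford_conj x)) = (*v) A"
    by (simp add: assms the_inv_f_f inj_cvec)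
  then show ?thesis
    by (simp add: spin_cover_def)
qed

lemma spin_cover_one [simp]: "spin_cover 1 = mat 1"
  by (rule spin_cover_eqI) simp

lemma spin_cover_minus [simp]: "spin_cover (- x) = spin_cover x"
  by (simp add: spin_cover_def)

lemma spin_cover_mult:
  assumes x: "x \<in> Spin" and y: "y \<in> Spin"
  shows "spin_cover (x * y) = spin_cover x ** spin_cover y"
proof (rule spin_cover_eqI)
  fix v
  have "x * y * cvec v * clifford_conj (x * y) = x * (y * cvec v * clifford_conj y) * clifford_conj x"
    by (simp only: clifford_conj_mult mult.assoc)
  also have "\<dots> = cvec ((spin_cover x ** spin_cover y) *v v)"
    by (simp add: cvec_spin_cover [OF x, symmetric] cvec_spin_cover [OF y, symmetric] matrix_vector_mul_assoc [symmetric])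
  finally show "x * y * cvec v * clifford_conj (x * y) = cvec ((spin_cover x ** spin_cover y) *v v)" .
qed

lemma Spin_conj:
  assumes "x \<in> Spin"
  shows "clifford_conj x \<in> Spin"
proof -
  let ?y = "clifford_conj x"
  have "clifford_conj ?y * ?y = 1"
    using SpinD(2) [OF assms] clifford_conj_mult [of x ?y] by simp
  moreover have "clifford_conj ?y * (?y * x) = clifford_conj ?y * ?y * x"
    by (simp only: mult.assoc)
  ultimately have cc: "clifford_conj ?y = x"
    using SpinD(3) [OF assms] by simp
  have "?y * cvec v * clifford_conj ?y \<in> range cvec" for v
  proof -
    define A where "A = spin_cover x"
    have "A ** transpose A = mat 1"
      using orthogonal_spin_cover [OF assms] by (simp add: A_def orthogonal_matrix_def)
    then have "A *v (transpose A *v v) = v"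
      by (simp only: matrix_vector_mul_assoc matrix_vector_mul_lid)
    then have "cvec v = x * cvec (transpose A *v v) * ?y"
      using cvec_spin_cover [OF assms, of "transpose A *v v"] by (simp only: A_def)
    then have "?y * cvec v * clifford_conj ?y = (?y * x) * cvec (transpose A *v v) * (?y * x)"
      by (simp only: cc mult.assoc)
    then show ?thesis
      by (simp add: SpinD [OF assms])
  qed
  moreover have "grade_involution ?y = ?y"
    by (simp only: clifford_conj_grade_involution [symmetric] SpinD(1) [OF assms])
  moreover have "?y * clifford_conj ?y = 1"
    by (simp only: cc SpinD(3) [OF assms])
  ultimately show ?thesis
    by (auto simp: Spin_def)
qed

lemma spin_cover_eq_iff:
  assumes x: "x \<in> Spin" and y: "y \<in> Spin"
  shows "spin_cover x = spin_cover y \<longleftrightarrow> x = y \<or> x = - y"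
proof
  assume eq: "spin_cover x = spin_cover y"
  let ?z = "clifford_conj y * x"
  have z: "?z \<in> Spin"
    using x y by (intro Spin_mult Spin_conj)
  have "?z * cvec v = 1 *\<^sub>R (cvec v * ?z)" for v
  proof -
    have "x * cvec v * clifford_conj x = y * cvec v * clifford_conj y"
      using cvec_spin_cover [OF x] cvec_spin_cover [OF y] eq by metis
    then have "clifford_conj y * (x * cvec v * clifford_conj x) * x = clifford_conj y * (y * cvec v * clifford_conj y) * x"
      by simp
    then have "clifford_conj y * x * cvec v * (clifford_conj x * x) = (clifford_conj y * y) * cvec v * (clifford_conj y * x)"
      by (simp only: mult.assoc)
    then show ?thesis
      by (simp add: SpinD [OF x] SpinD [OF y])
  qed
  then have "?z = 1 \<or> ?z = - 1"
    using SpinD [OF z] by (intro twisted_central_unit(2) [of ?z 1]) simp_all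
  moreover have "x = y * ?z"
    by (simp add: mult.assoc [symmetric] SpinD [OF y])
  ultimately show "x = y \<or> x = - y"
    by (metis mult_1_right mult_minus_right)
qed auto

text \<open>
  The rotation covered by \<open>x\<close> is orthogonal, hence a product of \<open>k\<close> reflections.  The corresponding
  product \<open>y\<close> of unit vectors induces the same map up to the sign \<open>(-1)\<^sup>k\<close>, so \<open>y\<^sup>-\<^sup>1 x\<close> lies in the
  twisted centre.  Hence it is even, \<open>k\<close> is even, and the determinant is \<open>1\<close>.
\<close>

lemma rotation_spin_cover:
  assumes x: "x \<in> Spin"
  shows "rotation_matrix (spin_cover x)"
proof -
  define A where "A = spin_cover x"
  have "orthogonal_transformation ((*v) A)"
    using orthogonal_spin_cover [OF x] by (simp add: A_def orthogonal_transformation_matrix)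
  then obtain us where us: "\<forall>u\<in>set us. norm u = 1" "(*v) A = foldr reflect us"
    using orthogonal_transformation_product_of_reflections by blast
  define y where "y = prod_list (map cvec us)"
  \<comment> \<open>The parity of the product \<open>y\<close>, which is also the determinant of \<open>A\<close>.\<close>
  define e where "e = (- 1 :: real) ^ length us"
  have ee: "e * e = 1"
    by (simp add: e_def power_mult_distrib [symmetric])
  have y: "y * clifford_conj y = 1" "clifford_conj y * y = 1"
    using cvec_prod_unit [OF us(1)] clifford_inverse_commutes by (auto simp: y_def)
  have gy: "grade_involution y = e *\<^sub>R y"
    by (simp add: y_def e_def grade_involution_cvec_prod)
  let ?z = "clifford_conj y * x"
  have "clifford_conj (clifford_conj y) = y"
  proof -
    have "clifford_conj (clifford_conj y) * clifford_conj y = 1"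
      using y clifford_conj_mult [of y "clifford_conj y"] by simp
    then have "clifford_conj (clifford_conj y) * (clifford_conj y * y) = y"
      by (simp add: mult.assoc [symmetric])
    then show ?thesis by (simp add: y)
  qed
  then have "?z * clifford_conj ?z = clifford_conj y * (x * clifford_conj x) * y"
    by (simp only: clifford_conj_mult mult.assoc)
  then have z1: "?z * clifford_conj ?z = 1"
    by (simp add: SpinD [OF x] y)
  have z2: "grade_involution ?z = e *\<^sub>R ?z"
    by (simp add: grade_involution_simps(3) SpinD [OF x] clifford_conj_grade_involution [symmetric] gy
        linear_scale [OF linear_clifford_conj])
  have z3: "?z * cvec v = e *\<^sub>R (cvec v * ?z)" for v
  proof -
    have "x * cvec v * clifford_conj x = cvec (foldr reflect us v)"
      using cvec_spin_cover [OF x, of v] us(2) by (metis A_def)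
    also have "\<dots> = e *\<^sub>R (y * cvec v * clifford_conj y)"
      unfolding y_def cvec_prod_sandwich [OF us(1)] using ee by (simp add: e_def)
    finally have "clifford_conj y * (x * cvec v * clifford_conj x) * x =
        clifford_conj y * (e *\<^sub>R (y * cvec v * clifford_conj y)) * x"
      by simp
    then have "clifford_conj y * x * cvec v * (clifford_conj x * x) =
        e *\<^sub>R ((clifford_conj y * y) * cvec v * (clifford_conj y * x))"
      by (simp only: mult.assoc mult_scaleR_left mult_scaleR_right)
    then show ?thesis
      by (simp add: SpinD [OF x] y)
  qed
  have "e = 1"
    using twisted_central_unit(1) [OF z1 ee z2 z3] .
  moreover have "det A = e"
    using det_foldr_reflect [OF us(1)] by (simp add: us(2) [symmetric] e_def)
  ultimately show ?thesis
    using orthogonal_spin_cover [OF x] by (simp add: rotation_matrix_def A_def)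
qed

text \<open>
  A rotation is a product of an even number of reflections.  The product of the corresponding unit
  vectors is even and lies in the spin group.
\<close>

lemma spin_cover_surj:
  assumes A: "rotation_matrix A"
  obtains x where "x \<in> Spin" "spin_cover x = A"
proof -
  have "orthogonal_transformation ((*v) A)"
    using A by (simp add: rotation_matrix_def orthogonal_transformation_matrix)
  then obtain us where us: "\<forall>u\<in>set us. norm u = 1" "(*v) A = foldr reflect us"
    using orthogonal_transformation_product_of_reflections by blast
  define y where "y = prod_list (map cvec us)"
  have "det A = (- 1) ^ length us"
    using det_foldr_reflect [OF us(1)] by (simp add: us(2) [symmetric])
  then have e: "(- 1 :: real) ^ length us = 1"
    using A by (simp add: rotation_matrix_def)
  have y: "y * cvec v * clifford_conj y = cvec (A *v v)" for v
    using cvec_prod_sandwich [OF us(1)] by (simp add: y_def e us(2))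
  moreover have "grade_involution y = y"
    by (simp add: y_def grade_involution_cvec_prod e)
  ultimately have "y \<in> Spin"
    using cvec_prod_unit [OF us(1)] by (auto simp: Spin_def y_def)
  moreover have "spin_cover y = A"
    using y by (rule spin_cover_eqI)
  ultimately show ?thesis
    using that by blast
qed

subsection \<open>Topology of the double cover\<close>

lemma clifford_conj_blade_sign: "clifford_conj (blade S) = blade_sign S S *\<^sub>R blade S"
proof -
  have "blade S * blade S = blade_sign S S *\<^sub>R 1"
    by (simp add: blade_mult one_clifford_def)
  then have "clifford_conj (blade S) * (blade S * blade S) = blade_sign S S *\<^sub>R clifford_conj (blade S)"
    by simp
  then have "blade S = blade_sign S S *\<^sub>R clifford_conj (blade S)"
    by (simp add: mult.assoc [symmetric] blade_conj)
  then have "blade_sign S S *\<^sub>R blade S = (blade_sign S S * blade_sign S S) *\<^sub>R clifford_conj (blade S)"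
    by (metis scaleR_scaleR)
  then show ?thesis
    by (simp add: blade_sign_sq)
qed

lemma linear_blade_coeff: "linear (\<lambda>x. blade_coeffs x $ S)"
  by (rule linearI) simp_all

text \<open>
  Blades are orthonormal and \<open>e\<^sub>S\<close> times the conjugate of \<open>e\<^sub>T\<close> is, up to sign, the blade of the symmetric
  difference; so it has a scalar part only for \<open>S = T\<close>.  Consequently elements of the spin group have
  norm \<open>1\<close>, and the spin group is compact.
\<close>

lemma scalar_part_mult_conj:
  fixes x y :: "'n::{finite,linorder} clifford"
  shows "blade_coeffs (x * clifford_conj y) $ {} = x \<bullet> y"
proof -
  have lin: "linear (\<lambda>x. blade_coeffs (x * a) $ {})" "linear (\<lambda>y. blade_coeffs (a * clifford_conj y) $ {})" for a :: "'n clifford"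
    using linear_compose [OF linear_mult_right [of a] linear_blade_coeff [of "{}"]]
      linear_compose [OF linear_clifford_conj linear_compose [OF linear_mult_left [of a] linear_blade_coeff [of "{}"]]]
    by (simp_all add: o_def)
  have inner: "linear (\<lambda>x. x \<bullet> a)" "linear (\<lambda>x. a \<bullet> x)" for a :: "'n clifford"
    by (auto intro!: linearI simp: inner_simps)
  have "blade_coeffs (blade S * clifford_conj (blade T)) $ {} = blade S \<bullet> blade T" for S T :: "'n set"
  proof -
    have "blade S \<bullet> blade T = (if S = T then 1 else 0)"
      by (simp add: inner_clifford_def blade_def inner_axis_axis)
    moreover have "S \<noteq> T \<Longrightarrow> sym_diff S T \<noteq> {}"
      by blast
    ultimately show ?thesis
      by (cases "S = T") (auto simp: clifford_conj_blade_sign blade_mult blade_sign_sq linear_scale [OF linear_blade_coeff])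
  qed
  then have "blade_coeffs (blade S * clifford_conj y) $ {} = blade S \<bullet> y" for S :: "'n set"
    by (rule blade_linear_induct [OF lin(2) [of "blade S"] inner(2) [of "blade S"]])
  then show ?thesis
    by (rule blade_linear_induct [OF lin(1) [of "clifford_conj y"] inner(1) [of y]])
qed

lemma norm_Spin: "x \<in> Spin \<Longrightarrow> norm x = 1"
  using scalar_part_mult_conj [of x x] by (simp add: SpinD(2) norm_eq_sqrt_inner one_clifford_def)

lemma bounded_bilinear_clifford: "bounded_bilinear ((*) :: 'n::{finite,linorder} clifford \<Rightarrow> _)"
  unfolding bilinear_conv_bounded_bilinear [symmetric] bilinear_def
  by (simp add: linear_mult_left linear_mult_right)

lemma continuous_on_clifford_mult [continuous_intros]:
  fixes f g :: "'a::topological_space \<Rightarrow> 'n::{finite,linorder} clifford"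
  shows "continuous_on S f \<Longrightarrow> continuous_on S g \<Longrightarrow> continuous_on S (\<lambda>x. f x * g x)"
  by (rule bounded_bilinear.continuous_on [OF bounded_bilinear_clifford])

lemma continuous_on_linear_compose:
  fixes f :: "'b::euclidean_space \<Rightarrow> 'c::real_normed_vector"
  assumes "linear f" "continuous_on S g"
  shows "continuous_on S (\<lambda>x. f (g x))"
  using continuous_on_compose2 [OF linear_continuous_on [of f UNIV] assms(2)] assms(1)
  by (simp add: linear_conv_bounded_linear)

lemma continuous_on_clifford_conj [continuous_intros]:
  "continuous_on S f \<Longrightarrow> continuous_on S (\<lambda>x. clifford_conj (f x))"
  by (rule continuous_on_linear_compose [OF linear_clifford_conj])

lemma continuous_on_grade_involution [continuous_intros]:
  "continuous_on S f \<Longrightarrow> continuous_on S (\<lambda>x. grade_involution (f x))"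
  by (rule continuous_on_linear_compose [OF linear_grade_involution])

lemma compact_Spin: "compact (Spin :: 'n::{finite,linorder} clifford set)"
proof -
  have range: "closed (range (cvec :: _ \<Rightarrow> 'n clifford))"
    by (intro closed_subspace linear_subspace_image linear_cvec subspace_UNIV)
  have "(Spin :: 'n clifford set) = {x. grade_involution x = x} \<inter> {x. x * clifford_conj x = 1} \<inter>
      (\<Inter>v. (\<lambda>x. x * cvec v * clifford_conj x) -` range cvec)"
    by (auto simp: Spin_def)
  moreover have "closed ((\<lambda>x :: 'n clifford. x * cvec v * clifford_conj x) -` range cvec)" for v
    by (intro closed_vimage range continuous_intros)
  then have "closed ({x :: 'n clifford. grade_involution x = x} \<inter> {x. x * clifford_conj x = 1} \<inter>
      (\<Inter>v. (\<lambda>x. x * cvec v * clifford_conj x) -` range cvec))"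
    by (intro closed_Int closed_Collect_eq continuous_intros closed_INT) blast
  ultimately have "closed (Spin :: 'n clifford set)"
    by metis
  moreover have "bounded (Spin :: 'n clifford set)"
    by (rule boundedI [of _ 1]) (simp add: norm_Spin)
  ultimately show ?thesis
    by (simp add: compact_eq_bounded_closed)
qed

lemma blade_coeffs_cvec: "blade_coeffs (cvec v) $ {i} = v $ i"
  by (simp add: cvec_def gen_def if_distrib sum.delta sum.delta' cong: if_cong)

lemma spin_cover_entry:
  assumes "x \<in> Spin"
  shows "spin_cover x $ i $ j = blade_coeffs (x * gen j * clifford_conj x) $ {i}"
proof -
  have "cvec (spin_cover x *v axis j 1) = x * gen j * clifford_conj x"
    by (simp add: cvec_spin_cover [OF assms] cvec_axis)
  then have "blade_coeffs (x * gen j * clifford_conj x) $ {i} = (spin_cover x *v axis j 1) $ i"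
    by (metis blade_coeffs_cvec)
  then show ?thesis
    by (simp add: matrix_vector_mult_basis column_def)
qed

lemma continuous_on_spin_cover: "continuous_on (Spin :: 'n::{finite,linorder} clifford set) spin_cover"
proof -
  have "continuous_on (Spin :: 'n clifford set) (\<lambda>x. \<chi> i j. blade_coeffs (x * gen j * clifford_conj x) $ {i})"
    by (intro continuous_on_vec_lambda continuous_on_linear_compose [OF linear_blade_coeff] continuous_intros)
  then show ?thesis
    by (rule continuous_on_eq) (simp add: vec_eq_iff spin_cover_entry)
qed

lemma carrier_SO_group [simp]: "A \<in> carrier SO_group \<longleftrightarrow> rotation_matrix A"
  by (simp add: SO_group_def)

text \<open>
  The image of \<open>U\<close> is also the image of the saturated set \<open>U \<union> -U\<close>, whose complement is compact and has a
  compact, hence closed, image.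
\<close>

lemma openin_spin_cover_image:
  assumes "openin (top_of_set Spin) U"
  shows "openin (top_of_set (carrier SO_group)) (spin_cover ` U)"
proof -
  have US: "U \<subseteq> Spin"
    using openin_imp_subset [OF assms] .
  have "openin (top_of_set Spin) (Spin \<inter> uminus -` U)"
    by (rule continuous_openin_preimage [OF _ _ assms]) (auto intro!: continuous_intros)
  with assms have "openin (top_of_set Spin) (U \<union> (Spin \<inter> uminus -` U))"
    by (rule openin_Un)
  then have "closedin (top_of_set Spin) (Spin - (U \<union> (Spin \<inter> uminus -` U)))"
    by (simp add: closedin_diff)
  then have "compact (Spin - (U \<union> (Spin \<inter> uminus -` U)))"
    by (rule closedin_compact [OF compact_Spin])
  then have "compact (spin_cover ` (Spin - (U \<union> (Spin \<inter> uminus -` U))))"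
    by (intro compact_continuous_image continuous_on_subset [OF continuous_on_spin_cover]) auto
  then have "closed (spin_cover ` (Spin - (U \<union> (Spin \<inter> uminus -` U))))"
    by (rule compact_imp_closed)
  moreover have "spin_cover ` U = carrier SO_group - spin_cover ` (Spin - (U \<union> (Spin \<inter> uminus -` U)))"
  proof (intro equalityI subsetI)
    fix A assume "A \<in> spin_cover ` U"
    then obtain x where x: "x \<in> U" "A = spin_cover x" by blast
    have "A \<noteq> spin_cover y" if "y \<in> Spin - (U \<union> (Spin \<inter> uminus -` U))" for y
      using that x US spin_cover_eq_iff [of x y] by auto
    then show "A \<in> carrier SO_group - spin_cover ` (Spin - (U \<union> (Spin \<inter> uminus -` U)))"
      using x US by (auto simp: rotation_spin_cover)
  next
    fix A assume A: "A \<in> carrier SO_group - spin_cover ` (Spin - (U \<union> (Spin \<inter> uminus -` U)))"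
    then obtain x where x: "x \<in> Spin" "A = spin_cover x"
      by (auto elim: spin_cover_surj)
    with A have "x \<in> U \<or> - x \<in> U"
      by auto
    then show "A \<in> spin_cover ` U"
      using x by (metis imageI spin_cover_minus)
  qed
  ultimately show ?thesis
    by (simp only: Diff_eq) (blast intro: openin_open_Int open_Compl)
qed

text \<open>
  As \<open>y\<close> and \<open>-y\<close> are at distance \<open>2\<close> for \<open>y\<close> of norm \<open>1\<close>, they cannot both lie in a ball of radius \<open>1\<close>.
\<close>

lemma spin_cover_evenly_covered:
  assumes x: "x \<in> Spin"
  obtains V where "openin (top_of_set Spin) V" "x \<in> V" "V \<inter> uminus ` V = {}"
proof
  show "openin (top_of_set Spin) (Spin \<inter> ball x 1)"
    by (simp add: openin_open_Int)
  show "x \<in> Spin \<inter> ball x 1"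
    using x by simp
  show "Spin \<inter> ball x 1 \<inter> uminus ` (Spin \<inter> ball x 1) = {}"
  proof -
    have False if "y \<in> Spin" "dist x y < 1" "dist x (- y) < 1" for y
    proof -
      have "dist y (- y) < 2"
        using dist_triangle3 [of y "- y" x] that by linarith
      moreover have "dist y (- y) = norm (2 *\<^sub>R y)"
        by (simp add: dist_norm scaleR_2)
      ultimately show False
        using norm_Spin [OF that(1)] by simp
    qed
    then show ?thesis by force
  qed
qed

subsection \<open>The automorphism of the Clifford algebra induced by an orthogonal matrix\<close>

text \<open>
  The automorphism determined by the universal property: orthonormal vectors satisfy the same relations as
  the generators.
\<close>

definition clifford_map :: "real ^ 'n::_ ^ 'n::_ \<Rightarrow> 'n::{finite,linorder} clifford \<Rightarrow> 'n clifford" where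
  "clifford_map A = clifford_lift (\<lambda>i. cvec (A *v axis i 1))"

context
  fixes A :: "real ^ 'n::_ ^ 'n::{finite,linorder}"
  assumes A: "orthogonal_matrix A"
begin

lemma orthogonal_inner: "(A *v v) \<bullet> (A *v w) = v \<bullet> w"
  using A orthogonal_transformation_matrix [of "(*v) A"] by (simp add: orthogonal_transformation_def)

lemma clifford_map_mult: "clifford_map A (x * y) = clifford_map A x * clifford_map A y"
  unfolding clifford_map_def
proof (rule clifford_lift_mult)
  fix i j :: 'n
  show "cvec (A *v axis i 1) * cvec (A *v axis i 1) = - 1"
    by (simp add: cvec_sq orthogonal_inner inner_axis_axis)
  assume "i \<noteq> j"
  then show "cvec (A *v axis i 1) * cvec (A *v axis j 1) = - (cvec (A *v axis j 1) * cvec (A *v axis i 1))"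
    using cvec_anticommutator [of "A *v axis i 1" "A *v axis j 1"]
    by (simp add: orthogonal_inner inner_axis_axis add_eq_0_iff2)
qed

lemma linear_clifford_map: "linear (clifford_map A)"
  unfolding clifford_map_def by (rule linear_clifford_lift)

lemma clifford_map_one: "clifford_map A 1 = 1"
  by (simp add: clifford_map_def)

lemma clifford_map_cvec: "clifford_map A (cvec v) = cvec (A *v v)"
proof -
  have "clifford_map A (cvec v) = (\<Sum>i\<in>UNIV. v $ i *\<^sub>R cvec (A *v axis i 1))"
    by (simp add: cvec_def [of v] linear_sum [OF linear_clifford_map] linear_scale [OF linear_clifford_map])
      (simp add: clifford_map_def)
  also have "\<dots> = cvec (A *v (\<Sum>i\<in>UNIV. v $ i *\<^sub>R axis i 1))"
    by (simp add: linear_sum [OF linear_cvec] linear_scale [OF linear_cvec]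
      linear_sum [OF matrix_vector_mul_linear] matrix_vector_mult_scaleR)
  also have "(\<Sum>i\<in>UNIV. v $ i *\<^sub>R axis i 1) = v"
    using basis_expansion [of v] by (simp add: scalar_mult_eq_scaleR)
  finally show ?thesis .
qed

lemma clifford_map_blade:
  "clifford_map A (blade S) = prod_list (map cvec (map (\<lambda>i. A *v axis i 1) (sorted_list_of_set S)))"
  by (simp add: clifford_map_def ordered_prod_def o_def)

lemma clifford_map_grade_involution: "clifford_map A (grade_involution x) = grade_involution (clifford_map A x)"
proof (rule blade_linear_induct [of "\<lambda>x. clifford_map A (grade_involution x)" "\<lambda>x. grade_involution (clifford_map A x)"])
  show "linear (\<lambda>x. clifford_map A (grade_involution x))" "linear (\<lambda>x. grade_involution (clifford_map A x))"
    using linear_compose [OF linear_clifford_map linear_grade_involution]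
      linear_compose [OF linear_grade_involution linear_clifford_map] by (simp_all add: o_def)
  fix S
  have "grade_involution (clifford_map A (blade S)) = (- 1) ^ card S *\<^sub>R clifford_map A (blade S)"
    unfolding clifford_map_blade grade_involution_cvec_prod by simp
  then show "clifford_map A (grade_involution (blade S)) = grade_involution (clifford_map A (blade S))"
    unfolding grade_involution_blade
    by (cases "even (card S)") (simp_all add: linear_neg [OF linear_clifford_map])
qed

text \<open>
  On blades both sides are inverse to the image of the blade, which is a product of unit vectors.
\<close>

lemma clifford_map_conj: "clifford_map A (clifford_conj x) = clifford_conj (clifford_map A x)"
proof (rule blade_linear_induct [of "\<lambda>x. clifford_map A (clifford_conj x)" "\<lambda>x. clifford_conj (clifford_map A x)"])
  show "linear (\<lambda>x. clifford_map A (clifford_conj x))" "linear (\<lambda>x. clifford_conj (clifford_map A x))"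
    using linear_compose [OF linear_clifford_map linear_clifford_conj]
      linear_compose [OF linear_clifford_conj linear_clifford_map] by (simp_all add: o_def)
  fix S
  let ?y = "clifford_map A (blade S)"
  have n: "norm (A *v axis i 1) = 1" for i
    using orthogonal_inner [of "axis i 1" "axis i 1"] by (simp add: norm_eq_1 inner_axis_axis)
  then have y: "?y * clifford_conj ?y = 1"
    unfolding clifford_map_blade by (intro cvec_prod_unit) auto
  have "clifford_map A (clifford_conj (blade S)) * ?y = 1"
    by (simp only: clifford_map_mult [symmetric] blade_conj clifford_map_one)
  then have "clifford_map A (clifford_conj (blade S)) * (?y * clifford_conj ?y) = clifford_conj ?y"
    by (simp only: mult.assoc [symmetric] mult_1_left)
  then show "clifford_map A (clifford_conj (blade S)) = clifford_conj (clifford_map A (blade S))"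
    by (simp only: y mult_1_right)
qed

end

lemma clifford_map_transpose:
  fixes A :: "real ^ 'n::_ ^ 'n::{finite,linorder}"
  assumes A: "orthogonal_matrix A"
  shows "clifford_map (transpose A) (clifford_map A x) = x"
proof -
  have A': "orthogonal_matrix (transpose A)"
    using A by simp
  have h: "clifford_map (transpose A) (prod_list xs) = prod_list (map (clifford_map (transpose A)) xs)" for xs :: "'n clifford list"
    by (induction xs) (simp_all add: clifford_map_mult [OF A'] clifford_map_one [OF A'])
  have "transpose A *v (A *v v) = v" for v
    using A by (simp add: matrix_vector_mul_assoc orthogonal_matrix_def del: matrix_transpose_mul)
  then have bl: "clifford_map (transpose A) (clifford_map A (blade S)) = blade S" for S
    unfolding clifford_map_blade [OF A]
    by (simp only: h map_map o_def clifford_map_cvec [OF A'] cvec_axis) (simp add: blade_eq_ordered_prod ordered_prod_def)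
  have lin: "linear (\<lambda>x. clifford_map (transpose A) (clifford_map A x))"
    using linear_compose [OF linear_clifford_map [OF A] linear_clifford_map [OF A']] by (simp add: o_def)
  show ?thesis
    by (rule blade_linear_induct [of "\<lambda>x. clifford_map (transpose A) (clifford_map A x)" "\<lambda>x. x", OF lin _ bl])
      (simp add: linear_id [unfolded id_def])
qed

lemma clifford_map_sandwich:
  fixes A :: "real ^ 'n::_ ^ 'n::{finite,linorder}"
  assumes A: "orthogonal_matrix A" and x: "x \<in> Spin"
  shows "clifford_map A x * cvec v * clifford_conj (clifford_map A x) =
    cvec ((A ** spin_cover x ** transpose A) *v v)"
proof -
  have "A *v (transpose A *v v) = v"
    using A by (simp only: matrix_vector_mul_assoc orthogonal_matrix_def) simp
  then have "cvec v = clifford_map A (cvec (transpose A *v v))"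
    by (simp only: clifford_map_cvec [OF A])
  then have "clifford_map A x * cvec v * clifford_conj (clifford_map A x) =
      clifford_map A (x * cvec (transpose A *v v) * clifford_conj x)"
    by (simp only: clifford_map_conj [OF A] clifford_map_mult [OF A])
  then show ?thesis
    by (simp only: cvec_spin_cover [OF x, symmetric] clifford_map_cvec [OF A] matrix_vector_mul_assoc matrix_mul_assoc)
qed

lemma clifford_map_Spin:
  assumes A: "orthogonal_matrix A" and x: "x \<in> Spin"
  shows "clifford_map A x \<in> Spin"
  unfolding Spin_def mem_Collect_eq
proof (intro conjI allI)
  show "grade_involution (clifford_map A x) = clifford_map A x"
    by (simp only: clifford_map_grade_involution [OF A, symmetric] SpinD(1) [OF x])
  show "clifford_map A x * clifford_conj (clifford_map A x) = 1"
    by (simp only: clifford_map_conj [OF A, symmetric] clifford_map_mult [OF A, symmetric] SpinD(2) [OF x]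
        clifford_map_one [OF A])
qed (simp add: clifford_map_sandwich [OF A x])

lemma spin_cover_clifford_map:
  assumes A: "orthogonal_matrix A" and x: "x \<in> Spin"
  shows "spin_cover (clifford_map A x) = A ** spin_cover x ** transpose A"
  by (rule spin_cover_eqI) (rule clifford_map_sandwich [OF A x])

section \<open>Polar decomposition and orthogonal conjugacy\<close>

text \<open>
  For a positive form bounded by \<open>a\<close>, polarisation bounds the bilinear form by \<open>a\<close> on pairs of vectors of
  equal length; the bound is applied to \<open>x\<close> and the rescaled image of \<open>x\<close>.
\<close>

lemma symmetric_norm_bound:
  fixes A :: "'a::real_inner \<Rightarrow> 'a"
  assumes lin: "linear A" and sym: "\<And>x y. A x \<bullet> y = x \<bullet> A y"
    and lower: "\<And>x. 0 \<le> A x \<bullet> x" and upper: "\<And>x. A x \<bullet> x \<le> a * (x \<bullet> x)" and a: "0 \<le> a"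
  shows "norm (A x) \<le> a * norm x"
proof (cases "A x = 0 \<or> x = 0")
  case True
  then show ?thesis
    using a linear_0 [OF lin] by auto
next
  case False
  define y where "y = (norm x / norm (A x)) *\<^sub>R A x"
  have ny: "y \<bullet> y = x \<bullet> x"
    using False by (simp add: y_def power2_norm_eq_inner [symmetric] power2_eq_square)
  have "4 * (A x \<bullet> y) = A (x + y) \<bullet> (x + y) - A (x - y) \<bullet> (x - y)"
    using sym [of x y] by (simp add: linear_add [OF lin] linear_diff [OF lin] inner_simps inner_commute)
  also have "\<dots> \<le> a * ((x + y) \<bullet> (x + y)) + a * ((x - y) \<bullet> (x - y))"
    using upper [of "x + y"] lower [of "x - y"] a by (smt (verit) inner_ge_zero mult_nonneg_nonneg)
  also have "\<dots> = a * (4 * (x \<bullet> x))"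
    by (simp add: ny inner_simps inner_commute algebra_simps)
  finally have "A x \<bullet> y \<le> a * (x \<bullet> x)"
    by simp
  moreover have "A x \<bullet> y = norm (A x) * norm x"
    using False by (simp add: y_def power2_norm_eq_inner [symmetric] power2_eq_square)
  ultimately have "norm (A x) * norm x \<le> (a * norm x) * norm x"
    by (simp add: power2_norm_eq_inner [symmetric] power2_eq_square)
  then show ?thesis
    using False by simp
qed

text \<open>
  The equation says that \<open>1 - B\<close> is a square root of \<open>1 - A\<close>.  It is solved as a fixed point of the
  contraction \<open>B \<mapsto> (A + B\<^sup>2) / 2\<close>, which preserves the closed set of symmetric operators of norm at most \<open>r\<close>
  that commute with \<open>\<C>\<close>.  So the fixed point inherits these properties.
\<close>

lemma contraction_root:
  fixes A :: "'a::euclidean_space \<Rightarrow> 'a" and \<C> :: "('a \<Rightarrow> 'a) set"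
  assumes lin: "linear A" and sym: "\<And>x y. A x \<bullet> y = x \<bullet> A y"
    and lower: "\<And>x. 0 \<le> A x \<bullet> x" and upper: "\<And>x. A x \<bullet> x \<le> a * (x \<bullet> x)" and a: "0 \<le> a" "a < 1"
    and \<C>: "\<And>C. C \<in> \<C> \<Longrightarrow> linear C" and comm: "\<And>C x. C \<in> \<C> \<Longrightarrow> C (A x) = A (C x)"
  obtains B where "linear B" "\<And>x y. B x \<bullet> y = x \<bullet> B y" "\<And>C x. C \<in> \<C> \<Longrightarrow> C (B x) = B (C x)"
    "\<And>x. 2 *\<^sub>R B x = A x + B (B x)"
proof -
  define A' where "A' = Blinfun A"
  have A' [simp]: "blinfun_apply A' = A"
    using lin by (simp add: A'_def bounded_linear_Blinfun_apply linear_conv_bounded_linear)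
  \<comment> \<open>The smaller root of \<open>r\<^sup>2 - 2 r + a = 0\<close>: exactly the radius that the contraction maps to itself.\<close>
  define r where "r = 1 - sqrt (1 - a)"
  have r: "0 \<le> r" "r < 1" "a + r * r = 2 * r"
    using a by (auto simp: r_def algebra_simps real_sqrt_le_1_iff)
  have nA: "norm A' \<le> a"
    using symmetric_norm_bound [OF lin sym lower upper a(1)] a(1) by (intro norm_blinfun_bound) simp_all
  define K where "K = {B :: 'a \<Rightarrow>\<^sub>L 'a. norm B \<le> r \<and> (\<forall>x y. blinfun_apply B x \<bullet> y = x \<bullet> blinfun_apply B y) \<and> (\<forall>C\<in>\<C>. \<forall>x. C (blinfun_apply B x) = blinfun_apply B (C x))}"
  define T where "T = (\<lambda>B. (1/2) *\<^sub>R (A' + (B o\<^sub>L B)))"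
  have T_apply: "blinfun_apply (T B) x = (1/2) *\<^sub>R (A x + blinfun_apply B (blinfun_apply B x))" for B x
    by (simp add: T_def blinfun.add_left blinfun.scaleR_left)
  have cont: "continuous_on UNIV C" if "C \<in> \<C>" for C
    using \<C> [OF that] by (simp add: linear_continuous_on linear_conv_bounded_linear)
  have "K = cball 0 r \<inter> (\<Inter>x. \<Inter>y. {B. blinfun_apply B x \<bullet> y = x \<bullet> blinfun_apply B y}) \<inter> (\<Inter>C\<in>\<C>. \<Inter>x. {B. C (blinfun_apply B x) = blinfun_apply B (C x)})"
    by (auto simp: K_def)
  moreover have "closed {B. blinfun_apply B x \<bullet> y = x \<bullet> blinfun_apply B y}" for x y :: 'a
    by (intro closed_Collect_eq continuous_intros)
  moreover have "closed {B. C (blinfun_apply B x) = blinfun_apply B (C x)}" if "C \<in> \<C>" for C x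
    by (intro closed_Collect_eq continuous_on_compose2 [OF cont [OF that]] continuous_intros) auto
  ultimately have "closed K"
    by (auto intro!: closed_Int closed_INT)
  then have "complete K"
    by (simp add: complete_eq_closed)
  moreover have "K \<noteq> {}"
  proof -
    have "C 0 = 0" if "C \<in> \<C>" for C
      using linear_0 [OF \<C> [OF that]] .
    then have "0 \<in> K"
      using r by (simp add: K_def)
    then show ?thesis by blast
  qed
  moreover have "T ` K \<subseteq> K"
  proof clarify
    fix B assume B: "B \<in> K"
    then have nB: "norm B \<le> r" and sB: "blinfun_apply B x \<bullet> y = x \<bullet> blinfun_apply B y" and cB: "C \<in> \<C> \<Longrightarrow> C (blinfun_apply B x) = blinfun_apply B (C x)" for x y C
      by (auto simp: K_def)
    have "norm (B o\<^sub>L B) \<le> norm B * norm B"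
      by (rule norm_blinfun_compose)
    also have "\<dots> \<le> r * r"
      using nB r by (intro mult_mono) auto
    finally have "norm (T B) \<le> (1/2) * (a + r * r)"
      unfolding T_def using nA norm_triangle_ineq [of A' "B o\<^sub>L B"] by simp
    then have "norm (T B) \<le> r"
      using r by simp
    moreover have "blinfun_apply (T B) x \<bullet> y = x \<bullet> blinfun_apply (T B) y" for x y
      by (simp add: T_apply inner_simps sym sB)
    moreover have "C (blinfun_apply (T B) x) = blinfun_apply (T B) (C x)" if "C \<in> \<C>" for C x
      by (simp add: T_apply linear_add [OF \<C> [OF that]] linear_scale [OF \<C> [OF that]] comm [OF that] cB [OF that])
    ultimately show "T B \<in> K"
      by (simp add: K_def)
  qed
  moreover have "dist (T B) (T B') \<le> r * dist B B'" if "B \<in> K" "B' \<in> K" for B B'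
  proof -
    have "T B - T B' = (1/2) *\<^sub>R ((B o\<^sub>L (B - B')) + ((B - B') o\<^sub>L B'))"
      by (rule blinfun_eqI) (simp add: T_apply blinfun.bilinear_simps algebra_simps)
    also have "norm \<dots> \<le> (1/2) * (norm (B o\<^sub>L (B - B')) + norm ((B - B') o\<^sub>L B'))"
      by (simp add: norm_triangle_ineq)
    also have "\<dots> \<le> (1/2) * (norm B * norm (B - B') + norm (B - B') * norm B')"
      by (intro mult_left_mono add_mono norm_blinfun_compose) simp
    also have "\<dots> \<le> (1/2) * (r * norm (B - B') + norm (B - B') * r)"
      using that by (intro mult_left_mono add_mono mult_right_mono mult_left_mono) (auto simp: K_def)
    finally show ?thesis
      by (simp add: dist_norm mult.commute)
  qed
  ultimately obtain B where B: "B \<in> K" "T B = B"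
    using Banach_fix [of K r T] r by blast
  have "2 *\<^sub>R blinfun_apply B x = A x + blinfun_apply B (blinfun_apply B x)" for x
  proof -
    have "2 *\<^sub>R blinfun_apply B x = 2 *\<^sub>R ((1/2) *\<^sub>R (A x + blinfun_apply B (blinfun_apply B x)))"
      using T_apply [of B x] B(2) by metis
    then show ?thesis by simp
  qed
  then show ?thesis
    using B(1) by (intro that [of "blinfun_apply B"]) (auto simp: K_def bounded_linear.linear [OF blinfun.bounded_linear_right])
qed

text \<open>
  The positive factor \<open>R\<close> of the polar decomposition is the square root of \<open>S = F\<^sup>T F\<close>.  Scaling by an upper
  bound \<open>M\<close> of \<open>S\<close> gives \<open>S = M (1 - A)\<close> with \<open>0 \<le> A < 1\<close>, so that \<open>contraction_root\<close> applies; the root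
  commutes with everything that commutes with \<open>S\<close>.
\<close>

theorem polar_factor:
  fixes F :: "real ^ 'n ^ 'n"
  assumes F: "invertible F"
  obtains R where "\<And>x. norm (R *v x) = norm (F *v x)"
    "\<And>g. transpose F ** F ** g = g ** (transpose F ** F) \<Longrightarrow> R ** g = g ** R"
proof -
  define S where "S = transpose F ** F"
  have S: "(S *v x) \<bullet> y = (F *v x) \<bullet> (F *v y)" for x y
    by (simp add: S_def matrix_vector_mul_assoc [symmetric] dot_lmul_matrix [symmetric])
  have inj: "inj ((*v) F)"
    using F by (metis invertible_left_inverse matrix_left_invertible_injective)
  obtain m where m: "m > 0" "\<And>x. m * norm x \<le> norm (F *v x)"
    using linear_inj_bounded_below_pos [OF matrix_vector_mul_linear inj] by blast
  obtain M' where M': "M' > 0" "\<And>x. norm (F *v x) \<le> M' * norm x"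
    using linear_bounded_pos [OF matrix_vector_mul_linear [of F]] by (auto simp: mult.commute)
  \<comment> \<open>The summand \<open>m\<^sup>2\<close> makes the bound strictly larger than the lower bound of \<open>S\<close>.\<close>
  define M where "M = M'\<^sup>2 + m\<^sup>2"
  have M: "M > 0" "m\<^sup>2 < M"
    using m(1) M'(1) by (simp_all add: M_def pos_add_strict)
  have upS: "(S *v x) \<bullet> x \<le> M * (x \<bullet> x)" for x
  proof -
    have "(norm (F *v x))\<^sup>2 \<le> (M' * norm x)\<^sup>2"
      using M'(2) by (intro power_mono) auto
    also have "\<dots> \<le> M * (norm x)\<^sup>2"
      unfolding M_def power_mult_distrib by (intro mult_right_mono) auto
    finally show ?thesis
      by (simp add: S power2_norm_eq_inner)
  qed
  have loS: "m\<^sup>2 * (x \<bullet> x) \<le> (S *v x) \<bullet> x" for x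
  proof -
    have "(m * norm x)\<^sup>2 \<le> (norm (F *v x))\<^sup>2"
      using m by (intro power_mono) auto
    then show ?thesis
      by (simp add: S power2_norm_eq_inner power_mult_distrib)
  qed
  define A where "A = (\<lambda>x. x - (S *v x) /\<^sub>R M)"
  have linA: "linear A"
    by (rule linearI) (simp_all add: A_def matrix_vector_right_distrib matrix_vector_mult_scaleR algebra_simps)
  have symA: "A x \<bullet> y = x \<bullet> A y" for x y
    using S [of x y] S [of y x] by (simp add: A_def inner_simps inner_commute)
  have loA: "0 \<le> A x \<bullet> x" for x
    using upS [of x] M by (simp add: A_def inner_simps field_simps)
  have upA: "A x \<bullet> x \<le> (1 - m\<^sup>2 / M) * (x \<bullet> x)" for x
    using loS [of x] M by (simp add: A_def inner_simps field_simps)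
  define \<C> where "\<C> = {C. \<exists>g. C = (*v) g \<and> S ** g = g ** S}"
  have commA: "C (A x) = A (C x)" if "C \<in> \<C>" for C x
  proof -
    from that obtain g where g: "C = (*v) g" "S ** g = g ** S"
      by (auto simp: \<C>_def)
    then have "S *v (g *v x) = g *v (S *v x)"
      by (simp only: matrix_vector_mul_assoc)
    then show ?thesis
      by (simp add: A_def g(1) matrix_vector_mult_diff_distrib matrix_vector_mult_scaleR)
  qed
  have a: "0 \<le> 1 - m\<^sup>2 / M" "1 - m\<^sup>2 / M < 1"
    using M m by (simp_all add: field_simps)
  have linC: "linear C" if "C \<in> \<C>" for C
    using that by (auto simp: \<C>_def)
  obtain B where B: "linear B" "\<And>x y. B x \<bullet> y = x \<bullet> B y" "\<And>C x. C \<in> \<C> \<Longrightarrow> C (B x) = B (C x)"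
    "\<And>x. 2 *\<^sub>R B x = A x + B (B x)"
    using contraction_root [OF linA symA loA upA a linC commA] by blast
  define N where "N = (\<lambda>x. sqrt M *\<^sub>R (x - B x))"
  have linN: "linear N"
    by (rule linearI) (simp_all add: N_def linear_add [OF B(1)] linear_scale [OF B(1)] algebra_simps)
  have N2: "N (N x) = S *v x" for x
  proof -
    have "N (N x) = sqrt M *\<^sub>R sqrt M *\<^sub>R (x - 2 *\<^sub>R B x + B (B x))"
      by (simp only: N_def linear_diff [OF B(1)] linear_scale [OF B(1)]) (simp add: algebra_simps scaleR_2)
    also have "\<dots> = M *\<^sub>R (x - 2 *\<^sub>R B x + B (B x))"
      using M(1) by simp
    also have "\<dots> = M *\<^sub>R (x - A x)"
      by (simp add: B(4))
    also have "\<dots> = S *v x"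
      using M(1) by (simp add: A_def)
    finally show ?thesis .
  qed
  have "(norm (N x))\<^sup>2 = (norm (F *v x))\<^sup>2" for x
  proof -
    have "N x \<bullet> N x = N (N x) \<bullet> x"
      unfolding N_def using B(2) by (simp add: linear_scale [OF B(1)] linear_diff [OF B(1)] inner_simps)
    then show ?thesis
      by (simp add: N2 S power2_norm_eq_inner)
  qed
  then have "norm (matrix N *v x) = norm (F *v x)" for x
    using matrix_vector_mul(2) [OF linN] by (metis norm_ge_zero power2_eq_imp_eq)
  moreover have "matrix N ** g = g ** matrix N" if "transpose F ** F ** g = g ** (transpose F ** F)" for g
  proof -
    have "(*v) g \<in> \<C>"
      using that by (auto simp: \<C>_def S_def)
    then have "g *v (N x) = N (g *v x)" for x
      using B(3) by (simp add: N_def matrix_vector_mult_diff_distrib matrix_vector_mult_scaleR)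
    then have "(matrix N ** g) *v x = (g ** matrix N) *v x" for x
      using matrix_vector_mul(2) [OF linN] by (metis matrix_vector_mul_assoc)
    then show ?thesis
      by (simp add: matrix_eq)
  qed
  ultimately show ?thesis
    using that by blast
qed

lemma matrix_inv_inverse:
  assumes "invertible A"
  shows "A ** matrix_inv A = mat 1" "matrix_inv A ** A = mat 1"
  using someI_ex [OF assms [unfolded invertible_def]] by (simp_all add: matrix_inv_def)

text \<open>
  If \<open>g\<close> and \<open>h = F g F\<^sup>-\<^sup>1\<close> are both orthogonal, transposing \<open>h F = F g\<close> shows that \<open>g\<close> commutes with
  \<open>F\<^sup>T F\<close>, hence with the positive factor \<open>R\<close> of \<open>F = U R\<close>.  So \<open>R\<close> cancels from the conjugation.
\<close>

theorem orthogonal_conjugator: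
  fixes F :: "real ^ 'n ^ 'n"
  assumes F: "invertible F" and G: "\<And>g. g \<in> G \<Longrightarrow> orthogonal_matrix g \<and> orthogonal_matrix (F ** g ** matrix_inv F)"
  obtains U where "orthogonal_matrix U" "\<And>g. g \<in> G \<Longrightarrow> F ** g ** matrix_inv F = U ** g ** transpose U"
proof -
  obtain R where R: "\<And>x. norm (R *v x) = norm (F *v x)"
    "\<And>g. transpose F ** F ** g = g ** (transpose F ** F) \<Longrightarrow> R ** g = g ** R"
    using polar_factor [OF F] by blast
  have Finv: "F ** matrix_inv F = mat 1" "matrix_inv F ** F = mat 1"
    using F by (simp_all add: matrix_inv_inverse)
  have "inj ((*v) F)"
    using F by (metis invertible_left_inverse matrix_left_invertible_injective)
  then have "x = 0" if "R *v x = 0" for x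
    using R(1) [of x] that by (metis injD matrix_vector_mult_0_right norm_eq_zero norm_zero)
  then have "inj ((*v) R)"
    by (simp add: linear_injective_0 [OF matrix_vector_mul_linear])
  then have invR: "invertible R"
    by (metis invertible_left_inverse matrix_left_invertible_injective)
  then have Rinv: "R ** matrix_inv R = mat 1" "matrix_inv R ** R = mat 1"
    by (simp_all add: matrix_inv_inverse)
  define U where "U = F ** matrix_inv R"
  have FU: "F = U ** R"
    by (simp add: U_def matrix_mul_assoc [symmetric] Rinv)
  have "norm (U *v x) = norm x" for x
    using R(1) [of "matrix_inv R *v x"] by (simp add: U_def matrix_vector_mul_assoc Rinv)
  then have "orthogonal_transformation ((*v) U)"
    by (simp add: orthogonal_transformation)
  then have U: "orthogonal_matrix U"
    by (simp add: orthogonal_transformation_matrix)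
  have "F ** g ** matrix_inv F = U ** g ** transpose U" if "g \<in> G" for g
  proof -
    define h where "h = F ** g ** matrix_inv F"
    have g: "transpose g ** g = mat 1" "g ** transpose g = mat 1" "transpose h ** h = mat 1"
      using G [OF that] by (auto simp: orthogonal_matrix_def h_def)
    have hF: "h ** F = F ** g"
      by (simp add: h_def matrix_mul_assoc [symmetric] Finv)
    then have "transpose F ** transpose h = transpose g ** transpose F"
      by (metis matrix_transpose_mul)
    then have "g ** (transpose F ** transpose h) ** h = g ** (transpose g ** transpose F) ** h"
      by simp
    then have "g ** transpose F ** (transpose h ** h) = (g ** transpose g) ** transpose F ** h"
      by (simp only: matrix_mul_assoc)
    then have gF: "g ** transpose F = transpose F ** h"
      by (simp add: g)
    have "transpose F ** F ** g = transpose F ** h ** F"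
      by (simp add: matrix_mul_assoc [symmetric] hF)
    also have "\<dots> = g ** (transpose F ** F)"
      by (simp add: gF [symmetric] matrix_mul_assoc)
    finally have comm: "R ** g = g ** R"
      by (rule R(2))
    have "transpose U ** F = R"
      using U by (simp add: FU matrix_mul_assoc orthogonal_matrix_def)
    then have "R ** matrix_inv F = transpose U"
      by (metis Finv(1) matrix_mul_assoc matrix_mul_rid)
    moreover have "F ** g ** matrix_inv F = U ** g ** (R ** matrix_inv F)"
      by (simp only: FU [THEN arg_cong, of "\<lambda>F. F ** g"] matrix_mul_assoc [symmetric]) (simp only: comm matrix_mul_assoc)
    ultimately show ?thesis by simp
  qed
  then show ?thesis
    using that U by blast
qed

section \<open>Bieberbach groups act freely and properly discontinuously\<close>

lemma norm_orthogonal_matrix_le: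
  fixes A :: "real ^ 'n ^ 'n"
  assumes "orthogonal_matrix A"
  shows "norm A \<le> CARD('n)"
proof -
  have "norm (A $ i) = 1" for i
    using assms unfolding orthogonal_matrix_orthonormal_rows by (simp add: row_def vec_nth_inverse)
  then show ?thesis
    using L2_set_le_sum [of UNIV "\<lambda>i. norm (A $ i)"] by (simp add: norm_vec_def)
qed

lemma bounded_bilinear_matrix_mult: "bounded_bilinear ((**) :: real ^ 'n ^ 'n \<Rightarrow> real ^ 'n ^ 'n \<Rightarrow> real ^ 'n ^ 'n)"
  unfolding bilinear_conv_bounded_bilinear [symmetric] bilinear_def
  by (auto intro!: linearI simp: matrix_matrix_mult_def vec_eq_iff sum.distrib distrib_left distrib_right
      sum_distrib_left mult_ac)

lemma motion_apply_isometry: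
  assumes "orthogonal_matrix (fst \<gamma>)"
  shows "dist (motion_apply \<gamma> x) (motion_apply \<gamma> y) = dist x y"
proof -
  have "orthogonal_transformation ((*v) (fst \<gamma>))"
    using assms by (simp add: orthogonal_transformation_matrix)
  then have "norm (fst \<gamma> *v (x - y)) = norm (x - y)"
    by (simp add: orthogonal_transformation)
  then show ?thesis
    by (simp add: motion_apply_def case_prod_beta dist_norm matrix_vector_mult_diff_distrib)
qed

locale bieberbach_group =
  fixes \<Gamma> :: "'n::finite motion set"
  assumes bieberbach: "bieberbach \<Gamma>"
begin

abbreviation "G \<equiv> (euclidean_group :: 'n motion monoid)\<lparr>carrier := \<Gamma>\<rparr>"

lemma subgroup: "subgroup \<Gamma> euclidean_group"
  using bieberbach by (simp add: bieberbach_def)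

lemma group_G: "group G"
  using group.subgroup_imp_group [OF group_euclidean_group subgroup] .

sublocale G: group G
  by (rule group_G)

lemma orthogonal: "\<gamma> \<in> \<Gamma> \<Longrightarrow> orthogonal_matrix (fst \<gamma>)"
  using subgroup.mem_carrier [OF subgroup, of \<gamma>] by (simp add: euclidean_group_def case_prod_beta)

lemma motion_apply_mult:
  "motion_apply (\<gamma> \<otimes>\<^bsub>euclidean_group\<^esub> \<delta>) x = motion_apply \<gamma> (motion_apply \<delta> x)"
  by (simp add: motion_apply_def euclidean_group_def case_prod_beta matrix_vector_right_distrib
      matrix_vector_mul_assoc add.assoc)

lemma motion_apply_one [simp]: "motion_apply \<one>\<^bsub>euclidean_group\<^esub> x = x"
  by (simp add: motion_apply_def euclidean_group_def)

lemma inv_eq: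
  assumes "(A, a) \<in> \<Gamma>"
  shows "(transpose A, - (transpose A *v a)) \<in> \<Gamma>"
proof -
  have A: "orthogonal_matrix A"
    using orthogonal [OF assms] by simp
  have c: "(A, a) \<in> carrier euclidean_group" "(transpose A, - (transpose A *v a)) \<in> carrier euclidean_group"
    using A by (simp_all add: euclidean_group_def)
  have "(transpose A, - (transpose A *v a)) \<otimes>\<^bsub>euclidean_group\<^esub> (A, a) = \<one>\<^bsub>euclidean_group\<^esub>"
    using A by (simp add: euclidean_group_def orthogonal_matrix_def)
  then have "inv\<^bsub>euclidean_group\<^esub> (A, a) = (transpose A, - (transpose A *v a))"
    using group.inv_equality [OF group_euclidean_group] c by blast
  then show ?thesis
    using subgroup.m_inv_closed [OF subgroup assms] by simp
qed

text \<open>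
  The identity is isolated, and by translation so is every element.  The translation by \<open>\<gamma>\<^sup>-\<^sup>1\<close> distorts
  distances by a factor that is bounded independently of \<open>\<gamma>\<close>, because orthogonal matrices are bounded.
\<close>

lemma uniform_discrete: "uniform_discrete \<Gamma>"
proof -
  have one: "(mat 1, 0) \<in> \<Gamma>"
    using subgroup.one_closed [OF subgroup] by (simp add: euclidean_group_def)
  have "(mat 1, 0) isolated_in \<Gamma>"
    using bieberbach one by (simp add: bieberbach_def discrete_def)
  then obtain e where e: "e > 0" "\<And>\<gamma>. \<gamma> \<in> \<Gamma> \<Longrightarrow> dist (mat 1, 0) \<gamma> < e \<Longrightarrow> \<gamma> = (mat 1, 0)"
    by (auto simp: isolated_in_dist_Ex_iff)
  have "bounded_bilinear ((**) :: real ^ 'n ^ 'n \<Rightarrow> real ^ 'n ^ 'n \<Rightarrow> real ^ 'n ^ 'n)"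
    by (rule bounded_bilinear_matrix_mult)
  then have "\<exists>K>0. \<forall>(A :: real ^ 'n ^ 'n) (B :: real ^ 'n ^ 'n). norm (A ** B) \<le> norm A * norm B * K"
    by (rule bounded_bilinear.pos_bounded)
  then obtain K where K: "K > 0" "\<And>(A :: real ^ 'n ^ 'n) (B :: real ^ 'n ^ 'n). norm (A ** B) \<le> norm A * norm B * K"
    by blast
  \<comment> \<open>A Lipschitz constant of left translations by motions: \<open>n K\<close> for the matrix part, \<open>1\<close> for the
    translation part.\<close>
  define L where "L = CARD('n) * K + 1"
  have L: "L > 0"
    using K by (simp add: L_def add_pos_pos)
  have "\<gamma> = \<delta>" if \<gamma>: "\<gamma> \<in> \<Gamma>" and \<delta>: "\<delta> \<in> \<Gamma>" and d: "dist \<gamma> \<delta> < e / L" for \<gamma> \<delta>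
  proof -
    obtain A a B b where eq: "\<gamma> = (A, a)" "\<delta> = (B, b)"
      by (metis surj_pair)
    have A: "orthogonal_matrix A"
      using orthogonal [OF \<gamma>] by (simp add: eq)
    then have AA: "transpose A ** A = mat 1" "A ** transpose A = mat 1"
      by (auto simp: orthogonal_matrix_def)
    have mem: "(transpose A ** B, transpose A *v (b - a)) \<in> \<Gamma>"
      using subgroup.m_closed [OF subgroup inv_eq \<delta>] \<gamma>
      by (simp add: eq euclidean_group_def matrix_vector_mult_diff_distrib)
    have "orthogonal_transformation ((*v) (transpose A))"
      using A by (simp add: orthogonal_transformation_matrix)
    then have n1: "norm (transpose A *v (b - a)) = norm (b - a)"
      by (simp add: orthogonal_transformation)
    have "transpose A ** (B - A) = transpose A ** B - mat 1"
      using bounded_bilinear.diff_right [OF bounded_bilinear_matrix_mult] AA by metis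
    then have "norm (transpose A ** B - mat 1) \<le> norm (transpose A) * norm (B - A) * K"
      using K(2) by metis
    also have "\<dots> \<le> CARD('n) * norm (B - A) * K"
      using norm_orthogonal_matrix_le [of "transpose A"] A K(1) by (intro mult_right_mono) auto
    finally have n2: "norm (transpose A ** B - mat 1) \<le> CARD('n) * K * norm (B - A)"
      by (simp add: mult_ac)
    have BA: "norm (B - A) \<le> dist \<gamma> \<delta>" "norm (b - a) \<le> dist \<gamma> \<delta>"
      using dist_fst_le [of \<gamma> \<delta>] dist_snd_le [of \<gamma> \<delta>] by (simp_all add: eq dist_norm norm_minus_commute)
    have "dist (mat 1, 0) (X, y) \<le> norm (X - mat 1) + norm y" for X :: "real ^ 'n ^ 'n" and y :: "real ^ 'n"
      using norm_Pair_le [of "X - mat 1" y] by (subst dist_commute) (simp add: dist_norm)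
    then have "dist (mat 1, 0) (transpose A ** B, transpose A *v (b - a)) \<le>
        norm (transpose A ** B - mat 1) + norm (transpose A *v (b - a))" .
    also have "\<dots> \<le> CARD('n) * K * dist \<gamma> \<delta> + dist \<gamma> \<delta>"
    proof (rule add_mono)
      show "norm (transpose A ** B - mat 1) \<le> CARD('n) * K * dist \<gamma> \<delta>"
        using K(1) by (intro order_trans [OF n2] mult_left_mono BA(1)) simp
      show "norm (transpose A *v (b - a)) \<le> dist \<gamma> \<delta>"
        using n1 BA(2) by linarith
    qed
    also have "\<dots> = L * dist \<gamma> \<delta>"
      by (simp add: L_def algebra_simps)
    also have "\<dots> < e"
      using d L by (simp add: field_simps)
    finally have eq1: "transpose A ** B = mat 1" "transpose A *v (b - a) = 0"
      using e(2) [OF mem] by auto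
    then have "A ** transpose A ** B = A" "norm (b - a) = 0"
      using n1 by (simp_all add: matrix_mul_assoc [symmetric])
    then show ?thesis
      by (simp add: AA eq)
  qed
  then show ?thesis
    using e(1) L unfolding uniform_discrete_def by (intro exI [of _ "e / L"]) auto
qed

text \<open>
  Motions that move \<open>x\<close> by a bounded amount form a bounded set.
\<close>

lemma finite_near: "finite {\<gamma> \<in> \<Gamma>. dist x (motion_apply \<gamma> x) \<le> r}"
proof -
  let ?S = "{\<gamma> \<in> \<Gamma>. dist x (motion_apply \<gamma> x) \<le> r}"
  have "norm \<gamma> \<le> CARD('n) + (r + 2 * norm x)" if \<gamma>: "\<gamma> \<in> ?S" for \<gamma>
  proof -
    obtain A a where eq: "\<gamma> = (A, a)"
      by (metis surj_pair)
    have A: "orthogonal_matrix A"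
      using orthogonal [of \<gamma>] \<gamma> by (simp add: eq)
    then have "orthogonal_transformation ((*v) A)"
      by (simp add: orthogonal_transformation_matrix)
    then have "norm (A *v x) = norm x"
      by (simp add: orthogonal_transformation)
    moreover have "norm (A *v x + a - x) \<le> r"
      using \<gamma> by (simp add: eq motion_apply_def dist_norm norm_minus_commute)
    moreover have "norm a \<le> norm (A *v x + a - x) + norm (A *v x) + norm x"
      using norm_triangle_ineq [of "(A *v x + a - x) - A *v x" x]
        norm_triangle_ineq4 [of "A *v x + a - x" "A *v x"] by simp
    ultimately have "norm a \<le> r + 2 * norm x"
      by simp
    then show ?thesis
      using norm_Pair_le [of A a] norm_orthogonal_matrix_le [OF A] by (simp add: eq)
  qed
  then have "bounded ?S"
    by (rule boundedI)
  moreover have "uniform_discrete ?S"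
    using uniform_discrete by (rule uniform_discrete_subset) auto
  ultimately show ?thesis
    using uniform_discrete_finite_iff by blast
qed

text \<open>
  The stabiliser of a point is finite by \<open>finite_near\<close>, so its elements have finite order.
\<close>

lemma free:
  assumes \<gamma>: "\<gamma> \<in> \<Gamma>" and fix_x: "motion_apply \<gamma> x = x"
  shows "\<gamma> = \<one>\<^bsub>euclidean_group\<^esub>"
proof -
  have pow: "\<gamma> [^]\<^bsub>G\<^esub> k \<in> \<Gamma>" for k :: nat
    using G.nat_pow_closed [of \<gamma>] \<gamma> by simp
  have pow_x: "motion_apply (\<gamma> [^]\<^bsub>G\<^esub> k) x = x" for k :: nat
    by (induction k) (simp_all add: motion_apply_mult fix_x)
  have "range (\<lambda>k::nat. \<gamma> [^]\<^bsub>G\<^esub> k) \<subseteq> {\<gamma> \<in> \<Gamma>. dist x (motion_apply \<gamma> x) \<le> 0}"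
    using pow pow_x by auto
  then have "finite (range (\<lambda>k::nat. \<gamma> [^]\<^bsub>G\<^esub> k))"
    using finite_near finite_subset by blast
  then have "\<not> inj (\<lambda>k::nat. \<gamma> [^]\<^bsub>G\<^esub> k)"
    using finite_imageD infinite_UNIV_nat by blast
  then obtain i j :: nat where ij: "i < j" "\<gamma> [^]\<^bsub>G\<^esub> i = \<gamma> [^]\<^bsub>G\<^esub> j"
    unfolding inj_def by (metis linorder_neqE_nat)
  have "\<gamma> [^]\<^bsub>G\<^esub> i \<otimes>\<^bsub>G\<^esub> \<gamma> [^]\<^bsub>G\<^esub> (j - i) = \<gamma> [^]\<^bsub>G\<^esub> (i + (j - i))"
    by (rule G.nat_pow_mult) (simp add: \<gamma>)
  also have "\<dots> = \<gamma> [^]\<^bsub>G\<^esub> i"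
    using ij by simp
  finally have "\<gamma> [^]\<^bsub>G\<^esub> (j - i) = \<one>\<^bsub>G\<^esub>"
    by (rule G.l_cancel_one [THEN iffD1, rotated 2]) (simp_all add: pow)
  moreover have "torsion_free G"
    using bieberbach by (simp add: bieberbach_def)
  note torsion = this [unfolded torsion_free_def, rule_format]
  ultimately have "\<gamma> = \<one>\<^bsub>G\<^esub>"
    by (intro torsion [of \<gamma> "j - i"]) (use \<gamma> ij(1) in simp_all)
  then show ?thesis
    by simp
qed

text \<open>
  Only finitely many group elements move \<open>x\<close> by at most \<open>1\<close>, and by freeness each of them, other than the
  identity, moves \<open>x\<close> by at least some \<open>d > 0\<close>.  A ball of radius \<open>d / 2\<close> is then disjoint from its
  translates.
\<close>

lemma properly_discontinuous:
  obtains e where "e > 0" "\<And>\<gamma> y. \<gamma> \<in> \<Gamma> \<Longrightarrow> y \<in> ball x e \<Longrightarrow> motion_apply \<gamma> y \<in> ball x e \<Longrightarrow> \<gamma> = \<one>\<^bsub>euclidean_group\<^esub>"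
proof -
  define S where "S = {\<gamma> \<in> \<Gamma>. dist x (motion_apply \<gamma> x) \<le> 1} - {\<one>\<^bsub>euclidean_group\<^esub>}"
  define d where "d = Min (insert 1 ((\<lambda>\<gamma>. dist x (motion_apply \<gamma> x)) ` S))"
  have fin: "finite S"
    unfolding S_def using finite_near by (rule finite_Diff)
  have "dist x (motion_apply \<gamma> x) > 0" if "\<gamma> \<in> S" for \<gamma>
    using that free [of \<gamma> x] by (auto simp: S_def)
  then have d: "d > 0" "d \<le> 1" "\<And>\<gamma>. \<gamma> \<in> S \<Longrightarrow> d \<le> dist x (motion_apply \<gamma> x)"
    using fin by (auto simp: d_def)
  have "\<gamma> = \<one>\<^bsub>euclidean_group\<^esub>"
    if "\<gamma> \<in> \<Gamma>" "y \<in> ball x (d / 2)" "motion_apply \<gamma> y \<in> ball x (d / 2)" for \<gamma> y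
  proof (rule ccontr)
    assume ne: "\<gamma> \<noteq> \<one>\<^bsub>euclidean_group\<^esub>"
    have "dist x (motion_apply \<gamma> x) \<le> dist x (motion_apply \<gamma> y) + dist (motion_apply \<gamma> y) (motion_apply \<gamma> x)"
      by (rule dist_triangle)
    also have "\<dots> = dist x (motion_apply \<gamma> y) + dist x y"
      using motion_apply_isometry [OF orthogonal [OF that(1)]] by (simp add: dist_commute)
    also have "\<dots> < d"
      using that(2,3) by simp
    finally have lt: "dist x (motion_apply \<gamma> x) < d" .
    then have "\<gamma> \<in> S"
      using ne that(1) d(2) by (simp add: S_def)
    then have "d \<le> dist x (motion_apply \<gamma> x)"
      by (rule d(3))
    with lt show False by simp
  qed
  then show ?thesis
    using that [of "d / 2"] d(1) by simp
qed

end

section \<open>Orbit spaces\<close>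

subsection \<open>Open maps and quotient maps\<close>

lemma open_map_prod:
  assumes f: "open_map X X' f" and g: "open_map Y Y' g"
  shows "open_map (prod_topology X Y) (prod_topology X' Y') (\<lambda>(x, y). (f x, g y))"
  unfolding open_map_def
proof (intro allI impI)
  fix W assume W: "openin (prod_topology X Y) W"
  show "openin (prod_topology X' Y') ((\<lambda>(x, y). (f x, g y)) ` W)"
    unfolding openin_prod_topology_alt
  proof (intro allI impI)
    fix a b assume "(a, b) \<in> (\<lambda>(x, y). (f x, g y)) ` W"
    then obtain x y where xy: "(x, y) \<in> W" "a = f x" "b = g y" by auto
    then obtain U V where UV: "openin X U" "openin Y V" "x \<in> U" "y \<in> V" "U \<times> V \<subseteq> W"
      using W unfolding openin_prod_topology_alt by meson
    have "openin X' (f ` U)" "openin Y' (g ` V)"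
      using f g UV by (auto simp: open_map_def)
    moreover have "f ` U \<times> g ` V \<subseteq> (\<lambda>(x, y). (f x, g y)) ` W"
      using UV(5) by force
    ultimately show "\<exists>U V. openin X' U \<and> openin Y' V \<and> a \<in> U \<and> b \<in> V \<and> U \<times> V \<subseteq> (\<lambda>(x, y). (f x, g y)) ` W"
      using xy UV(3,4) by blast
  qed
qed

lemma open_injective_homeomorphic_map:
  assumes "continuous_map X Y f" "open_map X Y f" "openin X W" "inj_on f W"
  shows "homeomorphic_map (subtopology X W) (subtopology Y (f ` W)) f"
proof (rule bijective_open_imp_homeomorphic_map)
  have W: "W \<subseteq> topspace X"
    using assms(3) by (rule openin_subset)
  show "continuous_map (subtopology X W) (subtopology Y (f ` W)) f"
    using assms(1) W by (auto simp: continuous_map_in_subtopology continuous_map_from_subtopology)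
  show "open_map (subtopology X W) (subtopology Y (f ` W)) f"
    using assms(2,3) by (intro open_map_into_subtopology open_map_from_subtopology) auto
  have "f ` W \<subseteq> topspace Y"
    using assms(1) W by (auto simp: continuous_map_def)
  then show "f ` topspace (subtopology X W) = topspace (subtopology Y (f ` W))"
    using W by (auto simp: topspace_subtopology)
  show "inj_on f (topspace (subtopology X W))"
    using assms(4) by (rule inj_on_subset) simp
qed

text \<open>
  The universal property of quotient maps: each of the two maps factors through the other.
\<close>

lemma quotient_maps_same_fibres:
  assumes f: "quotient_map T X f" and g: "quotient_map T Y g"
    and eq: "\<And>s t. s \<in> topspace T \<Longrightarrow> t \<in> topspace T \<Longrightarrow> f s = f t \<longleftrightarrow> g s = g t"
  shows "\<exists>h. homeomorphic_map X Y h \<and> (\<forall>t\<in>topspace T. h (f t) = g t)"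
proof -
  define h where "h = g \<circ> inv_into (topspace T) f"
  define k where "k = f \<circ> inv_into (topspace T) g"
  have surj: "f ` topspace T = topspace X" "g ` topspace T = topspace Y"
    using f g by (auto simp: quotient_map_def)
  have h: "h (f t) = g t" and k: "k (g t) = f t" if t: "t \<in> topspace T" for t
  proof -
    have "inv_into (topspace T) f (f t) \<in> topspace T" "f (inv_into (topspace T) f (f t)) = f t"
      "inv_into (topspace T) g (g t) \<in> topspace T" "g (inv_into (topspace T) g (g t)) = g t"
      using t by (auto intro: inv_into_into f_inv_into_f)
    then show "h (f t) = g t" "k (g t) = f t"
      using eq t by (auto simp: h_def k_def)
  qed
  have "continuous_map T Y (h \<circ> f)"
    using quotient_imp_continuous_map [OF g] by (rule continuous_map_eq) (simp add: h)
  then have ch: "continuous_map X Y h"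
    by (rule continuous_compose_quotient_map [OF f])
  have "continuous_map T X (k \<circ> g)"
    using quotient_imp_continuous_map [OF f] by (rule continuous_map_eq) (simp add: k)
  then have ck: "continuous_map Y X k"
    by (rule continuous_compose_quotient_map [OF g])
  have "homeomorphic_maps X Y h k"
    unfolding homeomorphic_maps_def using ch ck h k by (auto simp: surj [symmetric])
  then show ?thesis
    using h homeomorphic_maps_imp_map by blast
qed

text \<open>
  A subset of a sheet is the part of the sheet that lies over its image under \<open>\<Lambda>\<close>, so it is open if that
  image is open.
\<close>

lemma two_fold_covering_open_map_lift:
  assumes cov: "two_fold_covering P Q \<Lambda>" and c: "continuous_map T P f" and o: "open_map T Q (\<Lambda> \<circ> f)"
  shows "open_map T P f"
  unfolding open_map_def
proof (intro allI impI)
  fix W assume W: "openin T W"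
  have "\<exists>U. openin P U \<and> p \<in> U \<and> U \<subseteq> f ` W" if "p \<in> f ` W" for p
  proof -
    from that obtain t where t: "t \<in> W" "p = f t" by blast
    have "t \<in> topspace T"
      using W t openin_subset by blast
    then have p: "p \<in> topspace P"
      using c t(2) by (auto simp: continuous_map_def)
    obtain V V' where V: "openin P V" "p \<in> V" "inj_on \<Lambda> V"
      using two_fold_covering_sheets [OF cov p p refl] by metis
    define W' where "W' = W \<inter> {t \<in> topspace T. f t \<in> V}"
    have "openin T W'"
      unfolding W'_def using W openin_continuous_map_preimage [OF c V(1)] by (rule openin_Int)
    then have "openin Q ((\<Lambda> \<circ> f) ` W')"
      using o by (simp add: open_map_def)
    moreover have "continuous_map P Q \<Lambda>"
      using cov by (simp add: two_fold_covering_def)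
    ultimately have "openin P {p \<in> topspace P. \<Lambda> p \<in> (\<Lambda> \<circ> f) ` W'}"
      by (rule openin_continuous_map_preimage [rotated])
    then have "openin P (V \<inter> {p \<in> topspace P. \<Lambda> p \<in> (\<Lambda> \<circ> f) ` W'})"
      using V(1) by (rule openin_Int [rotated])
    moreover have "V \<inter> {p \<in> topspace P. \<Lambda> p \<in> (\<Lambda> \<circ> f) ` W'} \<subseteq> f ` W"
    proof (intro subsetI)
      fix p' assume "p' \<in> V \<inter> {p \<in> topspace P. \<Lambda> p \<in> (\<Lambda> \<circ> f) ` W'}"
      then have p': "p' \<in> V" "\<Lambda> p' \<in> (\<Lambda> \<circ> f) ` W'"
        by auto
      then obtain t' where t': "t' \<in> W'" "\<Lambda> p' = \<Lambda> (f t')" by auto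
      then have "p' = f t'"
        using inj_onD [OF V(3)] p'(1) by (auto simp: W'_def)
      then show "p' \<in> f ` W"
        using t'(1) by (auto simp: W'_def)
    qed
    moreover have "p \<in> V \<inter> {p \<in> topspace P. \<Lambda> p \<in> (\<Lambda> \<circ> f) ` W'}"
      using p V(2) t \<open>t \<in> topspace T\<close> by (auto simp: W'_def)
    ultimately show ?thesis
      by blast
  qed
  then show "openin P (f ` W)"
    using openin_subopen by blast
qed

subsection \<open>Actions that lift the action on Euclidean space\<close>

text \<open>
  The base \<open>\<real>\<^sup>n\<close>, the frames \<open>\<real>\<^sup>n \<times> SO(n)\<close> and the spin frames \<open>\<real>\<^sup>n \<times> Spin(n)\<close> are all spaces with an
  action of \<open>\<Gamma>\<close> and an equivariant map \<open>pr\<close> to Euclidean space.  Through \<open>pr\<close> they inherit freeness and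
  proper discontinuity, which give their orbit spaces the local structure of the space itself.
\<close>

locale lifted_action = bieberbach_group \<Gamma> for \<Gamma> :: "'n::finite motion set" +
  fixes T :: "'t topology" and \<phi> :: "'n motion \<Rightarrow> 't \<Rightarrow> 't" and pr :: "'t \<Rightarrow> real ^ 'n"
  assumes action_continuous: "\<gamma> \<in> \<Gamma> \<Longrightarrow> continuous_map T T (\<phi> \<gamma>)"
    and action_one: "t \<in> topspace T \<Longrightarrow> \<phi> \<one>\<^bsub>euclidean_group\<^esub> t = t"
    and action_mult: "\<gamma> \<in> \<Gamma> \<Longrightarrow> \<delta> \<in> \<Gamma> \<Longrightarrow> t \<in> topspace T \<Longrightarrow>
      \<phi> (\<gamma> \<otimes>\<^bsub>euclidean_group\<^esub> \<delta>) t = \<phi> \<gamma> (\<phi> \<delta> t)"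
    and pr_continuous: "continuous_map T euclidean pr"
    and pr_action: "\<gamma> \<in> \<Gamma> \<Longrightarrow> t \<in> topspace T \<Longrightarrow> pr (\<phi> \<gamma> t) = motion_apply \<gamma> (pr t)"
begin

definition "cls = orbit G \<phi>"

lemma cls_image: "cls t = (\<lambda>\<gamma>. \<phi> \<gamma> t) ` \<Gamma>"
  unfolding cls_def orbit_def by (simp add: Setcompr_eq_image del: split_paired_Ex)

lemma action_closed: "\<gamma> \<in> \<Gamma> \<Longrightarrow> t \<in> topspace T \<Longrightarrow> \<phi> \<gamma> t \<in> topspace T"
  using continuous_map_funspace [OF action_continuous] by blast

lemma inverse:
  assumes "\<gamma> \<in> \<Gamma>"
  obtains \<delta> where "\<delta> \<in> \<Gamma>" "\<delta> \<otimes>\<^bsub>euclidean_group\<^esub> \<gamma> = \<one>\<^bsub>euclidean_group\<^esub>" "\<gamma> \<otimes>\<^bsub>euclidean_group\<^esub> \<delta> = \<one>\<^bsub>euclidean_group\<^esub>"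
  using G.l_inv [of \<gamma>] G.r_inv [of \<gamma>] G.inv_closed [of \<gamma>] assms by simp

lemma cls_eq_iff:
  assumes t: "t \<in> topspace T" and t': "t' \<in> topspace T"
  shows "cls t = cls t' \<longleftrightarrow> (\<exists>\<gamma>\<in>\<Gamma>. t' = \<phi> \<gamma> t)"
proof
  assume eq: "cls t = cls t'"
  have "\<phi> \<one>\<^bsub>euclidean_group\<^esub> t' \<in> cls t'"
    unfolding cls_image using G.one_closed by (intro imageI) simp
  then have "t' \<in> cls t"
    by (simp add: action_one t' eq)
  then show "\<exists>\<gamma>\<in>\<Gamma>. t' = \<phi> \<gamma> t"
    unfolding cls_image by blast
next
  assume "\<exists>\<gamma>\<in>\<Gamma>. t' = \<phi> \<gamma> t"
  then obtain \<gamma> where \<gamma>: "\<gamma> \<in> \<Gamma>" "t' = \<phi> \<gamma> t" by blast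
  obtain \<delta> where \<delta>: "\<delta> \<in> \<Gamma>" "\<delta> \<otimes>\<^bsub>euclidean_group\<^esub> \<gamma> = \<one>\<^bsub>euclidean_group\<^esub>"
    using inverse [OF \<gamma>(1)] by blast
  have t_eq: "t = \<phi> \<delta> t'"
    using action_mult [OF \<delta>(1) \<gamma>(1) t] \<delta>(2) action_one [OF t] \<gamma>(2) by simp
  have sub: "cls (\<phi> \<beta> u) \<subseteq> cls u" if "\<beta> \<in> \<Gamma>" "u \<in> topspace T" for \<beta> u
  proof
    fix v assume "v \<in> cls (\<phi> \<beta> u)"
    then obtain \<alpha> where \<alpha>: "\<alpha> \<in> \<Gamma>" "v = \<phi> \<alpha> (\<phi> \<beta> u)"
      unfolding cls_image by blast
    have "\<alpha> \<otimes>\<^bsub>euclidean_group\<^esub> \<beta> \<in> \<Gamma>"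
      using G.m_closed [of \<alpha> \<beta>] \<alpha>(1) that(1) by simp
    then show "v \<in> cls u"
      unfolding cls_image \<alpha>(2) action_mult [OF \<alpha>(1) that, symmetric] by (rule imageI)
  qed
  show "cls t = cls t'"
    using sub [OF \<gamma>(1) t] sub [OF \<delta>(1) t'] \<gamma>(2) t_eq by (metis subset_antisym)
qed

lemma cls_action: "\<gamma> \<in> \<Gamma> \<Longrightarrow> t \<in> topspace T \<Longrightarrow> cls (\<phi> \<gamma> t) = cls t"
  using cls_eq_iff action_closed by blast

definition "quot = orbit_space G \<phi> T"

lemma topspace_quot: "topspace quot = cls ` topspace T"
  by (auto simp: quot_def topspace_orbit_space orbits_def cls_def)

lemma quotient_map_cls: "quotient_map T quot cls"
  unfolding quot_def cls_def by (rule quotient_map_orbit)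

lemma continuous_map_cls: "continuous_map T quot cls"
  by (rule quotient_imp_continuous_map [OF quotient_map_cls])

lemma open_map_cls: "open_map T quot cls"
  unfolding open_map_def
proof (intro allI impI)
  fix W assume W: "openin T W"
  then have WT: "W \<subseteq> topspace T"
    by (rule openin_subset)
  have "cls t \<in> cls ` W \<longleftrightarrow> (\<exists>\<gamma>\<in>\<Gamma>. \<phi> \<gamma> t \<in> W)" if "t \<in> topspace T" for t
    using cls_eq_iff [OF that] WT by blast
  then have "{t \<in> topspace T. cls t \<in> cls ` W} = (\<Union>\<gamma>\<in>\<Gamma>. {t \<in> topspace T. \<phi> \<gamma> t \<in> W})"
    by blast
  moreover have "openin T {t \<in> topspace T. \<phi> \<gamma> t \<in> W}" if "\<gamma> \<in> \<Gamma>" for \<gamma>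
    using action_continuous [OF that] W by (rule openin_continuous_map_preimage)
  ultimately have "openin T {t \<in> topspace T. cls t \<in> cls ` W}"
    by auto
  then show "openin quot (cls ` W)"
    using WT by (auto simp: quot_def openin_orbit_space orbits_def cls_def)
qed

lemma cls_eq_small:
  assumes disc: "\<And>\<gamma> y. \<gamma> \<in> \<Gamma> \<Longrightarrow> y \<in> U \<Longrightarrow> motion_apply \<gamma> y \<in> U \<Longrightarrow> \<gamma> = \<one>\<^bsub>euclidean_group\<^esub>"
    and t: "t \<in> topspace T" "t' \<in> topspace T" "pr t \<in> U" "pr t' \<in> U" and eq: "cls t = cls t'"
  shows "t = t'"
proof -
  obtain \<gamma> where \<gamma>: "\<gamma> \<in> \<Gamma>" "t' = \<phi> \<gamma> t"
    using eq cls_eq_iff t by blast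
  then have "\<gamma> = \<one>\<^bsub>euclidean_group\<^esub>"
    using disc [OF \<gamma>(1) t(3)] pr_action [OF \<gamma>(1) t(1)] t(4) by simp
  then show ?thesis
    using \<gamma> action_one t(1) by simp
qed

lemma cls_eq_same_base:
  assumes t: "t \<in> topspace T" "t' \<in> topspace T" "pr t = pr t'" and eq: "cls t = cls t'"
  shows "t = t'"
  by (rule cls_eq_small [of "{pr t}"]) (use t eq free in auto)

end

subsection \<open>The flat manifold and its frame bundle\<close>

locale oriented_bieberbach_group = bieberbach_group \<Gamma> for \<Gamma> :: "'n::{finite,linorder} motion set" +
  assumes oriented: "holonomy \<Gamma> \<subseteq> carrier SO_group"
begin

lemma rotation: "\<gamma> \<in> \<Gamma> \<Longrightarrow> rotation_matrix (fst \<gamma>)"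
  using oriented by (auto simp: holonomy_def)

lemma motion_continuous: "continuous_on UNIV (motion_apply \<gamma>)"
  unfolding motion_apply_def case_prod_beta by (intro continuous_intros linear_continuous_on)
    (simp add: linear_conv_bounded_linear [symmetric])

sublocale base: lifted_action \<Gamma> euclidean motion_apply "\<lambda>x. x"
  by unfold_locales (simp_all add: motion_continuous motion_apply_mult)

abbreviation frames :: "'n frame topology" where
  "frames \<equiv> prod_topology euclidean (top_of_set (carrier SO_group))"

lemma frames_eq: "frames = top_of_set (UNIV \<times> carrier SO_group)"
  using prod_topology_subtopology_eu [of UNIV "carrier SO_group"] by simp

lemma rotation_matrix_mult:
  fixes A B :: "real ^ 'm ^ 'm"
  shows "rotation_matrix A \<Longrightarrow> rotation_matrix B \<Longrightarrow> rotation_matrix (A ** B)"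
  by (simp add: rotation_matrix_def orthogonal_matrix_mul det_mul)

lemma fst_mult: "fst (\<gamma> \<otimes>\<^bsub>euclidean_group\<^esub> \<delta>) = fst \<gamma> ** fst \<delta>"
  by (simp add: euclidean_group_def case_prod_beta)

lemma fst_one: "fst \<one>\<^bsub>euclidean_group\<^esub> = mat 1"
  by (simp add: euclidean_group_def)

lemma motion_frame_eq: "motion_frame \<gamma> (x, B) = (motion_apply \<gamma> x, fst \<gamma> ** B)"
  by (simp add: motion_frame_def motion_apply_def case_prod_beta)

sublocale frame: lifted_action \<Gamma> frames motion_frame fst
proof unfold_locales
  fix \<gamma> assume \<gamma>: "\<gamma> \<in> \<Gamma>"
  have "continuous_on (UNIV \<times> carrier SO_group) (motion_frame \<gamma>)"
    unfolding motion_frame_def case_prod_beta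
    by (intro continuous_intros continuous_on_linear_compose [of "(*v) (fst \<gamma>)"]
        continuous_on_linear_compose [of "\<lambda>B. fst \<gamma> ** B"])
      (simp_all add: bounded_linear.linear [OF bounded_bilinear.bounded_linear_right [OF bounded_bilinear_matrix_mult]])
  moreover have "motion_frame \<gamma> \<in> UNIV \<times> carrier SO_group \<rightarrow> UNIV \<times> carrier SO_group"
    using rotation [OF \<gamma>] by (auto simp: motion_frame_eq rotation_matrix_mult)
  ultimately show "continuous_map frames frames (motion_frame \<gamma>)"
    unfolding frames_eq by (simp add: continuous_map_in_subtopology image_subset_iff_funcset)
next
  show "continuous_map frames euclidean fst"
    by (rule continuous_map_fst)
next
  fix \<gamma> \<delta> t
  show "motion_frame (\<gamma> \<otimes>\<^bsub>euclidean_group\<^esub> \<delta>) t = motion_frame \<gamma> (motion_frame \<delta> t)"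
    by (cases t) (simp add: motion_frame_eq motion_apply_mult fst_mult matrix_mul_assoc)
  show "fst (motion_frame \<gamma> t) = motion_apply \<gamma> (fst t)"
    by (cases t) (simp add: motion_frame_eq)
  show "motion_frame \<one>\<^bsub>euclidean_group\<^esub> t = t"
    by (cases t) (simp add: motion_frame_eq fst_one)
qed

end

section \<open>The spin structure associated with a lift of the holonomy\<close>

lemma spin_group_simps [simp]:
  "carrier spin_group = Spin" "x \<otimes>\<^bsub>spin_group\<^esub> y = x * y" "\<one>\<^bsub>spin_group\<^esub> = 1"
  by (simp_all add: spin_group_def)

context oriented_bieberbach_group
begin

lemma flat_manifold_eq: "flat_manifold \<Gamma> = base.quot"
  by (simp add: flat_manifold_def base.quot_def)

lemma total_space_frame_bundle: "total_space (frame_bundle \<Gamma>) = frame.quot"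
  by (simp add: frame_bundle_def frame.quot_def)

lemma projection_frame_cls: "projection (frame_bundle \<Gamma>) (frame.cls (x, B)) = base.cls x"
  by (simp add: frame_bundle_def frame.cls_image base.cls_image image_image motion_frame_eq)

lemma right_action_frame_cls: "right_action (frame_bundle \<Gamma>) (frame.cls (x, B)) C = frame.cls (x, B ** C)"
  by (simp add: frame_bundle_def frame.cls_image image_image motion_frame_eq matrix_mul_assoc)

lemma one_mem: "\<one>\<^bsub>euclidean_group\<^esub> \<in> \<Gamma>"
  using G.one_closed by simp

lemma mult_mem: "\<gamma> \<in> \<Gamma> \<Longrightarrow> \<delta> \<in> \<Gamma> \<Longrightarrow> \<gamma> \<otimes>\<^bsub>euclidean_group\<^esub> \<delta> \<in> \<Gamma>"
  using G.m_closed [of \<gamma> \<delta>] by simp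

end

locale spin_lift = oriented_bieberbach_group \<Gamma> for \<Gamma> :: "'n::{finite,linorder} motion set" +
  fixes \<epsilon> :: "'n motion \<Rightarrow> 'n clifford"
  assumes lift_Spin: "\<gamma> \<in> \<Gamma> \<Longrightarrow> \<epsilon> \<gamma> \<in> Spin"
    and lift_mult: "\<gamma> \<in> \<Gamma> \<Longrightarrow> \<delta> \<in> \<Gamma> \<Longrightarrow> \<epsilon> (\<gamma> \<otimes>\<^bsub>euclidean_group\<^esub> \<delta>) = \<epsilon> \<gamma> * \<epsilon> \<delta>"
    and lift_cover: "\<gamma> \<in> \<Gamma> \<Longrightarrow> spin_cover (\<epsilon> \<gamma>) = fst \<gamma>"
begin

lemma lift_one: "\<epsilon> \<one>\<^bsub>euclidean_group\<^esub> = 1"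
proof -
  let ?e = "\<epsilon> \<one>\<^bsub>euclidean_group\<^esub>"
  have "\<one>\<^bsub>euclidean_group\<^esub> \<otimes>\<^bsub>euclidean_group\<^esub> \<one>\<^bsub>euclidean_group\<^esub> = (\<one>\<^bsub>euclidean_group\<^esub> :: 'n motion)"
    by (simp add: euclidean_group_def)
  then have "?e * ?e = ?e"
    using lift_mult [OF one_mem one_mem] by simp
  then have "clifford_conj ?e * ?e * ?e = clifford_conj ?e * ?e"
    by (simp add: mult.assoc)
  then show ?thesis
    using SpinD(3) [OF lift_Spin [OF one_mem]] by simp
qed

abbreviation "spin_frames \<equiv> prod_topology (euclidean :: (real ^ 'n::_) topology) (top_of_set (Spin :: 'n clifford set))"

lemma spin_frames_eq: "spin_frames = top_of_set (UNIV \<times> Spin)"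
  using prod_topology_subtopology_eu [of UNIV "Spin :: 'n clifford set"] by simp

definition spin_motion :: "'n motion \<Rightarrow> (real ^ 'n::_) \<times> 'n clifford \<Rightarrow> (real ^ 'n::_) \<times> 'n clifford" where
  "spin_motion \<gamma> = (\<lambda>(x, u). (motion_apply \<gamma> x, \<epsilon> \<gamma> * u))"

lemma spin_motion_eq: "spin_motion \<gamma> (x, u) = (motion_apply \<gamma> x, \<epsilon> \<gamma> * u)"
  by (simp add: spin_motion_def)

sublocale spin: lifted_action \<Gamma> spin_frames spin_motion fst
proof unfold_locales
  fix \<gamma> assume \<gamma>: "\<gamma> \<in> \<Gamma>"
  have "continuous_on (UNIV \<times> Spin) (spin_motion \<gamma>)"
    unfolding spin_motion_def case_prod_beta
    by (intro continuous_intros continuous_on_compose2 [OF motion_continuous]) auto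
  moreover have "spin_motion \<gamma> \<in> UNIV \<times> Spin \<rightarrow> UNIV \<times> Spin"
    using lift_Spin [OF \<gamma>] by (auto simp: spin_motion_eq Spin_mult)
  ultimately show "continuous_map spin_frames spin_frames (spin_motion \<gamma>)"
    unfolding spin_frames_eq by (simp add: continuous_map_in_subtopology image_subset_iff_funcset)
  fix t
  show "fst (spin_motion \<gamma> t) = motion_apply \<gamma> (fst t)"
    by (cases t) (simp add: spin_motion_eq)
  fix \<delta> assume "\<delta> \<in> \<Gamma>"
  then show "spin_motion (\<gamma> \<otimes>\<^bsub>euclidean_group\<^esub> \<delta>) t = spin_motion \<gamma> (spin_motion \<delta> t)"
    using \<gamma> by (cases t) (simp add: spin_motion_eq motion_apply_mult lift_mult mult.assoc)
next
  show "spin_motion \<one>\<^bsub>euclidean_group\<^esub> t = t" for t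
    by (cases t) (simp add: spin_motion_eq lift_one)
  show "continuous_map spin_frames euclidean fst"
    by (rule continuous_map_fst)
qed

text \<open>
  The bundle \<open>(\<real>\<^sup>n \<times> Spin(n)) / \<Gamma>\<close>.  Projection, right action and covering are images of the corresponding
  maps of \<open>\<real>\<^sup>n \<times> Spin(n)\<close>, which commute with \<open>\<Gamma>\<close> and hence map orbits to orbits.
\<close>

definition associated_bundle :: "(((real ^ 'n::_) \<times> 'n clifford) set, (real ^ 'n::_) set, 'n clifford) bundle_data" where
  "associated_bundle = \<lparr>total_space = spin.quot, projection = (\<lambda>q. fst ` q),
    right_action = (\<lambda>q w. (\<lambda>(x, u). (x, u * w)) ` q)\<rparr>"

definition associated_covering :: "((real ^ 'n::_) \<times> 'n clifford) set \<Rightarrow> 'n frame set" where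
  "associated_covering = (\<lambda>q. (\<lambda>(x, u). (x, spin_cover u)) ` q)"

lemma projection_spin_cls: "projection associated_bundle (spin.cls (x, u)) = base.cls x"
  by (simp add: associated_bundle_def spin.cls_image base.cls_image image_image spin_motion_eq)

lemma right_action_spin_cls: "right_action associated_bundle (spin.cls (x, u)) w = spin.cls (x, u * w)"
  by (simp add: associated_bundle_def spin.cls_image image_image spin_motion_eq mult.assoc)

lemma associated_covering_cls:
  assumes "u \<in> Spin"
  shows "associated_covering (spin.cls (x, u)) = frame.cls (x, spin_cover u)"
  using assms by (auto simp: associated_covering_def spin.cls_image frame.cls_image image_image spin_motion_eq
      motion_frame_eq spin_cover_mult lift_Spin lift_cover intro!: image_cong)

lemma total_space_associated: "total_space associated_bundle = spin.quot"
  by (simp add: associated_bundle_def)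

lemma associated_point:
  assumes "p \<in> topspace spin.quot"
  obtains x u where "u \<in> Spin" "p = spin.cls (x, u)"
  using assms by (auto simp: spin.topspace_quot)

lemma spin_cls_mem: "u \<in> Spin \<Longrightarrow> spin.cls (x, u) \<in> topspace spin.quot"
  by (auto simp: spin.topspace_quot)

text \<open>
  The product of the orbit map with the identity of the spin group is open, hence a quotient map, so
  continuity can be checked upstairs.
\<close>

lemma continuous_associated_action:
  "continuous_map (prod_topology spin.quot (top_of_set Spin)) spin.quot
    (\<lambda>(p, w). right_action associated_bundle p w)"
proof (rule continuous_compose_quotient_map)
  let ?q = "\<lambda>(t, w :: 'n clifford). (spin.cls t, w)"
  have "open_map (prod_topology spin_frames (top_of_set Spin)) (prod_topology spin.quot (top_of_set Spin)) ?q"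
    using open_map_prod [OF spin.open_map_cls open_map_id] by simp
  moreover have "continuous_map (prod_topology spin_frames (top_of_set Spin)) (prod_topology spin.quot (top_of_set Spin)) ?q"
    using spin.continuous_map_cls by (simp add: continuous_map_prod_top)
  moreover have "?q ` topspace (prod_topology spin_frames (top_of_set Spin)) = topspace (prod_topology spin.quot (top_of_set Spin))"
    by (force simp: spin.topspace_quot)
  ultimately show "quotient_map (prod_topology spin_frames (top_of_set Spin)) (prod_topology spin.quot (top_of_set Spin)) ?q"
    by (simp add: continuous_open_imp_quotient_map)
  have T: "prod_topology spin_frames (top_of_set (Spin :: 'n clifford set)) = top_of_set ((UNIV \<times> Spin) \<times> Spin)"
    unfolding spin_frames_eq by simp
  have "continuous_on ((UNIV \<times> Spin) \<times> Spin) (\<lambda>((x :: real ^ 'n::_, u :: 'n clifford), w). (x, u * w))"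
    unfolding case_prod_beta by (intro continuous_intros)
  then have "continuous_map (prod_topology spin_frames (top_of_set Spin)) spin_frames (\<lambda>((x, u), w). (x, u * w))"
    unfolding T unfolding spin_frames_eq by (auto simp: continuous_map_in_subtopology Spin_mult)
  then have "continuous_map (prod_topology spin_frames (top_of_set Spin)) spin.quot (spin.cls \<circ> (\<lambda>((x, u), w). (x, u * w)))"
    using spin.continuous_map_cls by (rule continuous_map_compose)
  then show "continuous_map (prod_topology spin_frames (top_of_set Spin)) spin.quot
      ((\<lambda>(p, w). right_action associated_bundle p w) \<circ> ?q)"
    by (rule continuous_map_eq) (auto simp: right_action_spin_cls)
qed

lemma continuous_associated_projection: "continuous_map spin.quot base.quot (projection associated_bundle)"
proof (rule continuous_compose_quotient_map [OF spin.quotient_map_cls])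
  have "continuous_map spin_frames base.quot (base.cls \<circ> fst)"
    using continuous_map_compose [OF continuous_map_fst base.continuous_map_cls] .
  then show "continuous_map spin_frames base.quot (projection associated_bundle \<circ> spin.cls)"
    by (rule continuous_map_eq) (auto simp: projection_spin_cls)
qed

text \<open>
  Over a small ball both the orbit map of the base and that of the spin frames are injective and open.  So
  both \<open>U \<times> Spin(n)\<close> and the part of the bundle over \<open>U\<close> are copies of the product of the ball with the
  spin group.
\<close>

lemma associated_trivialization:
  assumes y: "y \<in> topspace base.quot"
  shows "\<exists>U \<tau>. openin base.quot U \<and> y \<in> U \<and>
    homeomorphic_map (prod_topology (subtopology base.quot U) (top_of_set Spin))
      (subtopology spin.quot {p \<in> topspace spin.quot. projection associated_bundle p \<in> U}) \<tau> \<and>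
    (\<forall>y\<in>U. \<forall>g\<in>Spin. projection associated_bundle (\<tau> (y, g)) = y \<and>
      (\<forall>h\<in>Spin. \<tau> (y, g * h) = right_action associated_bundle (\<tau> (y, g)) h))"
proof -
  obtain x where x: "y = base.cls x"
    using y by (auto simp: base.topspace_quot)
  obtain e where e: "e > 0" "\<And>\<gamma> y. \<gamma> \<in> \<Gamma> \<Longrightarrow> y \<in> ball x e \<Longrightarrow> motion_apply \<gamma> y \<in> ball x e \<Longrightarrow> \<gamma> = \<one>\<^bsub>euclidean_group\<^esub>"
    using properly_discontinuous by blast
  define W where "W = ball x e \<times> (Spin :: 'n clifford set)"
  define U where "U = base.cls ` ball x e"
  let ?S = "top_of_set (Spin :: 'n clifford set)"
  let ?\<eta> = "\<lambda>(b, u :: 'n clifford). (base.cls b, u)"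
  have W: "openin spin_frames W"
    unfolding W_def by (simp add: openin_prod_Times_iff)
  have U: "openin base.quot U"
    using base.open_map_cls by (simp add: open_map_def U_def)
  have base_inj: "b = b'" if "b \<in> ball x e" "b' \<in> ball x e" "base.cls b = base.cls b'" for b b'
    by (rule base.cls_eq_small [of "ball x e", OF e(2)]) (use that in auto)
  have spin_inj: "inj_on spin.cls W"
  proof (rule inj_onI)
    fix t t' assume "t \<in> W" "t' \<in> W" "spin.cls t = spin.cls t'"
    then show "t = t'"
      by (intro spin.cls_eq_small [of "ball x e", OF e(2)]) (auto simp: W_def)
  qed
  have eta_inj: "inj_on ?\<eta> W"
    using base_inj by (auto simp: inj_on_def W_def)
  have h1: "homeomorphic_map (subtopology spin_frames W) (subtopology spin.quot (spin.cls ` W)) spin.cls"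
    by (rule open_injective_homeomorphic_map [OF spin.continuous_map_cls spin.open_map_cls W spin_inj])
  have "homeomorphic_map (subtopology spin_frames W) (subtopology (prod_topology base.quot ?S) (?\<eta> ` W)) ?\<eta>"
  proof (rule open_injective_homeomorphic_map [OF _ _ W])
    show "continuous_map spin_frames (prod_topology base.quot ?S) ?\<eta>"
      using base.continuous_map_cls by (simp add: continuous_map_prod_top)
    show "open_map spin_frames (prod_topology base.quot ?S) ?\<eta>"
      using open_map_prod [OF base.open_map_cls open_map_id] by simp
  qed (rule eta_inj)
  moreover have "?\<eta> ` W = U \<times> Spin"
    by (force simp: W_def U_def)
  moreover have "subtopology (prod_topology base.quot ?S) (U \<times> Spin) = prod_topology (subtopology base.quot U) ?S"
    unfolding prod_topology_subtopology(1) [of base.quot U ?S] by simp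
  ultimately have h2: "homeomorphic_map (subtopology spin_frames W) (prod_topology (subtopology base.quot U) ?S) ?\<eta>"
    by simp
  have topW: "topspace (subtopology spin_frames W) = W"
    using openin_subset [OF W] by (auto simp: topspace_subtopology)
  have same: "?\<eta> t = ?\<eta> t' \<longleftrightarrow> spin.cls t = spin.cls t'" if "t \<in> W" "t' \<in> W" for t t'
    by (simp only: inj_on_eq_iff [OF eta_inj that] inj_on_eq_iff [OF spin_inj that])
  \<comment> \<open>The trivialization is the homeomorphism between two quotients of the same space \<open>W\<close>.\<close>
  have qm: "quotient_map (subtopology spin_frames W) (prod_topology (subtopology base.quot U) ?S) ?\<eta>"
    "quotient_map (subtopology spin_frames W) (subtopology spin.quot (spin.cls ` W)) spin.cls"
    using h1 h2 by (simp_all only: homeomorphic_map_def)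
  have same': "?\<eta> t = ?\<eta> t' \<longleftrightarrow> spin.cls t = spin.cls t'"
    if "t \<in> topspace (subtopology spin_frames W)" "t' \<in> topspace (subtopology spin_frames W)" for t t'
    using same that by (simp only: topW)
  have "\<exists>\<tau>. homeomorphic_map (prod_topology (subtopology base.quot U) ?S) (subtopology spin.quot (spin.cls ` W)) \<tau> \<and>
      (\<forall>t\<in>topspace (subtopology spin_frames W). \<tau> (?\<eta> t) = spin.cls t)"
    using qm same' by (rule quotient_maps_same_fibres)
  then obtain \<tau> where \<tau>: "homeomorphic_map (prod_topology (subtopology base.quot U) ?S) (subtopology spin.quot (spin.cls ` W)) \<tau>"
    and \<tau>_eq': "\<forall>t\<in>topspace (subtopology spin_frames W). \<tau> (?\<eta> t) = spin.cls t"
    by (elim exE conjE)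
  then have \<tau>_eq: "\<tau> (?\<eta> t) = spin.cls t" if "t \<in> W" for t
    using that by (simp only: topW)
  have \<tau>_cls: "\<tau> (base.cls b, u) = spin.cls (b, u)" if "b \<in> ball x e" "u \<in> Spin" for b u
    using \<tau>_eq [of "(b, u)"] that by (simp add: W_def)
  have "spin.cls ` W = {p \<in> topspace spin.quot. projection associated_bundle p \<in> U}"
  proof (intro equalityI subsetI)
    fix p assume "p \<in> spin.cls ` W"
    then obtain b u where "b \<in> ball x e" "u \<in> Spin" "p = spin.cls (b, u)"
      by (auto simp: W_def)
    then show "p \<in> {p \<in> topspace spin.quot. projection associated_bundle p \<in> U}"
      by (simp add: spin_cls_mem projection_spin_cls U_def)
  next
    fix p assume p: "p \<in> {p \<in> topspace spin.quot. projection associated_bundle p \<in> U}"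
    then obtain z u where zu: "u \<in> Spin" "p = spin.cls (z, u)"
      using associated_point by blast
    with p obtain b where b: "b \<in> ball x e" "base.cls z = base.cls b"
      by (auto simp: projection_spin_cls U_def)
    then obtain \<gamma> where \<gamma>: "\<gamma> \<in> \<Gamma>" "b = motion_apply \<gamma> z"
      using base.cls_eq_iff by auto
    then have "p = spin.cls (b, \<epsilon> \<gamma> * u)"
      using spin.cls_action [of \<gamma> "(z, u)"] zu by (simp add: spin_motion_eq)
    moreover have "(b, \<epsilon> \<gamma> * u) \<in> W"
      using b \<gamma> zu by (simp add: W_def Spin_mult lift_Spin)
    ultimately show "p \<in> spin.cls ` W" by blast
  qed
  with \<tau> have \<tau>_hom: "homeomorphic_map (prod_topology (subtopology base.quot U) ?S)
      (subtopology spin.quot {p \<in> topspace spin.quot. projection associated_bundle p \<in> U}) \<tau>"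
    by simp
  have yU: "y \<in> U"
    using e(1) by (simp add: x U_def)
  have \<tau>_proj: "projection associated_bundle (\<tau> (z, g)) = z" if "z \<in> U" "g \<in> Spin" for z g
    using that by (auto simp: U_def \<tau>_cls projection_spin_cls)
  have \<tau>_act: "\<tau> (z, g * h) = right_action associated_bundle (\<tau> (z, g)) h" if "z \<in> U" "g \<in> Spin" "h \<in> Spin" for z g h
    using that by (auto simp: U_def \<tau>_cls right_action_spin_cls Spin_mult)
  show ?thesis
    by (intro exI [of _ U] exI [of _ \<tau>] conjI ballI U yU \<tau>_hom \<tau>_proj \<tau>_act)
qed

lemma principal_associated_bundle: "principal_bundle spin_group base.quot associated_bundle"
  unfolding principal_bundle_def total_space_associated spin_group_simps
proof (intro conjI ballI)
  fix p assume "p \<in> topspace spin.quot"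
  then obtain x u where p: "u \<in> Spin" "p = spin.cls (x, u)"
    by (rule associated_point)
  then show "right_action associated_bundle p 1 = p"
    by (simp add: right_action_spin_cls)
  fix g
  show "projection associated_bundle (right_action associated_bundle p g) = projection associated_bundle p"
    by (simp add: p right_action_spin_cls projection_spin_cls)
  fix h
  show "right_action associated_bundle (right_action associated_bundle p g) h = right_action associated_bundle p (g * h)"
    by (simp add: p right_action_spin_cls mult.assoc)
qed (use continuous_associated_projection continuous_associated_action associated_trivialization in blast)+

lemma open_map_spin_cover: "open_map (top_of_set Spin) (top_of_set (carrier SO_group)) spin_cover"
  unfolding open_map_def using openin_spin_cover_image by blast

lemma continuous_map_spin_cover: "continuous_map (top_of_set Spin) (top_of_set (carrier SO_group)) spin_cover"
  using continuous_on_spin_cover rotation_spin_cover by (auto simp: continuous_map_in_subtopology)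

lemma associated_covering_composite:
  "continuous_map spin_frames frame.quot (associated_covering \<circ> spin.cls)"
  "open_map spin_frames frame.quot (associated_covering \<circ> spin.cls)"
proof -
  let ?l = "\<lambda>(x, u). (x :: real ^ 'n::_, spin_cover (u :: 'n clifford))"
  have eq: "(frame.cls \<circ> ?l) t = (associated_covering \<circ> spin.cls) t" if "t \<in> topspace spin_frames" for t
    using that by (auto simp: associated_covering_cls)
  have "continuous_map spin_frames frames ?l"
    by (subst continuous_map_prod_top, intro disjI2 conjI continuous_map_spin_cover) simp
  then have "continuous_map spin_frames frame.quot (frame.cls \<circ> ?l)"
    using frame.continuous_map_cls by (rule continuous_map_compose)
  then show "continuous_map spin_frames frame.quot (associated_covering \<circ> spin.cls)"
    by (rule continuous_map_eq) (rule eq)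
  have "open_map spin_frames frames ?l"
    using open_map_prod [OF open_map_id open_map_spin_cover] by simp
  then have "open_map spin_frames frame.quot (frame.cls \<circ> ?l)"
    using frame.open_map_cls by (rule open_map_compose)
  then show "open_map spin_frames frame.quot (associated_covering \<circ> spin.cls)"
    by (rule open_map_eq) (rule eq)
qed

lemma continuous_associated_covering: "continuous_map spin.quot frame.quot associated_covering"
  by (rule continuous_compose_quotient_map [OF spin.quotient_map_cls associated_covering_composite(1)])

lemma open_associated_covering: "open_map spin.quot frame.quot associated_covering"
  by (rule open_map_from_composition_left [OF associated_covering_composite(2) spin.continuous_map_cls])
    (simp add: spin.topspace_quot)

lemma associated_covering_fibre:
  assumes "u \<in> Spin" "v \<in> Spin" "frame.cls (x, spin_cover u) = frame.cls (y, spin_cover v)"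
  shows "spin.cls (x, u) = spin.cls (y, v) \<or> spin.cls (x, u) = spin.cls (y, - v)"
proof -
  obtain \<gamma> where \<gamma>: "\<gamma> \<in> \<Gamma>" "(y, spin_cover v) = motion_frame \<gamma> (x, spin_cover u)"
    using frame.cls_eq_iff [of "(x, spin_cover u)" "(y, spin_cover v)"] assms by (auto simp: rotation_spin_cover)
  then have "spin_cover v = spin_cover (\<epsilon> \<gamma> * u)"
    using assms by (simp add: motion_frame_eq spin_cover_mult lift_Spin lift_cover)
  then have "\<epsilon> \<gamma> * u = v \<or> \<epsilon> \<gamma> * u = - v"
    using spin_cover_eq_iff [of v "\<epsilon> \<gamma> * u"] assms \<gamma>(1) by (auto simp: Spin_mult lift_Spin)
  moreover have "spin.cls (x, u) = spin.cls (y, \<epsilon> \<gamma> * u)"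
    using spin.cls_action [of \<gamma> "(x, u)"] \<gamma> assms by (simp add: spin_motion_eq motion_frame_eq)
  ultimately show ?thesis by metis
qed

text \<open>
  The sheets over a small neighbourhood of \<open>[(x, C)]\<close> consist of the classes of \<open>(b, v)\<close> and of \<open>(b, -v)\<close>,
  for \<open>b\<close> in a small ball about \<open>x\<close> and \<open>v\<close> in a small neighbourhood of a preimage \<open>c\<close> of \<open>C\<close>.  They are
  disjoint because \<open>\<Gamma>\<close> does not identify points over the ball and no \<open>v\<close> has its negative nearby.
\<close>

lemma two_fold_associated_covering: "two_fold_covering spin.quot frame.quot associated_covering"
  unfolding two_fold_covering_def
proof (intro conjI ballI)
  fix q assume "q \<in> topspace frame.quot"
  then obtain x C where q: "rotation_matrix C" "q = frame.cls (x, C)"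
    by (auto simp: frame.topspace_quot)
  obtain c where c: "c \<in> Spin" "spin_cover c = C"
    using spin_cover_surj [OF q(1)] .
  obtain V where V: "openin (top_of_set Spin) V" "c \<in> V" "V \<inter> uminus ` V = {}"
    using spin_cover_evenly_covered [OF c(1)] .
  have VS: "V \<subseteq> Spin"
    using V(1) by (rule openin_imp_subset)
  obtain e where e: "e > 0" "\<And>\<gamma> y. \<gamma> \<in> \<Gamma> \<Longrightarrow> y \<in> ball x e \<Longrightarrow> motion_apply \<gamma> y \<in> ball x e \<Longrightarrow> \<gamma> = \<one>\<^bsub>euclidean_group\<^esub>"
    using properly_discontinuous by blast
  have neg: "- v \<notin> V" if "v \<in> V" for v
    using V(3) that by (metis IntI add.inverse_inverse empty_iff imageI)
  have openN: "openin (top_of_set Spin) (uminus ` V)"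
  proof -
    have "openin (top_of_set Spin) (Spin \<inter> uminus -` V)"
      by (rule continuous_openin_preimage [OF _ _ V(1)]) (auto intro!: continuous_intros)
    moreover have "Spin \<inter> uminus -` V = uminus ` V"
      using VS by (force simp: image_iff)
    ultimately show ?thesis by simp
  qed
  define S where "S = (\<lambda>N :: 'n clifford set. spin.cls ` (ball x e \<times> N))"
  define T where "T = associated_covering ` S V"
  have small: "(b, v) = (b', v')" if "spin.cls (b, v) = spin.cls (b', v')" "b \<in> ball x e" "b' \<in> ball x e" "v \<in> Spin" "v' \<in> Spin" for b b' v v'
    by (rule spin.cls_eq_small [of "ball x e", OF e(2)]) (use that in auto)
  have covS: "associated_covering ` S N = (\<lambda>(b, v). frame.cls (b, spin_cover v)) ` (ball x e \<times> N)" if "N \<subseteq> Spin" for N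
    unfolding S_def image_image using that by (intro image_cong) (auto simp: associated_covering_cls)
  have TN: "associated_covering ` S (uminus ` V) = T"
  proof -
    have NS: "uminus ` V \<subseteq> Spin"
      using VS by auto
    have "ball x e \<times> uminus ` V = (\<lambda>(b, v). (b, - v)) ` (ball x e \<times> V)"
      by force
    then show ?thesis
      unfolding T_def covS [OF VS] covS [OF NS] by (simp add: image_image case_prod_beta)
  qed
  have sheet: "openin spin.quot (S N)" "inj_on associated_covering (S N)"
    if N: "N = V \<or> N = uminus ` V" for N
  proof -
    have NS: "N \<subseteq> Spin" and oN: "openin (top_of_set Spin) N"
      using N VS V(1) openN by auto
    have "openin spin_frames (ball x e \<times> N)"
      using oN by (simp add: openin_prod_Times_iff)
    then show "openin spin.quot (S N)"
      using spin.open_map_cls by (simp add: S_def open_map_def)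
    show "inj_on associated_covering (S N)"
    proof (rule inj_onI)
      fix p p' assume "p \<in> S N" "p' \<in> S N" and eq: "associated_covering p = associated_covering p'"
      then obtain b v b' v' where p: "b \<in> ball x e" "v \<in> N" "p = spin.cls (b, v)"
        "b' \<in> ball x e" "v' \<in> N" "p' = spin.cls (b', v')"
        by (auto simp: S_def)
      have vS: "v \<in> Spin" "v' \<in> Spin"
        using p NS by auto
      then have "frame.cls (b, spin_cover v) = frame.cls (b', spin_cover v')"
        using eq by (simp add: p associated_covering_cls)
      then have "spin.cls (b, v) = spin.cls (b', v') \<or> spin.cls (b, v) = spin.cls (b', - v')"
        using associated_covering_fibre vS by blast
      moreover have "spin.cls (b, v) \<noteq> spin.cls (b', - v')"
      proof
        assume "spin.cls (b, v) = spin.cls (b', - v')"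
        then have "v = - v'"
          using small p(1,4) vS by (metis Pair_inject Spin_minus)
        then show False
          using N p(2,5) neg by auto
      qed
      ultimately show "p = p'"
        by (simp add: p)
    qed
  qed
  have disj: "S V \<inter> S (uminus ` V) = {}"
  proof -
    have False if "spin.cls (b, v) = spin.cls (b', - v')" "b \<in> ball x e" "b' \<in> ball x e" "v \<in> V" "v' \<in> V" for b b' v v'
    proof -
      have "v = - v'"
        using small [OF that(1-3)] that(4,5) VS by auto
      then show False
        using neg that by auto
    qed
    then show ?thesis by (auto simp: S_def)
  qed
  have union: "S V \<union> S (uminus ` V) = {p \<in> topspace spin.quot. associated_covering p \<in> T}"
  proof (intro equalityI subsetI)
    fix p assume "p \<in> S V \<union> S (uminus ` V)"
    then obtain N where N: "N = V \<or> N = uminus ` V" "p \<in> S N"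
      by blast
    have "p \<in> topspace spin.quot"
      using openin_subset [OF sheet(1) [OF N(1)]] N(2) by blast
    moreover have "associated_covering ` S N = T"
      using N(1) TN by (auto simp: T_def)
    ultimately show "p \<in> {p \<in> topspace spin.quot. associated_covering p \<in> T}"
      using N(2) by blast
  next
    fix p assume p: "p \<in> {p \<in> topspace spin.quot. associated_covering p \<in> T}"
    then obtain y u where u: "u \<in> Spin" "p = spin.cls (y, u)"
      using associated_point by blast
    obtain b v where bv: "b \<in> ball x e" "v \<in> V" "frame.cls (y, spin_cover u) = frame.cls (b, spin_cover v)"
      using p u by (auto simp: T_def covS [OF VS] associated_covering_cls)
    then have "p = spin.cls (b, v) \<or> p = spin.cls (b, - v)"
      using associated_covering_fibre u VS by blast
    then show "p \<in> S V \<union> S (uminus ` V)"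
      using bv by (auto simp: S_def)
  qed
  have cS: "spin.cls (x, c) \<in> S V" "spin.cls (x, - c) \<in> S (uminus ` V)"
    using V(2) e(1) by (auto simp: S_def)
  have "{p \<in> topspace spin.quot. associated_covering p = q} = {spin.cls (x, c), spin.cls (x, - c)}"
  proof (intro equalityI subsetI)
    fix p assume p: "p \<in> {p \<in> topspace spin.quot. associated_covering p = q}"
    then obtain y u where u: "u \<in> Spin" "p = spin.cls (y, u)"
      using associated_point by blast
    then show "p \<in> {spin.cls (x, c), spin.cls (x, - c)}"
      using p q c associated_covering_fibre [of u c y x] by (auto simp: associated_covering_cls)
  qed (use c q in \<open>auto simp: associated_covering_cls spin_cls_mem\<close>)
  moreover have "spin.cls (x, c) \<noteq> spin.cls (x, - c)"
    using cS disj by auto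
  ultimately show "card {p \<in> topspace spin.quot. associated_covering p = q} = 2"
    by simp
  show "\<exists>T. openin frame.quot T \<and> q \<in> T \<and> (\<exists>\<V>. \<Union>\<V> = {p \<in> topspace spin.quot. associated_covering p \<in> T} \<and>
      pairwise disjnt \<V> \<and> (\<forall>V\<in>\<V>. openin spin.quot V \<and>
        homeomorphic_map (subtopology spin.quot V) (subtopology frame.quot T) associated_covering))"
  proof (intro exI [of _ T] conjI exI [of _ "{S V, S (uminus ` V)}"] ballI)
    show "openin frame.quot T"
      using sheet(1) [of V] open_associated_covering by (simp add: open_map_def T_def)
    have "associated_covering (spin.cls (x, c)) = q"
      by (simp add: associated_covering_cls c q)
    then show "q \<in> T"
      using cS(1) by (auto simp: T_def)
    show "\<Union> {S V, S (uminus ` V)} = {p \<in> topspace spin.quot. associated_covering p \<in> T}"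
      using union by simp
    show "pairwise disjnt {S V, S (uminus ` V)}"
      using disj by (auto simp: pairwise_def disjnt_def)
  next
    fix W assume "W \<in> {S V, S (uminus ` V)}"
    then obtain N where N: "N = V \<or> N = uminus ` V" "W = S N" by blast
    then show "openin spin.quot W"
      using sheet(1) by blast
    have "associated_covering ` W = T"
      using N TN by (auto simp: T_def)
    then show "homeomorphic_map (subtopology spin.quot W) (subtopology frame.quot T) associated_covering"
      using open_injective_homeomorphic_map [OF continuous_associated_covering open_associated_covering sheet [OF N(1)]] N(2)
      by simp
  qed
qed (rule continuous_associated_covering)

theorem spin_structure_associated:
  "spin_structure (flat_manifold \<Gamma>) (frame_bundle \<Gamma>) (associated_bundle, associated_covering)"
  unfolding spin_structure_def prod.case flat_manifold_eq total_space_frame_bundle total_space_associated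
proof (intro conjI principal_associated_bundle two_fold_associated_covering ballI)
  fix p assume "p \<in> topspace spin.quot"
  then obtain x u where p: "u \<in> Spin" "p = spin.cls (x, u)"
    by (rule associated_point)
  show "projection (frame_bundle \<Gamma>) (associated_covering p) = projection associated_bundle p"
    by (simp add: p associated_covering_cls projection_frame_cls projection_spin_cls)
  fix w :: "'n clifford" assume "w \<in> Spin"
  with p show "associated_covering (right_action associated_bundle p w) =
      right_action (frame_bundle \<Gamma>) (associated_covering p) (spin_cover w)"
    by (simp add: associated_covering_cls right_action_spin_cls right_action_frame_cls Spin_mult spin_cover_mult)
qed

end

section \<open>The lift of the holonomy determined by a spin structure\<close>

context oriented_bieberbach_group
begin

text \<open>
  A lift \<open>s\<close> of the standard frames to \<open>P\<close> whose failure to be invariant under \<open>\<Gamma>\<close> is measured by \<open>\<epsilon>\<close>.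
\<close>

definition framing :: "('p, (real ^ 'n::_) set, 'n clifford) bundle_data \<Rightarrow> ('p \<Rightarrow> 'n frame set) \<Rightarrow>
    ('n motion \<Rightarrow> 'n clifford) \<Rightarrow> (real ^ 'n::_ \<Rightarrow> 'p) \<Rightarrow> bool" where
  "framing P \<Lambda> \<epsilon> s \<longleftrightarrow> continuous_map euclidean (total_space P) s \<and>
    (\<forall>x. \<Lambda> (s x) = frame.cls (x, mat 1)) \<and>
    (\<forall>\<gamma>\<in>\<Gamma>. \<epsilon> \<gamma> \<in> Spin \<and> (\<forall>x. right_action P (s (motion_apply \<gamma> x)) (\<epsilon> \<gamma>) = s x))"

lemma frame_cls_eq_iff:
  assumes "rotation_matrix B" "rotation_matrix C"
  shows "frame.cls (x, B) = frame.cls (x, C) \<longleftrightarrow> B = C"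
  using frame.cls_eq_same_base [of "(x, B)" "(x, C)"] assms by auto

lemma frame_cls_motion:
  assumes "\<gamma> \<in> \<Gamma>" "rotation_matrix B"
  shows "frame.cls (motion_apply \<gamma> x, fst \<gamma> ** B) = frame.cls (x, B)"
  using frame.cls_action [of \<gamma> "(x, B)"] assms by (simp add: motion_frame_eq)

lemma rotation_one: "rotation_matrix (mat 1 :: real ^ 'n::_ ^ 'n::_)"
  by (simp add: rotation_matrix_def orthogonal_matrix_id)

end

locale flat_spin_structure = oriented_bieberbach_group \<Gamma> for \<Gamma> :: "'n::{finite,linorder} motion set" +
  fixes P :: "('p, (real ^ 'n::_) set, 'n clifford) bundle_data" and \<Lambda> :: "'p \<Rightarrow> 'n frame set"
  assumes spin: "spin_structure (flat_manifold \<Gamma>) (frame_bundle \<Gamma>) (P, \<Lambda>)"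
begin

abbreviation "M \<equiv> topspace (total_space P)"
abbreviation act (infixl "\<cdot>" 70) where "p \<cdot> u \<equiv> right_action P p u"

lemma principal: "principal_bundle spin_group base.quot P"
  using spin by (simp add: spin_structure_def flat_manifold_eq)

lemma covering: "two_fold_covering (total_space P) frame.quot \<Lambda>"
  using spin by (simp add: spin_structure_def total_space_frame_bundle)

lemma projection_\<Lambda>: "p \<in> M \<Longrightarrow> projection (frame_bundle \<Gamma>) (\<Lambda> p) = projection P p"
  and \<Lambda>_act: "p \<in> M \<Longrightarrow> u \<in> Spin \<Longrightarrow> \<Lambda> (p \<cdot> u) = right_action (frame_bundle \<Gamma>) (\<Lambda> p) (spin_cover u)"
  using spin by (auto simp: spin_structure_def)

lemma continuous_projection: "continuous_map (total_space P) base.quot (projection P)"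
  using principal by (simp add: principal_bundle_def)

lemma continuous_act: "continuous_map (prod_topology (total_space P) (top_of_set Spin)) (total_space P) (\<lambda>(p, u). p \<cdot> u)"
  using principal by (simp add: principal_bundle_def)

lemma act_closed: "p \<in> M \<Longrightarrow> u \<in> Spin \<Longrightarrow> p \<cdot> u \<in> M"
  using continuous_map_funspace [OF continuous_act] by (auto simp: Pi_iff)

lemma projection_act: "p \<in> M \<Longrightarrow> u \<in> Spin \<Longrightarrow> projection P (p \<cdot> u) = projection P p"
  and act_mult: "p \<in> M \<Longrightarrow> u \<in> Spin \<Longrightarrow> w \<in> Spin \<Longrightarrow> p \<cdot> u \<cdot> w = p \<cdot> (u * w)"
  using principal by (auto simp: principal_bundle_def)

text \<open>
  A local trivialization restricted to one fibre identifies the fibre with the spin group; from this the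
  action on fibres is seen to be free and transitive.
\<close>

lemma trivialization:
  assumes p: "p \<in> M"
  obtains \<tau> where "inj_on \<tau> Spin" "\<tau> ` Spin = {p' \<in> M. projection P p' = projection P p}"
    "\<forall>g\<in>Spin. \<forall>h\<in>Spin. \<tau> (g * h) = \<tau> g \<cdot> h"
proof -
  define y where "y = projection P p"
  have "y \<in> topspace base.quot"
    using continuous_map_funspace [OF continuous_projection] p by (auto simp: y_def)
  then obtain U \<tau> where U: "openin base.quot U" "y \<in> U"
    and \<tau>: "homeomorphic_map (prod_topology (subtopology base.quot U) (top_of_set Spin))
      (subtopology (total_space P) {p \<in> M. projection P p \<in> U}) \<tau>"
    and act: "\<forall>y\<in>U. \<forall>g\<in>Spin. projection P (\<tau> (y, g)) = y \<and> (\<forall>h\<in>Spin. \<tau> (y, g * h) = \<tau> (y, g) \<cdot> h)"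
    using principal unfolding principal_bundle_def spin_group_simps by meson
  have "topspace (subtopology base.quot U) = U"
    using U(1) by (metis openin_subset topspace_subtopology_subset)
  then have top: "topspace (prod_topology (subtopology base.quot U) (top_of_set (Spin :: 'n clifford set))) = U \<times> Spin"
    by simp
  have image: "\<tau> ` (U \<times> Spin) = {p \<in> M. projection P p \<in> U}"
    using homeomorphic_imp_surjective_map [OF \<tau>] by (simp only: top) auto
  have inj: "inj_on \<tau> (U \<times> Spin)"
    using homeomorphic_imp_injective_map [OF \<tau>] by (simp only: top)
  show ?thesis
  proof (rule that [of "\<lambda>g. \<tau> (y, g)"])
    show "inj_on (\<lambda>g. \<tau> (y, g)) Spin"
      using inj U(2) by (auto simp: inj_on_def)
    show "(\<lambda>g. \<tau> (y, g)) ` Spin = {p' \<in> M. projection P p' = projection P p}"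
    proof (intro equalityI subsetI)
      fix p' assume "p' \<in> (\<lambda>g. \<tau> (y, g)) ` Spin"
      then obtain g where g: "g \<in> Spin" "p' = \<tau> (y, g)" by blast
      then have "p' \<in> \<tau> ` (U \<times> Spin)"
        using U(2) by blast
      then show "p' \<in> {p' \<in> M. projection P p' = projection P p}"
        using g act U(2) unfolding image by (simp add: y_def)
    next
      fix p' assume p': "p' \<in> {p' \<in> M. projection P p' = projection P p}"
      then have "p' \<in> \<tau> ` (U \<times> Spin)"
        using U(2) unfolding image by (simp add: y_def)
      then obtain z g where z: "z \<in> U" "g \<in> Spin" "p' = \<tau> (z, g)" by blast
      then have "z = y"
        using act p' by (simp add: y_def)
      then show "p' \<in> (\<lambda>g. \<tau> (y, g)) ` Spin"
        using z by blast
    qed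
  qed (use act U(2) in blast)
qed

lemma act_free:
  assumes p: "p \<in> M" and u: "u \<in> Spin" and w: "w \<in> Spin" and eq: "p \<cdot> u = p \<cdot> w"
  shows "u = w"
proof -
  obtain \<tau> where \<tau>: "inj_on \<tau> Spin" "\<tau> ` Spin = {p' \<in> M. projection P p' = projection P p}"
    "\<forall>g\<in>Spin. \<forall>h\<in>Spin. \<tau> (g * h) = \<tau> g \<cdot> h"
    using trivialization [OF p] .
  have "p \<in> \<tau> ` Spin"
    using p by (simp add: \<tau>(2))
  then obtain g where g: "g \<in> Spin" "p = \<tau> g" by blast
  then have "\<tau> (g * u) = \<tau> (g * w)"
    using eq u w by (simp add: \<tau>(3))
  then have "g * u = g * w"
    by (rule inj_onD [OF \<tau>(1)]) (use g u w in \<open>simp_all add: Spin_mult\<close>)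
  then have "(clifford_conj g * g) * u = (clifford_conj g * g) * w"
    by (simp add: mult.assoc)
  then show ?thesis
    by (simp add: SpinD(3) [OF g(1)])
qed

lemma act_transitive:
  assumes p: "p \<in> M" "p' \<in> M" and eq: "projection P p = projection P p'"
  obtains u where "u \<in> Spin" "p' = p \<cdot> u"
proof -
  obtain \<tau> where "inj_on \<tau> Spin" and \<tau>: "\<tau> ` Spin = {p' \<in> M. projection P p' = projection P p}"
    "\<forall>g\<in>Spin. \<forall>h\<in>Spin. \<tau> (g * h) = \<tau> g \<cdot> h"
    using trivialization [OF p(1)] .
  have "p \<in> \<tau> ` Spin" "p' \<in> \<tau> ` Spin"
    using p eq by (simp_all add: \<tau>(1))
  then obtain g g' where g: "g \<in> Spin" "p = \<tau> g" "g' \<in> Spin" "p' = \<tau> g'" by blast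
  have "p \<cdot> (clifford_conj g * g') = \<tau> (g * (clifford_conj g * g'))"
    using g by (simp add: \<tau>(2) Spin_mult Spin_conj)
  also have "g * (clifford_conj g * g') = g'"
    using SpinD(2) [OF g(1)] by (simp add: mult.assoc [symmetric])
  finally show ?thesis
    using that [of "clifford_conj g * g'"] g by (simp add: Spin_mult Spin_conj)
qed

lemma \<Lambda>_act_frame:
  assumes "p \<in> M" "u \<in> Spin" "\<Lambda> p = frame.cls (x, B)"
  shows "\<Lambda> (p \<cdot> u) = frame.cls (x, B ** spin_cover u)"
  using assms by (simp add: \<Lambda>_act right_action_frame_cls)

lemma continuous_frame_section: "continuous_map euclidean frame.quot (\<lambda>x. frame.cls (x, mat 1))"
proof -
  have "continuous_map euclidean frames (\<lambda>x. (x, mat 1))"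
    using rotation_one by (simp add: continuous_map_paired continuous_map_const)
  then show ?thesis
    using continuous_map_compose [OF _ frame.continuous_map_cls] by (auto simp: o_def)
qed

lemma section_eq_everywhere:
  assumes s: "continuous_map euclidean (total_space P) s" and t: "continuous_map euclidean (total_space P) t"
    and eq: "\<And>x. \<Lambda> (s x) = \<Lambda> (t x)" and 0: "s 0 = t (0 :: real ^ 'n::_)"
  shows "s x = t x"
  by (rule lifts_agree [OF covering connected_UNIV, of 0]) (use assms in simp_all)

lemma continuous_act_section:
  assumes "continuous_map euclidean (total_space P) s" "u \<in> Spin"
  shows "continuous_map euclidean (total_space P) (\<lambda>x. s x \<cdot> u)"
proof -
  have "continuous_map euclidean (prod_topology (total_space P) (top_of_set Spin)) (\<lambda>x. (s x, u))"
    using assms by (simp add: continuous_map_paired continuous_map_const)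
  from continuous_map_compose [OF this continuous_act] show ?thesis
    by (simp add: o_def)
qed

lemma projection_eq_base:
  assumes "p \<in> M" "\<Lambda> p = frame.cls (x, B)"
  shows "projection P p = base.cls x"
  using projection_\<Lambda> [OF assms(1)] assms(2) by (simp add: projection_frame_cls)

text \<open>
  The element \<open>u = \<epsilon> \<gamma>\<close> is chosen at the origin.  Then \<open>x \<mapsto> s (\<gamma> x) \<cdot> u\<close> and \<open>s\<close> are lifts of the same
  map which agree at the origin, so the defining equation holds everywhere.
\<close>

theorem framing_exists:
  obtains \<epsilon> s where "spin_lift \<Gamma> \<epsilon>" "framing P \<Lambda> \<epsilon> s"
proof -
  have "frame.cls (0, mat 1) \<in> topspace frame.quot"
    using rotation_one by (auto simp: frame.topspace_quot)
  then obtain p where p: "p \<in> M" "\<Lambda> p = frame.cls (0, mat 1)"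
    using two_fold_covering_point [OF covering] by blast
  obtain s where s: "continuous_map euclidean (total_space P) s" "\<And>x. \<Lambda> (s x) = frame.cls (x, mat 1)"
    using two_fold_covering_lift [OF covering continuous_frame_section p] by metis
  have sM: "s x \<in> M" for x
    using continuous_map_funspace [OF s(1)] by auto
  have proj: "projection P (s x) = base.cls x" for x
    using projection_eq_base [OF sM s(2)] .
  have "\<exists>u\<in>Spin. spin_cover u = fst \<gamma> \<and> (\<forall>x. s (motion_apply \<gamma> x) \<cdot> u = s x)" if \<gamma>: "\<gamma> \<in> \<Gamma>" for \<gamma>
  proof -
    have "projection P (s (motion_apply \<gamma> 0)) = projection P (s 0)"
      using base.cls_action [of \<gamma> 0] \<gamma> by (simp add: proj)
    then obtain u where u: "u \<in> Spin" "s 0 = s (motion_apply \<gamma> 0) \<cdot> u"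
      using act_transitive sM by metis
    have \<Lambda>u: "\<Lambda> (s (motion_apply \<gamma> x) \<cdot> u) = frame.cls (motion_apply \<gamma> x, spin_cover u)" for x
      using \<Lambda>_act_frame [OF sM u(1) s(2)] by simp
    have "frame.cls (motion_apply \<gamma> 0, spin_cover u) = frame.cls (0, mat 1)"
      using \<Lambda>u [of 0] u(2) s(2) [of 0] by metis
    also have "\<dots> = frame.cls (motion_apply \<gamma> 0, fst \<gamma>)"
      using frame_cls_motion [OF \<gamma> rotation_one, of 0] by simp
    finally have cu: "spin_cover u = fst \<gamma>"
      using frame_cls_eq_iff rotation_spin_cover [OF u(1)] rotation [OF \<gamma>] by blast
    have same: "\<Lambda> (s (motion_apply \<gamma> x) \<cdot> u) = \<Lambda> (s x)" for x
      using frame_cls_motion [OF \<gamma> rotation_one, of x] by (simp add: \<Lambda>u cu s(2))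
    have "continuous_map euclidean (total_space P) (\<lambda>x. s (motion_apply \<gamma> x))"
      using continuous_map_compose [OF _ s(1), of euclidean "motion_apply \<gamma>"] motion_continuous [of \<gamma>] by (simp add: o_def)
    then have cont: "continuous_map euclidean (total_space P) (\<lambda>x. s (motion_apply \<gamma> x) \<cdot> u)"
      using u(1) by (rule continuous_act_section)
    have "s (motion_apply \<gamma> x) \<cdot> u = s x" for x
      by (rule section_eq_everywhere [OF cont s(1) same u(2) [symmetric]])
    then show ?thesis
      using u(1) cu by blast
  qed
  then obtain \<epsilon> where \<epsilon>: "\<And>\<gamma>. \<gamma> \<in> \<Gamma> \<Longrightarrow> \<epsilon> \<gamma> \<in> Spin" "\<And>\<gamma>. \<gamma> \<in> \<Gamma> \<Longrightarrow> spin_cover (\<epsilon> \<gamma>) = fst \<gamma>"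
    "\<And>\<gamma> x. \<gamma> \<in> \<Gamma> \<Longrightarrow> s (motion_apply \<gamma> x) \<cdot> \<epsilon> \<gamma> = s x"
    by metis
  have "spin_lift \<Gamma> \<epsilon>"
  proof unfold_locales
    fix \<gamma> \<delta> assume gd: "\<gamma> \<in> \<Gamma>" "\<delta> \<in> \<Gamma>"
    let ?p = "s (motion_apply (\<gamma> \<otimes>\<^bsub>euclidean_group\<^esub> \<delta>) 0)"
    have "?p \<cdot> (\<epsilon> \<gamma> * \<epsilon> \<delta>) = ?p \<cdot> \<epsilon> \<gamma> \<cdot> \<epsilon> \<delta>"
      using gd by (simp add: act_mult sM \<epsilon>)
    also have "\<dots> = s 0"
      using gd by (simp add: motion_apply_mult \<epsilon>)
    also have "\<dots> = ?p \<cdot> \<epsilon> (\<gamma> \<otimes>\<^bsub>euclidean_group\<^esub> \<delta>)"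
      using gd by (simp add: \<epsilon> mult_mem)
    finally show "\<epsilon> (\<gamma> \<otimes>\<^bsub>euclidean_group\<^esub> \<delta>) = \<epsilon> \<gamma> * \<epsilon> \<delta>"
      using act_free [OF sM] gd by (metis Spin_mult \<epsilon>(1) mult_mem)
  qed (use \<epsilon> in auto)
  moreover have "framing P \<Lambda> \<epsilon> s"
    using s \<epsilon> by (simp add: framing_def)
  ultimately show ?thesis
    using that by blast
qed

text \<open>
  Two lifts of the standard frames differ by \<open>z = 1\<close> or \<open>z = -1\<close>, which commutes with \<open>\<epsilon> \<gamma>\<close>.
\<close>

lemma framing_unique:
  assumes "framing P \<Lambda> \<epsilon> s" "framing P \<Lambda> \<epsilon>' s'" and \<gamma>: "\<gamma> \<in> \<Gamma>"
  shows "\<epsilon> \<gamma> = \<epsilon>' \<gamma>"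
proof -
  have s: "continuous_map euclidean (total_space P) s" "\<And>x. \<Lambda> (s x) = frame.cls (x, mat 1)"
    and \<epsilon>: "\<epsilon> \<gamma> \<in> Spin" "\<And>x. s (motion_apply \<gamma> x) \<cdot> \<epsilon> \<gamma> = s x"
    using assms(1) \<gamma> by (auto simp: framing_def)
  have s': "continuous_map euclidean (total_space P) s'" "\<And>x. \<Lambda> (s' x) = frame.cls (x, mat 1)"
    and \<epsilon>': "\<epsilon>' \<gamma> \<in> Spin" "\<And>x. s' (motion_apply \<gamma> x) \<cdot> \<epsilon>' \<gamma> = s' x"
    using assms(2) \<gamma> by (auto simp: framing_def)
  have sM: "s x \<in> M" "s' x \<in> M" for x
    using continuous_map_funspace [OF s(1)] continuous_map_funspace [OF s'(1)] by auto
  have "projection P (s 0) = projection P (s' 0)"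
    using projection_eq_base [OF sM(1) s(2)] projection_eq_base [OF sM(2) s'(2)] by simp
  then obtain z where z: "z \<in> Spin" "s' 0 = s 0 \<cdot> z"
    using act_transitive sM by metis
  have \<Lambda>z: "\<Lambda> (s x \<cdot> z) = frame.cls (x, spin_cover z)" for x
    using \<Lambda>_act_frame [OF sM(1) z(1) s(2)] by simp
  have "frame.cls (0, spin_cover z) = frame.cls (0, mat 1)"
    using \<Lambda>z [of 0] z(2) s'(2) [of 0] by metis
  then have z1: "spin_cover z = mat 1"
    using frame_cls_eq_iff rotation_spin_cover [OF z(1)] rotation_one by blast
  then have zpm: "z = 1 \<or> z = - 1"
    using spin_cover_eq_iff [OF z(1) Spin_one] by simp
  have eq: "s' x = s x \<cdot> z" for x
    using section_eq_everywhere [OF s'(1) continuous_act_section [OF s(1) z(1)]] z(2)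
    by (simp add: s'(2) \<Lambda>z z1)
  let ?y = "motion_apply \<gamma> 0"
  have "s' ?y \<cdot> \<epsilon> \<gamma> = s ?y \<cdot> (z * \<epsilon> \<gamma>)"
    using \<epsilon>(1) z(1) sM by (simp add: eq act_mult)
  also have "z * \<epsilon> \<gamma> = \<epsilon> \<gamma> * z"
    using zpm by auto
  also have "s ?y \<cdot> (\<epsilon> \<gamma> * z) = s' 0"
    using \<epsilon> z(1) sM by (simp add: act_mult [symmetric] eq)
  finally have "s' ?y \<cdot> \<epsilon> \<gamma> = s' ?y \<cdot> \<epsilon>' \<gamma>"
    by (simp add: \<epsilon>'(2))
  then show ?thesis
    using act_free [OF sM(2) \<epsilon>(1) \<epsilon>'(1)] by blast
qed

context
  fixes \<epsilon> s
  assumes lift: "spin_lift \<Gamma> \<epsilon>" and framing: "framing P \<Lambda> \<epsilon> s"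
begin

interpretation L: spin_lift \<Gamma> \<epsilon>
  by (rule lift)

text \<open>
  The description of \<open>P\<close> as a quotient of the spin frames \<open>\<real>\<^sup>n \<times> Spin(n)\<close>.
\<close>

definition "chart = (\<lambda>(x, u). s x \<cdot> u)"

lemma framed_section: "continuous_map euclidean (total_space P) s" "\<Lambda> (s x) = frame.cls (x, mat 1)"
  "\<gamma> \<in> \<Gamma> \<Longrightarrow> s (motion_apply \<gamma> x) \<cdot> \<epsilon> \<gamma> = s x"
  using framing by (auto simp: framing_def)

lemma section_closed: "s x \<in> M"
  using continuous_map_funspace [OF framed_section(1)] by auto

lemma projection_chart: "u \<in> Spin \<Longrightarrow> projection P (s x \<cdot> u) = base.cls x"
  using projection_eq_base [OF section_closed framed_section(2)] by (simp add: projection_act section_closed)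

lemma \<Lambda>_chart: "u \<in> Spin \<Longrightarrow> \<Lambda> (s x \<cdot> u) = frame.cls (x, spin_cover u)"
  using \<Lambda>_act_frame [OF section_closed _ framed_section(2)] by simp

lemma chart_eq_iff:
  assumes u: "u \<in> Spin" and w: "w \<in> Spin"
  shows "s x \<cdot> u = s y \<cdot> w \<longleftrightarrow> (\<exists>\<gamma>\<in>\<Gamma>. y = motion_apply \<gamma> x \<and> w = \<epsilon> \<gamma> * u)"
proof
  assume eq: "s x \<cdot> u = s y \<cdot> w"
  then have "base.cls x = base.cls y"
    using projection_chart u w by metis
  then obtain \<gamma> where \<gamma>: "\<gamma> \<in> \<Gamma>" "y = motion_apply \<gamma> x"
    using base.cls_eq_iff by auto
  have "s y \<cdot> w = s y \<cdot> \<epsilon> \<gamma> \<cdot> u"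
    using eq framed_section(3) \<gamma> by simp
  then have "w = \<epsilon> \<gamma> * u"
    using act_free [OF section_closed] u w \<gamma>(1) by (simp add: act_mult section_closed L.lift_Spin Spin_mult)
  with \<gamma> show "\<exists>\<gamma>\<in>\<Gamma>. y = motion_apply \<gamma> x \<and> w = \<epsilon> \<gamma> * u"
    by blast
next
  assume "\<exists>\<gamma>\<in>\<Gamma>. y = motion_apply \<gamma> x \<and> w = \<epsilon> \<gamma> * u"
  then obtain \<gamma> where \<gamma>: "\<gamma> \<in> \<Gamma>" "y = motion_apply \<gamma> x" "w = \<epsilon> \<gamma> * u" by blast
  then have "s y \<cdot> w = s y \<cdot> \<epsilon> \<gamma> \<cdot> u"
    using u by (simp add: act_mult section_closed L.lift_Spin)
  then show "s x \<cdot> u = s y \<cdot> w"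
    using framed_section(3) \<gamma> by simp
qed

lemma chart_surj:
  assumes p: "p \<in> M"
  obtains x u where "u \<in> Spin" "p = s x \<cdot> u"
proof -
  have "projection P p \<in> topspace base.quot"
    using continuous_map_funspace [OF continuous_projection] p by auto
  then obtain x where "projection P p = base.cls x"
    by (auto simp: base.topspace_quot)
  then have "projection P (s x) = projection P p"
    using projection_eq_base [OF section_closed framed_section(2)] by simp
  then show ?thesis
    using act_transitive [OF section_closed p] that by metis
qed

text \<open>
  The chart is open because its composite with \<open>\<Lambda>\<close> is the composite of the double cover of frames and the
  orbit map, which are open.
\<close>

lemma quotient_map_chart: "quotient_map L.spin_frames (total_space P) chart"
proof -
  have "continuous_map L.spin_frames (prod_topology (total_space P) (top_of_set Spin)) (\<lambda>(x, u). (s x, u))"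
    using framed_section(1) by (simp add: continuous_map_prod_top)
  then have "continuous_map L.spin_frames (total_space P) ((\<lambda>(p, u). p \<cdot> u) \<circ> (\<lambda>(x, u). (s x, u)))"
    using continuous_act by (rule continuous_map_compose)
  then have c: "continuous_map L.spin_frames (total_space P) chart"
    by (simp add: o_def chart_def case_prod_unfold)
  have "open_map L.spin_frames frame.quot (\<Lambda> \<circ> chart)"
    using L.associated_covering_composite(2)
    by (rule open_map_eq) (auto simp: chart_def \<Lambda>_chart L.associated_covering_cls)
  with covering c have "open_map L.spin_frames (total_space P) chart"
    by (rule two_fold_covering_open_map_lift)
  moreover have "chart ` topspace L.spin_frames = M"
  proof (intro equalityI subsetI)
    fix p assume "p \<in> M"
    then show "p \<in> chart ` topspace L.spin_frames"
      by (rule chart_surj) (auto simp: chart_def)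
  qed (auto simp: chart_def act_closed section_closed)
  ultimately show ?thesis
    using c by (simp add: continuous_open_imp_quotient_map)
qed

end

end

section \<open>Classification of spin structures\<close>

lemma bij_betw_quotient:
  assumes R: "R \<subseteq> A \<times> A" and h: "h ` A = B"
    and eq: "\<And>x y. x \<in> A \<Longrightarrow> y \<in> A \<Longrightarrow> (x, y) \<in> R \<longleftrightarrow> h x = h y"
  shows "bij_betw (\<lambda>c. the_elem (h ` c)) (A // R) B"
proof -
  have cls: "R `` {x} = {y \<in> A. h y = h x}" if "x \<in> A" for x
    using R eq [OF that] by auto
  have val: "the_elem (h ` (R `` {x})) = h x" if "x \<in> A" for x
  proof -
    have "h ` (R `` {x}) = {h x}"
      unfolding cls [OF that] using that by auto
    then show ?thesis by simp
  qed
  show ?thesis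
  proof (rule bij_betw_imageI)
    show "inj_on (\<lambda>c. the_elem (h ` c)) (A // R)"
    proof (rule inj_onI)
      fix c d assume c: "c \<in> A // R" and d: "d \<in> A // R" and e: "the_elem (h ` c) = the_elem (h ` d)"
      from c obtain x where x: "x \<in> A" "c = R `` {x}" by (rule quotientE)
      from d obtain y where y: "y \<in> A" "d = R `` {y}" by (rule quotientE)
      have "h x = h y"
        using e val x y by metis
      then show "c = d"
        by (simp only: x(2) y(2) cls [OF x(1)] cls [OF y(1)])
    qed
    show "(\<lambda>c. the_elem (h ` c)) ` (A // R) = B"
    proof -
      have "(\<lambda>c. the_elem (h ` c)) ` (A // R) = (\<lambda>x. the_elem (h ` (R `` {x}))) ` A"
        by (auto simp: quotient_def)
      also have "\<dots> = h ` A"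
        using val by (intro image_cong) auto
      finally show ?thesis
        by (simp only: h)
    qed
  qed
qed

context oriented_bieberbach_group
begin

lemma framing_section_closed:
  assumes "framing P \<Lambda> \<epsilon> s"
  shows "s x \<in> topspace (total_space P)"
  using assms continuous_map_funspace [of euclidean "total_space P" s] by (auto simp: framing_def)

lemma framing_isomorphic:
  assumes iso: "spin_isomorphic (P, \<Lambda>) (P\<^sub>1, \<Lambda>\<^sub>1)" and fr: "framing P \<Lambda> \<epsilon> s"
  obtains s\<^sub>1 where "framing P\<^sub>1 \<Lambda>\<^sub>1 \<epsilon> s\<^sub>1"
proof -
  obtain f where f: "homeomorphic_map (total_space P) (total_space P\<^sub>1) f"
    "\<And>p. p \<in> topspace (total_space P) \<Longrightarrow> \<Lambda>\<^sub>1 (f p) = \<Lambda> p"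
    "\<And>p u. p \<in> topspace (total_space P) \<Longrightarrow> u \<in> Spin \<Longrightarrow> f (right_action P p u) = right_action P\<^sub>1 (f p) u"
    using iso unfolding spin_isomorphic_def prod.case by blast
  have sM: "s x \<in> topspace (total_space P)" for x
    using framing_section_closed [OF fr] .
  have "continuous_map euclidean (total_space P\<^sub>1) (f \<circ> s)"
    using fr homeomorphic_imp_continuous_map [OF f(1)] by (auto simp: framing_def intro: continuous_map_compose)
  moreover have "right_action P\<^sub>1 (f (s (motion_apply \<gamma> x))) (\<epsilon> \<gamma>) = f (s x)" if "\<gamma> \<in> \<Gamma>" for \<gamma> x
    using fr that f(3) [OF sM, symmetric] by (simp add: framing_def)
  ultimately have "framing P\<^sub>1 \<Lambda>\<^sub>1 \<epsilon> (f \<circ> s)"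
    using fr f(2) [OF sM] by (simp add: framing_def)
  then show ?thesis
    using that by blast
qed

lemma isomorphic_framed:
  assumes P: "flat_spin_structure \<Gamma> P \<Lambda>" and P1: "flat_spin_structure \<Gamma> P\<^sub>1 \<Lambda>\<^sub>1"
    and lift: "spin_lift \<Gamma> \<epsilon>" and fr: "framing P \<Lambda> \<epsilon> s" and fr1: "framing P\<^sub>1 \<Lambda>\<^sub>1 \<epsilon> s\<^sub>1"
  shows "spin_isomorphic (P, \<Lambda>) (P\<^sub>1, \<Lambda>\<^sub>1)"
proof -
  interpret A: flat_spin_structure \<Gamma> P \<Lambda> by (rule P)
  interpret B: flat_spin_structure \<Gamma> P\<^sub>1 \<Lambda>\<^sub>1 by (rule P1)
  let ?T = "prod_topology euclidean (top_of_set (Spin :: 'n clifford set))"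
  let ?a = "\<lambda>(x, u). right_action P (s x) u" and ?b = "\<lambda>(x, u). right_action P\<^sub>1 (s\<^sub>1 x) u"
  have "quotient_map ?T (total_space P) ?a" "quotient_map ?T (total_space P\<^sub>1) ?b"
    using A.quotient_map_chart [OF lift fr] B.quotient_map_chart [OF lift fr1]
    unfolding A.chart_def [OF lift fr] B.chart_def [OF lift fr1] .
  moreover have "?a t = ?a t' \<longleftrightarrow> ?b t = ?b t'" if "t \<in> topspace ?T" "t' \<in> topspace ?T" for t t'
    using that A.chart_eq_iff [OF lift fr] B.chart_eq_iff [OF lift fr1] by (cases t; cases t') simp
  ultimately have "\<exists>h. homeomorphic_map (total_space P) (total_space P\<^sub>1) h \<and> (\<forall>t\<in>topspace ?T. h (?a t) = ?b t)"
    by (rule quotient_maps_same_fibres)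
  then obtain h where h: "homeomorphic_map (total_space P) (total_space P\<^sub>1) h"
    and h_eq: "\<And>x u. u \<in> Spin \<Longrightarrow> h (right_action P (s x) u) = right_action P\<^sub>1 (s\<^sub>1 x) u"
    by auto
  have "projection P\<^sub>1 (h p) = projection P p \<and> \<Lambda>\<^sub>1 (h p) = \<Lambda> p \<and>
      (\<forall>w\<in>Spin. h (right_action P p w) = right_action P\<^sub>1 (h p) w)"
    if p: "p \<in> topspace (total_space P)" for p
  proof -
    obtain x u where u: "u \<in> Spin" and p_eq: "p = right_action P (s x) u"
      using A.chart_surj [OF lift fr p] by blast
    have "h (right_action P p w) = right_action P\<^sub>1 (h p) w" if "w \<in> Spin" for w
      using u that framing_section_closed [OF fr] framing_section_closed [OF fr1]
      by (simp add: p_eq A.act_mult B.act_mult h_eq Spin_mult)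
    moreover have "projection P\<^sub>1 (h p) = projection P p" "\<Lambda>\<^sub>1 (h p) = \<Lambda> p"
      using u by (simp_all add: p_eq h_eq A.projection_chart [OF lift fr] B.projection_chart [OF lift fr1]
          A.\<Lambda>_chart [OF lift fr] B.\<Lambda>_chart [OF lift fr1])
    ultimately show ?thesis by blast
  qed
  then show ?thesis
    using h unfolding spin_isomorphic_def prod.case by blast
qed

text \<open>
  The associated bundle has the framing \<open>x \<mapsto> [(x, 1)]\<close>.  The framing is carried over to an isomorphic spin
  structure on the point type that is used for isomorphism classes.
\<close>

lemma framing_associated:
  assumes "spin_lift \<Gamma> \<epsilon>"
  obtains P :: "('n frame set \<times> bool, (real ^ 'n::_) set, 'n clifford) bundle_data" and \<Lambda> s
  where "spin_structure (flat_manifold \<Gamma>) (frame_bundle \<Gamma>) (P, \<Lambda>)" "framing P \<Lambda> \<epsilon> s"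
proof -
  interpret spin_lift \<Gamma> \<epsilon> by (rule assms)
  let ?s = "\<lambda>x. spin.cls (x, 1)"
  have "continuous_map euclidean spin_frames (\<lambda>x. (x, 1))"
    by (simp add: continuous_map_paired continuous_map_const)
  then have "continuous_map euclidean spin.quot ?s"
    using continuous_map_compose [OF _ spin.continuous_map_cls] by (auto simp: o_def)
  moreover have "right_action associated_bundle (?s (motion_apply \<gamma> x)) (\<epsilon> \<gamma>) = ?s x" if "\<gamma> \<in> \<Gamma>" for \<gamma> x
    using spin.cls_action [OF that, of "(x, 1)"] by (simp add: right_action_spin_cls spin_motion_eq)
  ultimately have fr: "framing associated_bundle associated_covering \<epsilon> ?s"
    by (simp add: framing_def total_space_associated associated_covering_cls lift_Spin)
  obtain S\<^sub>1 :: "('n frame set \<times> bool, (real ^ 'n::_) set, 'n clifford) bundle_data \<times> ('n frame set \<times> bool \<Rightarrow> 'n frame set)"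
    where S1: "spin_structure (flat_manifold \<Gamma>) (frame_bundle \<Gamma>) S\<^sub>1"
      "spin_isomorphic (associated_bundle, associated_covering) S\<^sub>1"
    using spin_structure_universe [OF spin_structure_associated] by blast
  obtain P \<Lambda> where S1_eq: "S\<^sub>1 = (P, \<Lambda>)" by (metis surj_pair)
  show ?thesis
    using framing_isomorphic [OF S1(2) [unfolded S1_eq] fr] S1(1) that unfolding S1_eq by blast
qed

text \<open>
  The function \<open>h\<close> sends a spin structure to the extensional lift of its framings.  It is onto by
  \<open>framing_associated\<close>, and its fibres are the isomorphism classes by \<open>framing_isomorphic\<close> and
  \<open>isomorphic_framed\<close>.
\<close>

theorem spin_structures_bij_lifts:
  "\<exists>\<beta>. bij_betw \<beta> (spin_structure_classes (flat_manifold \<Gamma>) (frame_bundle \<Gamma>))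
    {\<epsilon> \<in> extensional \<Gamma>. spin_lift \<Gamma> \<epsilon>}"
proof -
  define A where "A = {S :: ('n frame set \<times> bool, (real ^ 'n::_) set, 'n clifford) bundle_data \<times> ('n frame set \<times> bool \<Rightarrow> 'n frame set).
    spin_structure (flat_manifold \<Gamma>) (frame_bundle \<Gamma>) S}"
  define E where "E = {\<epsilon> \<in> extensional \<Gamma>. spin_lift \<Gamma> \<epsilon>}"
  define R where "R = {(S, S\<^sub>1). S \<in> A \<and> S\<^sub>1 \<in> A \<and> spin_isomorphic S S\<^sub>1}"
  define Fr where "Fr = (\<lambda>S \<epsilon>. \<epsilon> \<in> E \<and> (\<exists>s. framing (fst S :: ('n frame set \<times> bool, (real ^ 'n::_) set, 'n clifford) bundle_data) (snd S) \<epsilon> s))"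
  define h where "h = (\<lambda>S. THE \<epsilon>. Fr S \<epsilon>)"
  have struct: "flat_spin_structure \<Gamma> (fst S) (snd S)" if "S \<in> A" for S
    using that by unfold_locales (simp add: A_def)
  have ex: "\<exists>\<epsilon>. Fr S \<epsilon>" if "S \<in> A" for S
  proof -
    interpret flat_spin_structure \<Gamma> "fst S" "snd S" by (rule struct [OF that])
    obtain \<epsilon> s where \<epsilon>: "spin_lift \<Gamma> \<epsilon>" "framing (fst S) (snd S) \<epsilon> s"
      by (rule framing_exists)
    interpret L: spin_lift \<Gamma> \<epsilon> by (rule \<epsilon>(1))
    have "spin_lift \<Gamma> (restrict \<epsilon> \<Gamma>)"
      by unfold_locales (simp_all add: L.lift_Spin L.lift_mult L.lift_cover mult_mem)
    moreover have "framing (fst S) (snd S) (restrict \<epsilon> \<Gamma>) s"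
      using \<epsilon>(2) by (simp add: framing_def)
    ultimately show ?thesis
      by (auto simp: Fr_def E_def)
  qed
  have unique: "\<epsilon> = \<epsilon>'" if "S \<in> A" "Fr S \<epsilon>" "Fr S \<epsilon>'" for S \<epsilon> \<epsilon>'
  proof (rule extensionalityI)
    show "\<epsilon> \<in> extensional \<Gamma>" "\<epsilon>' \<in> extensional \<Gamma>"
      using that by (auto simp: Fr_def E_def)
    fix \<gamma> assume "\<gamma> \<in> \<Gamma>"
    then show "\<epsilon> \<gamma> = \<epsilon>' \<gamma>"
      using flat_spin_structure.framing_unique [OF struct [OF that(1)]] that(2,3) unfolding Fr_def by blast
  qed
  have h: "Fr S (h S)" if "S \<in> A" for S
    unfolding h_def using ex [OF that] unique [OF that] by (metis theI)
  have h_eqI: "h S = \<epsilon>" if "S \<in> A" "Fr S \<epsilon>" for S \<epsilon>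
    using unique [OF that(1) h [OF that(1)] that(2)] .
  have "bij_betw (\<lambda>c. the_elem (h ` c)) (A // R) E"
  proof (rule bij_betw_quotient)
    show "R \<subseteq> A \<times> A"
      by (auto simp: R_def)
    show "h ` A = E"
    proof (intro equalityI subsetI)
      fix \<epsilon> assume "\<epsilon> \<in> h ` A"
      then show "\<epsilon> \<in> E"
        using h by (auto simp: Fr_def)
    next
      fix \<epsilon> assume \<epsilon>: "\<epsilon> \<in> E"
      then obtain P :: "('n frame set \<times> bool, (real ^ 'n::_) set, 'n clifford) bundle_data" and \<Lambda> s
        where P: "spin_structure (flat_manifold \<Gamma>) (frame_bundle \<Gamma>) (P, \<Lambda>)" "framing P \<Lambda> \<epsilon> s"
        using framing_associated [of \<epsilon>] by (auto simp: E_def)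
      then have "h (P, \<Lambda>) = \<epsilon>"
        using \<epsilon> by (intro h_eqI) (auto simp: A_def Fr_def)
      then show "\<epsilon> \<in> h ` A"
        using P(1) by (auto simp: A_def)
    qed
    fix S S' assume S: "S \<in> A" and S': "S' \<in> A"
    show "(S, S') \<in> R \<longleftrightarrow> h S = h S'"
    proof
      assume "(S, S') \<in> R"
      then have iso: "spin_isomorphic (fst S, snd S) (fst S', snd S')"
        by (simp add: R_def)
      obtain s where s: "framing (fst S) (snd S) (h S) s"
        using h [OF S] by (auto simp: Fr_def)
      obtain s' where "framing (fst S') (snd S') (h S) s'"
        using framing_isomorphic [OF iso s] by blast
      then have "Fr S' (h S)"
        using h [OF S] by (auto simp: Fr_def)
      then show "h S = h S'"
        using h_eqI [OF S'] by simp
    next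
      assume eq: "h S = h S'"
      obtain s where s: "framing (fst S) (snd S) (h S) s" and lift: "spin_lift \<Gamma> (h S)"
        using h [OF S] by (auto simp: Fr_def E_def)
      obtain s' where s': "framing (fst S') (snd S') (h S) s'"
        using h [OF S'] unfolding eq [symmetric] by (auto simp: Fr_def)
      have "spin_isomorphic (fst S, snd S) (fst S', snd S')"
        by (rule isomorphic_framed [OF struct [OF S] struct [OF S'] lift s s'])
      then show "(S, S') \<in> R"
        using S S' by (simp add: R_def)
    qed
  qed
  moreover have "A // R = spin_structure_classes (flat_manifold \<Gamma>) (frame_bundle \<Gamma>)"
    by (simp add: spin_structure_classes_def A_def R_def)
  ultimately show ?thesis
    unfolding E_def by metis
qed

end

subsection \<open>Equivalent representations\<close>

text \<open>
  Composition with the automorphism of the Clifford algebra induced by \<open>U\<close>; its inverse is induced by the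
  transpose of \<open>U\<close>.
\<close>

lemma lifts_conjugate_bij:
  fixes U :: "real ^ 'n::_ ^ 'n::{finite,linorder}"
  assumes \<Gamma>: "subgroup \<Gamma> euclidean_group" and U: "orthogonal_matrix U"
    and \<phi>: "\<And>\<gamma>. \<gamma> \<in> \<Gamma> \<Longrightarrow> \<phi> (fst \<gamma>) = U ** fst \<gamma> ** transpose U"
  shows "bij_betw (\<lambda>\<epsilon>. restrict (clifford_map U \<circ> \<epsilon>) \<Gamma>)
    {\<epsilon> \<in> extensional \<Gamma>. \<epsilon> \<in> hom (euclidean_group\<lparr>carrier := \<Gamma>\<rparr>) spin_group \<and> (\<forall>\<gamma>\<in>\<Gamma>. spin_cover (\<epsilon> \<gamma>) = fst \<gamma>)}
    {\<epsilon> \<in> extensional \<Gamma>. \<epsilon> \<in> hom (euclidean_group\<lparr>carrier := \<Gamma>\<rparr>) spin_group \<and> (\<forall>\<gamma>\<in>\<Gamma>. spin_cover (\<epsilon> \<gamma>) = \<phi> (fst \<gamma>))}"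
    (is "bij_betw _ ?A ?B")
proof (rule bij_betw_byWitness)
  have U': "orthogonal_matrix (transpose U)"
    using U by simp
  have UU: "transpose U ** U = mat 1"
    using U by (simp add: orthogonal_matrix_def)
  have closed: "\<gamma> \<otimes>\<^bsub>euclidean_group\<^esub> \<delta> \<in> \<Gamma>" if "\<gamma> \<in> \<Gamma>" "\<delta> \<in> \<Gamma>" for \<gamma> \<delta>
    using subgroup.m_closed [OF \<Gamma> that] .
  let ?b = "\<lambda>\<epsilon>. restrict (clifford_map (transpose U) \<circ> \<epsilon>) \<Gamma>"
  show "\<forall>\<epsilon>\<in>?A. ?b (restrict (clifford_map U \<circ> \<epsilon>) \<Gamma>) = \<epsilon>"
    by (auto simp: clifford_map_transpose [OF U] intro!: extensionalityI [of _ \<Gamma>])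
  show "\<forall>\<epsilon>\<in>?B. restrict (clifford_map U \<circ> ?b \<epsilon>) \<Gamma> = \<epsilon>"
    using clifford_map_transpose [OF U'] by (auto intro!: extensionalityI [of _ \<Gamma>])
  have undo: "transpose U ** (U ** A ** transpose U) ** U = A" for A
    by (simp add: matrix_mul_assoc UU) (simp add: matrix_mul_assoc [symmetric] UU)
  show "(\<lambda>\<epsilon>. restrict (clifford_map U \<circ> \<epsilon>) \<Gamma>) ` ?A \<subseteq> ?B"
  proof (intro image_subsetI)
    fix \<epsilon> assume \<epsilon>: "\<epsilon> \<in> ?A"
    then have S: "\<epsilon> \<gamma> \<in> Spin" if "\<gamma> \<in> \<Gamma>" for \<gamma>
      using that by (auto simp: hom_def)
    show "restrict (clifford_map U \<circ> \<epsilon>) \<Gamma> \<in> ?B"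
      using \<epsilon> by (auto simp: hom_def closed clifford_map_mult [OF U] clifford_map_Spin [OF U S]
          spin_cover_clifford_map [OF U S] \<phi>)
  qed
  show "?b ` ?B \<subseteq> ?A"
  proof (intro image_subsetI)
    fix \<epsilon> assume \<epsilon>: "\<epsilon> \<in> ?B"
    then have S: "\<epsilon> \<gamma> \<in> Spin" if "\<gamma> \<in> \<Gamma>" for \<gamma>
      using that by (auto simp: hom_def)
    show "?b \<epsilon> \<in> ?A"
      using \<epsilon> by (auto simp: hom_def closed clifford_map_mult [OF U'] clifford_map_Spin [OF U' S]
          spin_cover_clifford_map [OF U' S] \<phi> undo)
  qed
qed

theorem corollary1:
  fixes \<Gamma> :: "'n::{finite,linorder} motion set"
    and \<phi> :: "real ^ 'n::_ ^ 'n::_ \<Rightarrow> real ^ 'n::_ ^ 'n::_"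
  assumes "bieberbach \<Gamma>"
    and "holonomy \<Gamma> \<subseteq> carrier SO_group"
    and "\<phi> \<in> hom (SO_group\<lparr>carrier := holonomy \<Gamma>\<rparr>) SO_group"
    and "\<exists>F. invertible F \<and> (\<forall>g\<in>holonomy \<Gamma>. \<phi> g = F ** g ** matrix_inv F)"
  shows "\<exists>\<beta>. bij_betw \<beta>
    (spin_structure_classes (flat_manifold \<Gamma>) (frame_bundle \<Gamma>))
    {\<epsilon> \<in> extensional \<Gamma>. \<epsilon> \<in> hom (euclidean_group\<lparr>carrier := \<Gamma>\<rparr>) spin_group \<and>
      (\<forall>\<gamma>\<in>\<Gamma>. spin_cover (\<epsilon> \<gamma>) = \<phi> (fst \<gamma>))}"
proof -
  interpret oriented_bieberbach_group \<Gamma>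
    using assms(1,2) by unfold_locales
  obtain F where F: "invertible F" "\<And>g. g \<in> holonomy \<Gamma> \<Longrightarrow> \<phi> g = F ** g ** matrix_inv F"
    using assms(4) by blast
  have "orthogonal_matrix g \<and> orthogonal_matrix (F ** g ** matrix_inv F)" if g: "g \<in> holonomy \<Gamma>" for g
  proof -
    have "\<phi> g \<in> carrier SO_group"
      using assms(3) g by (auto simp: hom_def)
    then show ?thesis
      using assms(2) g F(2) [OF g] by (auto simp: rotation_matrix_def)
  qed
  then obtain U where U: "orthogonal_matrix U"
    "\<And>g. g \<in> holonomy \<Gamma> \<Longrightarrow> F ** g ** matrix_inv F = U ** g ** transpose U"
    using orthogonal_conjugator [OF F(1)] by metis
  have "\<phi> (fst \<gamma>) = U ** fst \<gamma> ** transpose U" if "\<gamma> \<in> \<Gamma>" for \<gamma>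
    using F(2) U(2) that by (simp add: holonomy_def)
  note conj = lifts_conjugate_bij [OF subgroup U(1) this]
  have "{\<epsilon> \<in> extensional \<Gamma>. spin_lift \<Gamma> \<epsilon>} =
    {\<epsilon> \<in> extensional \<Gamma>. \<epsilon> \<in> hom (euclidean_group\<lparr>carrier := \<Gamma>\<rparr>) spin_group \<and> (\<forall>\<gamma>\<in>\<Gamma>. spin_cover (\<epsilon> \<gamma>) = fst \<gamma>)}"
    using oriented_bieberbach_group_axioms by (auto simp: spin_lift_def spin_lift_axioms_def hom_def)
  with spin_structures_bij_lifts conj show ?thesis
    by (metis (no_types, lifting) bij_betw_trans)
qed

end
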